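(* Let $G$ be a non-Hausdorff étale groupoid with Hausdorff cover $\tilde{G}$. If $G$ can be covered by countably many open bisections, then $C^*_r(\mathfrak{i})(J)=C^*_r(\mathfrak{i})(C^*_r(G))\cap\tilde{J}$.
   Context: Groupoids. A groupoid $G$ is a small category all of whose morphisms are invertible, identified with its set of morphisms; $G^{(0)}\subseteq G$ is its set of units, $r,s\colon G\to G^{(0)}$ are range and source, and $G_x=s^{-1}(x)$. Topological groupoids (continuous range, source, multiplication, inversion) are always assumed locally compact with $G^{(0)}$ Hausdorff in the subspace topology; $G$ itself need not be Hausdorff, and compact subsets need not be closed. $G$ is étale if $r$ is a local homeomorphism. An open bisection is an open subset $U\subseteq G$ on which $r$ and $s$ are injective ($U$ is then locally compact Hausdorff). Write $X=G^{(0)}$. $C^*$-algebras. For an open bisection $U$, $C_c(U)$ is the set of continuous functions $U\to\mathbb{C}$ with compact support in $U$, extended by zero to $G$; $\mathcal{C}_c(G)$ is the linear span of all $C_c(U)$, a $*$-algebra under $f^*(g)=\overline{f(g^{-1})}$ and convolution. For $x\in X$, $\pi_x\colon\mathcal{C}_c(G)\to\mathcal{L}(\ell^2(G_x))$ is $\pi_x(f)\xi=f*\xi$; $C^*_r(G)$ is the completion of $\mathcal{C}_c(G)$ in the norm $\sup_{x}\|\pi_x(f)\|$. Elements $f\in C^*_r(G)$ are viewed as functions on $G$ via $f(g)=\langle\pi_{s(g)}(f)\delta_{s(g)},\delta_g\rangle$ (similarly for $\tilde{G}$). With $\mathrm{supp}^\circ(f)=\{f\neq0\}$, the singular ideal is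 $J=\{f\in C^*_r(G):s(\mathrm{supp}^\circ(f))\text{ has empty interior}\}$. Hausdorff cover. Equip the set of closed subsets of $G$ with the Fell topology, with basis the sets $\{F: F\cap U_i\neq\emptyset\ (1\le i\le n),\ F\cap K=\emptyset\}$ for $U_1,\dots,U_n\subseteq G$ open and $K\subseteq G$ compact. $\tilde{G}$ is the closure of $\{\{g\}:g\in G\}$ in the space of non-empty closed subsets, and $\iota\colon G\to\tilde{G}$, $\iota(g)=\{g\}$. $\tilde{G}$ is a locally compact Hausdorff étale groupoid with unit space $\tilde{X}$ the closure of $\iota(X)$, source $\tilde{s}(\mathbf{g})=\{g_1^{-1}g_2:g_1,g_2\in\mathbf{g}\}$, range $\tilde{r}(\mathbf{g})=\{g_1g_2^{-1}:g_1,g_2\in\mathbf{g}\}$, and product (when $\tilde{s}(\mathbf{g})=\tilde{r}(\mathbf{h})$) and inverse those of subsets of $G$. The injective $*$-homomorphism $\mathfrak{i}\colon\mathcal{C}_c(G)\to C_c(\tilde{G})$, $\mathfrak{i}(f)(\mathbf{g})=\sum_{g\in\mathbf{g}}f(g)$, extends to an injective $*$-homomorphism $C^*_r(\mathfrak{i})\colon C^*_r(G)\to C^*_r(\tilde{G})$. Singular part of the cover. $\pi\colon\tilde{X}\to X$ is the continuous surjection determined by $\{\pi(\mathbf{x})\}=\mathbf{x}\cap X$. Let $\overline{X}$ be the closure of $X$ in $G$ and $D=s(\overline{X}\setminus X)=\pi(\tilde{X}\setminus\iota(X))$. Put $\tilde{X}_{\mathrm{sing}}=\mathrm{int}(\pi^{-1}(D))\subseteq\tilde{X}$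 (open and invariant), $\tilde{G}_{\mathrm{sing}}=\{\mathbf{g}\in\tilde{G}:\tilde{r}(\mathbf{g}),\tilde{s}(\mathbf{g})\in\tilde{X}_{\mathrm{sing}}\}$ and $\tilde{J}=\{\tilde{f}\in C^*_r(\tilde{G}):\mathrm{supp}^\circ(\tilde{f})\subseteq\tilde{G}_{\mathrm{sing}}\}$. *)

theory Defs
  imports "HOL-Analysis.Analysis"
begin

section \<open>Topological groupoids\<close>

text \<open>The set of morphisms is the carrier \<open>topspace (gtop G)\<close> of the topology; the values of the
  operations outside the carrier, and of \<open>gmul G g h\<close> when \<open>gsrc G g \<noteq> grng G h\<close>, are irrelevant.\<close>

record 'g groupoid_data =
  gtop :: "'g topology"
  gunits :: "'g set"
  gsrc :: "'g \<Rightarrow> 'g"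
  grng :: "'g \<Rightarrow> 'g"
  gmul :: "'g \<Rightarrow> 'g \<Rightarrow> 'g"
  ginv :: "'g \<Rightarrow> 'g"

abbreviation arrows :: "'g groupoid_data \<Rightarrow> 'g set" where
  "arrows G \<equiv> topspace (gtop G)"

abbreviation unit_top :: "'g groupoid_data \<Rightarrow> 'g topology" where
  "unit_top G \<equiv> subtopology (gtop G) (gunits G)"

definition fibre :: "'g groupoid_data \<Rightarrow> 'g \<Rightarrow> 'g set" where
  "fibre G x = {g \<in> arrows G. gsrc G g = x}"

locale groupoid =
  fixes G :: "'g groupoid_data"
  assumes units_subset: "gunits G \<subseteq> arrows G"
    and src_in: "g \<in> arrows G \<Longrightarrow> gsrc G g \<in> gunits G"
    and rng_in: "g \<in> arrows G \<Longrightarrow> grng G g \<in> gunits G"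
    and src_unit: "x \<in> gunits G \<Longrightarrow> gsrc G x = x"
    and rng_unit: "x \<in> gunits G \<Longrightarrow> grng G x = x"
    and mul_in: "\<lbrakk>g \<in> arrows G; h \<in> arrows G; gsrc G g = grng G h\<rbrakk> \<Longrightarrow> gmul G g h \<in> arrows G"
    and src_mul: "\<lbrakk>g \<in> arrows G; h \<in> arrows G; gsrc G g = grng G h\<rbrakk>
                   \<Longrightarrow> gsrc G (gmul G g h) = gsrc G h"
    and rng_mul: "\<lbrakk>g \<in> arrows G; h \<in> arrows G; gsrc G g = grng G h\<rbrakk>
                   \<Longrightarrow> grng G (gmul G g h) = grng G g"
    and mul_assoc: "\<lbrakk>g \<in> arrows G; h \<in> arrows G; k \<in> arrows G;
                     gsrc G g = grng G h; gsrc G h = grng G k\<rbrakk>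
                   \<Longrightarrow> gmul G (gmul G g h) k = gmul G g (gmul G h k)"
    and mul_src: "g \<in> arrows G \<Longrightarrow> gmul G g (gsrc G g) = g"
    and rng_mul_left: "g \<in> arrows G \<Longrightarrow> gmul G (grng G g) g = g"
    and inv_in: "g \<in> arrows G \<Longrightarrow> ginv G g \<in> arrows G"
    and src_inv: "g \<in> arrows G \<Longrightarrow> gsrc G (ginv G g) = grng G g"
    and rng_inv: "g \<in> arrows G \<Longrightarrow> grng G (ginv G g) = gsrc G g"
    and mul_inv_right: "g \<in> arrows G \<Longrightarrow> gmul G g (ginv G g) = grng G g"
    and mul_inv_left: "g \<in> arrows G \<Longrightarrow> gmul G (ginv G g) g = gsrc G g"

text \<open>Only the unit space is required to be Hausdorff.\<close>

locale topological_groupoid = groupoid G for G :: "'g groupoid_data" +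
  assumes continuous_src: "continuous_map (gtop G) (unit_top G) (gsrc G)"
    and continuous_rng: "continuous_map (gtop G) (unit_top G) (grng G)"
    and continuous_inv: "continuous_map (gtop G) (gtop G) (ginv G)"
    and continuous_mul:
      "continuous_map
         (subtopology (prod_topology (gtop G) (gtop G)) {(g, h). gsrc G g = grng G h})
         (gtop G) (\<lambda>(g, h). gmul G g h)"
    and locally_compact: "locally_compact_space (gtop G)"
    and Hausdorff_units: "Hausdorff_space (unit_top G)"

definition local_homeomorphism_map :: "'a topology \<Rightarrow> 'b topology \<Rightarrow> ('a \<Rightarrow> 'b) \<Rightarrow> bool" where
  "local_homeomorphism_map S T f \<longleftrightarrow>
     (\<forall>a \<in> topspace S. \<exists>U. openin S U \<and> a \<in> U \<and> openin T (f ` U) \<and>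
        homeomorphic_map (subtopology S U) (subtopology T (f ` U)) f)"

locale etale_groupoid = topological_groupoid G for G :: "'g groupoid_data" +
  assumes etale: "local_homeomorphism_map (gtop G) (unit_top G) (grng G)"

definition open_bisection :: "'g groupoid_data \<Rightarrow> 'g set \<Rightarrow> bool" where
  "open_bisection G U \<longleftrightarrow> openin (gtop G) U \<and> inj_on (grng G) U \<and> inj_on (gsrc G) U"

section \<open>Convolution algebra and reduced C*-algebra\<close>

text \<open>The support is compact in \<open>U\<close> and its closure is taken in \<open>U\<close>. The extension by zero of such
  a function need not be continuous on \<open>G\<close>.\<close>

definition Cc_bisection :: "'g groupoid_data \<Rightarrow> 'g set \<Rightarrow> ('g \<Rightarrow> complex) set" where
  "Cc_bisection G U =
     {f. continuous_map (subtopology (gtop G) U) euclidean f \<and>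
         compactin (subtopology (gtop G) U) (subtopology (gtop G) U closure_of {g \<in> U. f g \<noteq> 0}) \<and>
         (\<forall>g. g \<notin> U \<longrightarrow> f g = 0)}"

definition Cc :: "'g groupoid_data \<Rightarrow> ('g \<Rightarrow> complex) set" where
  "Cc G = {\<lambda>g. \<Sum>i<n. c i * f i g | (n::nat) (c :: nat \<Rightarrow> complex) f.
             \<forall>i<n. \<exists>U. open_bisection G U \<and> f i \<in> Cc_bisection G U}"

text \<open>The points of \<open>\<ell>\<^sup>2(G\<^sub>x)\<close> are functions on the whole type that vanish off the fibre.\<close>

definition ell2 :: "'g groupoid_data \<Rightarrow> 'g \<Rightarrow> ('g \<Rightarrow> complex) set" where
  "ell2 G x = {\<xi>. (\<forall>h. h \<notin> fibre G x \<longrightarrow> \<xi> h = 0) \<and>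
                  (\<lambda>h. (cmod (\<xi> h))\<^sup>2) summable_on fibre G x}"

definition ell2_norm :: "'g groupoid_data \<Rightarrow> 'g \<Rightarrow> ('g \<Rightarrow> complex) \<Rightarrow> real" where
  "ell2_norm G x \<xi> = sqrt (\<Sum>\<^sub>\<infinity>h\<in>fibre G x. (cmod (\<xi> h))\<^sup>2)"

definition ell2_inner :: "'g groupoid_data \<Rightarrow> 'g \<Rightarrow> ('g \<Rightarrow> complex) \<Rightarrow> ('g \<Rightarrow> complex) \<Rightarrow> complex" where
  "ell2_inner G x \<xi> \<eta> = (\<Sum>\<^sub>\<infinity>h\<in>fibre G x. \<xi> h * cnj (\<eta> h))"

definition delta :: "'g \<Rightarrow> 'g \<Rightarrow> complex" where
  "delta g = (\<lambda>h. if h = g then 1 else 0)"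

type_synonym 'g operator = "('g \<Rightarrow> complex) \<Rightarrow> ('g \<Rightarrow> complex)"

text \<open>Operators are extensional, so that two of them are equal iff they agree on \<open>\<ell>\<^sup>2(G\<^sub>x)\<close>.\<close>

definition bounded_operators :: "'g groupoid_data \<Rightarrow> 'g \<Rightarrow> 'g operator set" where
  "bounded_operators G x =
     {T \<in> ell2 G x \<rightarrow>\<^sub>E ell2 G x.
        (\<forall>\<xi>\<in>ell2 G x. \<forall>\<eta>\<in>ell2 G x. T (\<lambda>h. \<xi> h + \<eta> h) = (\<lambda>h. T \<xi> h + T \<eta> h)) \<and>
        (\<forall>c. \<forall>\<xi>\<in>ell2 G x. T (\<lambda>h. c * \<xi> h) = (\<lambda>h. c * T \<xi> h)) \<and>
        (\<exists>C. \<forall>\<xi>\<in>ell2 G x. ell2_norm G x (T \<xi>) \<le> C * ell2_norm G x \<xi>)}"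

definition op_norm :: "'g groupoid_data \<Rightarrow> 'g \<Rightarrow> 'g operator \<Rightarrow> ennreal" where
  "op_norm G x T = (SUP \<xi>\<in>{\<xi> \<in> ell2 G x. ell2_norm G x \<xi> \<le> 1}. ennreal (ell2_norm G x (T \<xi>)))"

definition convolution ::
    "'g groupoid_data \<Rightarrow> ('g \<Rightarrow> complex) \<Rightarrow> ('g \<Rightarrow> complex) \<Rightarrow> 'g \<Rightarrow> complex" where
  "convolution G f \<xi> g =
     (if g \<in> arrows G
      then \<Sum>\<^sub>\<infinity>h\<in>fibre G (gsrc G g). f (gmul G g (ginv G h)) * \<xi> h else 0)"

definition reg_rep :: "'g groupoid_data \<Rightarrow> 'g \<Rightarrow> ('g \<Rightarrow> complex) \<Rightarrow> 'g operator" where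
  "reg_rep G x f = restrict (\<lambda>\<xi>. convolution G f \<xi>) (ell2 G x)"

definition reg_family :: "'g groupoid_data \<Rightarrow> ('g \<Rightarrow> complex) \<Rightarrow> 'g \<Rightarrow> 'g operator" where
  "reg_family G f = restrict (\<lambda>x. reg_rep G x f) (gunits G)"

definition family_norm :: "'g groupoid_data \<Rightarrow> ('g \<Rightarrow> 'g operator) \<Rightarrow> ennreal" where
  "family_norm G T = (SUP x\<in>gunits G. op_norm G x (T x))"

text \<open>The map \<open>reg_family G\<close> is an isometric embedding of \<open>Cc G\<close>, with the reduced norm
  \<open>sup\<^sub>x \<parallel>\<pi>\<^sub>x(f)\<parallel>\<close>, into the (complete) C*-algebra of norm-bounded families in the product of the
  algebras of bounded operators on \<open>\<ell>\<^sup>2(G\<^sub>x)\<close>. The completion of \<open>Cc G\<close> is therefore realised as the closure of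
  its image, and the continuous extension of \<open>\<pi>\<^sub>x\<close> to it is evaluation \<open>T \<mapsto> T x\<close>. Subtraction of
  families is pointwise, and \<open>family_norm\<close> only looks at their values on \<open>\<ell>\<^sup>2(G\<^sub>x)\<close>.\<close>

definition Cstar_red :: "'g groupoid_data \<Rightarrow> ('g \<Rightarrow> 'g operator) set" where
  "Cstar_red G =
     {T \<in> (\<Pi>\<^sub>E x\<in>gunits G. bounded_operators G x).
        \<forall>\<epsilon>>0. \<exists>f\<in>Cc G. family_norm G (T - reg_family G f) < \<epsilon>}"

definition as_function :: "'g groupoid_data \<Rightarrow> ('g \<Rightarrow> 'g operator) \<Rightarrow> 'g \<Rightarrow> complex" where
  "as_function G T g = ell2_inner G (gsrc G g) (T (gsrc G g) (delta (gsrc G g))) (delta g)"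

definition open_supp :: "'g groupoid_data \<Rightarrow> ('g \<Rightarrow> 'g operator) \<Rightarrow> 'g set" where
  "open_supp G T = {g \<in> arrows G. as_function G T g \<noteq> 0}"

definition singular_ideal :: "'g groupoid_data \<Rightarrow> ('g \<Rightarrow> 'g operator) set" where
  "singular_ideal G =
     {T \<in> Cstar_red G. unit_top G interior_of (gsrc G ` open_supp G T) = {}}"

section \<open>The Hausdorff cover\<close>

definition fell_topology :: "'a topology \<Rightarrow> 'a set topology" where
  "fell_topology S = topology_generated_by
     {{F. closedin S F \<and> (\<forall>U\<in>\<U>. F \<inter> U \<noteq> {}) \<and> F \<inter> K = {}} | \<U> K.
        finite \<U> \<and> (\<forall>U\<in>\<U>. openin S U) \<and> compactin S K}"

definition set_mul :: "'g groupoid_data \<Rightarrow> 'g set \<Rightarrow> 'g set \<Rightarrow> 'g set" where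
  "set_mul G A B = {gmul G g h | g h. g \<in> A \<and> h \<in> B \<and> gsrc G g = grng G h}"

definition cover_carrier :: "'g groupoid_data \<Rightarrow> 'g set set" where
  "cover_carrier G =
     subtopology (fell_topology (gtop G)) {F. F \<noteq> {}} closure_of ((\<lambda>g. {g}) ` arrows G)"

definition cover_top :: "'g groupoid_data \<Rightarrow> 'g set topology" where
  "cover_top G = subtopology (fell_topology (gtop G)) (cover_carrier G)"

definition hausdorff_cover :: "'g groupoid_data \<Rightarrow> 'g set groupoid_data" where
  "hausdorff_cover G =
     \<lparr>gtop = cover_top G,
      gunits = cover_top G closure_of ((\<lambda>x. {x}) ` gunits G),
      gsrc = (\<lambda>A. set_mul G (ginv G ` A) A),
      grng = (\<lambda>A. set_mul G A (ginv G ` A)),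
      gmul = set_mul G,
      ginv = (\<lambda>A. ginv G ` A)\<rparr>"

text \<open>For \<open>f \<in> Cc G\<close> the sum below has only finitely many nonzero terms.\<close>

definition cover_map :: "'g groupoid_data \<Rightarrow> ('g \<Rightarrow> complex) \<Rightarrow> 'g set \<Rightarrow> complex" where
  "cover_map G f A = (if A \<in> arrows (hausdorff_cover G) then \<Sum>\<^sub>\<infinity>g\<in>A. f g else 0)"

text \<open>The extension by continuity of \<open>cover_map G\<close> to the reduced C*-algebras.\<close>

definition Cstar_cover_map ::
    "'g groupoid_data \<Rightarrow> ('g \<Rightarrow> 'g operator) \<Rightarrow> ('g set \<Rightarrow> 'g set operator)" where
  "Cstar_cover_map G T =
     (THE S. S \<in> Cstar_red (hausdorff_cover G) \<and>
        (\<forall>f :: nat \<Rightarrow> 'g \<Rightarrow> complex.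
           (\<forall>n. f n \<in> Cc G) \<and> (\<lambda>n. family_norm G (T - reg_family G (f n))) \<longlonglongrightarrow> 0 \<longrightarrow>
           (\<lambda>n. family_norm (hausdorff_cover G)
              (S - reg_family (hausdorff_cover G) (cover_map G (f n)))) \<longlonglongrightarrow> 0))"

section \<open>The singular part of the cover\<close>

definition cover_proj :: "'g groupoid_data \<Rightarrow> 'g set \<Rightarrow> 'g" where
  "cover_proj G A = the_elem (A \<inter> gunits G)"

definition nonHausdorff_units :: "'g groupoid_data \<Rightarrow> 'g set" where
  "nonHausdorff_units G = gsrc G ` (gtop G closure_of gunits G - gunits G)"

definition cover_units_sing :: "'g groupoid_data \<Rightarrow> 'g set set" where
  "cover_units_sing G =
     unit_top (hausdorff_cover G) interior_of
       {A \<in> gunits (hausdorff_cover G). cover_proj G A \<in> nonHausdorff_units G}"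

definition cover_sing :: "'g groupoid_data \<Rightarrow> 'g set set" where
  "cover_sing G =
     {A \<in> arrows (hausdorff_cover G).
        grng (hausdorff_cover G) A \<in> cover_units_sing G \<and>
        gsrc (hausdorff_cover G) A \<in> cover_units_sing G}"

definition cover_singular_ideal :: "'g groupoid_data \<Rightarrow> ('g set \<Rightarrow> 'g set operator) set" where
  "cover_singular_ideal G =
     {S \<in> Cstar_red (hausdorff_cover G). open_supp (hausdorff_cover G) S \<subseteq> cover_sing G}"

end

theory Submission
  imports Defs
begin

text \<open>The image of \<open>T\<close> in the algebra of the cover, viewed as a function, has at a closed set \<open>Z\<close> the
  limit of the values \<open>T(z)\<close> along the singletons \<open>{z}\<close> that converge to \<open>Z\<close> in the Fell topology.
  Write \<open>D\<close> for the non-Hausdorff units. If the image of \<open>T\<close> does not vanish at \<open>A\<close> and the source of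
  \<open>A\<close> is outside the singular part, then this source is a limit of singletons of units \<open>z\<close> not in
  \<open>D\<close>, and a local section through \<open>A\<close> gives an arrow \<open>g\<close> with \<open>T(g) \<noteq> 0\<close> and source \<open>z\<close>. Near such
  an arrow the map \<open>g \<mapsto> {g}\<close> is continuous, so \<open>T\<close> does not vanish on a neighbourhood of \<open>g\<close>, and the
  source of the support of \<open>T\<close> has interior points. The range is treated by inversion.
  Conversely, an element of the ideal of the cover that comes from \<open>T\<close> forces the source of the support
  of \<open>T\<close> into \<open>D\<close>, which is meagre: the closure of the units minus the units meets each bisection of
  the countable cover in a set whose source is nowhere dense.

  The map of the algebras exists because \<open>f \<mapsto> cover_map G f\<close> is contractive: finite matrices of
  \<open>cover_map G f\<close> are limits of finite matrices of \<open>f\<close>.\<close>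

section \<open>Operators on the fibres\<close>

text \<open>Compact subsets of \<open>G\<close> need not be closed, so a Fell neighbourhood of
  \<open>{g}\<close> may require that a compact set accumulating at \<open>g\<close> be avoided;
  this is how \<open>g \<mapsto> {g}\<close> can fail to be continuous. It fails at \<open>g\<close>
  only if some other arrow \<open>k\<close> cannot be separated from \<open>g\<close>. Such a pair
  has equal sources and equal ranges, and the product of the inverse of \<open>g\<close> with
  \<open>k\<close> is a non-unit in the closure of the units; so both the source and the range of
  \<open>g\<close> lie in \<open>D\<close>.

  The norm of a convolution operator is the supremum of the norms of its finite square blocks. A
  block contains only finitely many values of the function, so bounds on blocks pass to pointwise
  limits. The lemmas on blocks are stated for bare \<open>groupoid_data\<close>, so that they apply
  to the cover as well. The matrix entries on the cover only involve products
  \<open>A B\<^sup>-\<^sup>1\<close> of arrows with equal source, and these are computed explicitly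
  as translates \<open>g X h\<^sup>-\<^sup>1\<close> of the common source \<open>X\<close>.\<close>

lemma sum_cmod_sq_le_iff_L2_set:
  assumes "0 \<le> c"
  shows "(\<Sum>h\<in>E. (cmod (\<xi> h))\<^sup>2) \<le> c\<^sup>2 \<longleftrightarrow> L2_set (\<lambda>h. cmod (\<xi> h)) E \<le> c"
  unfolding L2_set_def using assms real_sqrt_le_iff[of _ "c\<^sup>2"] by simp

text \<open>A series of nonnegative terms converges once its finite partial sums are bounded. Hence
  the triangle inequality and the operator bounds below only have to be proved for
  \<open>L2_set\<close> over finite subsets of a fibre.\<close>

lemma ell2_bounded:
  assumes "\<And>h. h \<notin> fibre G x \<Longrightarrow> \<xi> h = 0" "0 \<le> c"
    and "\<And>E. finite E \<Longrightarrow> E \<subseteq> fibre G x \<Longrightarrow> L2_set (\<lambda>h. cmod (\<xi> h)) E \<le> c"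
  shows "\<xi> \<in> ell2 G x" "ell2_norm G x \<xi> \<le> c"
proof -
  have bd: "(\<Sum>h\<in>E. (cmod (\<xi> h))\<^sup>2) \<le> c\<^sup>2" if "finite E" "E \<subseteq> fibre G x" for E
    using assms that sum_cmod_sq_le_iff_L2_set by blast
  have "(\<lambda>h. (cmod (\<xi> h))\<^sup>2) summable_on fibre G x"
    by (rule nonneg_bdd_above_summable_on) (auto intro!: bdd_aboveI2[where M = "c\<^sup>2"] bd)
  moreover from this have "(\<Sum>\<^sub>\<infinity>h\<in>fibre G x. (cmod (\<xi> h))\<^sup>2) \<le> c\<^sup>2"
    by (rule infsum_le_finite_sums) (use bd in auto)
  ultimately show "\<xi> \<in> ell2 G x" "ell2_norm G x \<xi> \<le> c"
    using assms(1,2) real_sqrt_le_mono by (fastforce simp: ell2_def ell2_norm_def)+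
qed

lemma ell2_norm_nonneg: "0 \<le> ell2_norm G x \<xi>"
  by (simp add: ell2_norm_def infsum_nonneg)

lemma ell2_zero_off: "\<xi> \<in> ell2 G x \<Longrightarrow> h \<notin> fibre G x \<Longrightarrow> \<xi> h = 0"
  by (simp add: ell2_def)

lemma L2_set_le_ell2_norm:
  assumes "\<xi> \<in> ell2 G x" "finite E" "E \<subseteq> fibre G x"
  shows "L2_set (\<lambda>h. cmod (\<xi> h)) E \<le> ell2_norm G x \<xi>"
  unfolding L2_set_def ell2_norm_def
  using assms by (intro real_sqrt_le_mono finite_sum_le_infsum) (auto simp: ell2_def)

lemma cmod_le_ell2_norm:
  assumes "\<xi> \<in> ell2 G x" "h \<in> fibre G x"
  shows "cmod (\<xi> h) \<le> ell2_norm G x \<xi>"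
  using L2_set_le_ell2_norm[OF assms(1), of "{h}"] assms(2) by simp

lemma ell2_add:
  assumes "\<xi> \<in> ell2 G x" "\<eta> \<in> ell2 G x"
  shows "(\<lambda>h. \<xi> h + \<eta> h) \<in> ell2 G x"
    "ell2_norm G x (\<lambda>h. \<xi> h + \<eta> h) \<le> ell2_norm G x \<xi> + ell2_norm G x \<eta>"
proof -
  have bd: "L2_set (\<lambda>h. cmod (\<xi> h + \<eta> h)) E \<le> ell2_norm G x \<xi> + ell2_norm G x \<eta>"
    if "finite E" "E \<subseteq> fibre G x" for E
  proof -
    have "L2_set (\<lambda>h. cmod (\<xi> h + \<eta> h)) E \<le> L2_set (\<lambda>h. cmod (\<xi> h) + cmod (\<eta> h)) E"
      by (intro L2_set_mono norm_triangle_ineq) simp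
    also have "\<dots> \<le> L2_set (\<lambda>h. cmod (\<xi> h)) E + L2_set (\<lambda>h. cmod (\<eta> h)) E"
      by (rule L2_set_triangle_ineq)
    finally show ?thesis
      using L2_set_le_ell2_norm[OF assms(1) that] L2_set_le_ell2_norm[OF assms(2) that] by simp
  qed
  have off: "\<xi> h + \<eta> h = 0" if "h \<notin> fibre G x" for h
    using assms that by (simp add: ell2_zero_off)
  show "(\<lambda>h. \<xi> h + \<eta> h) \<in> ell2 G x"
    "ell2_norm G x (\<lambda>h. \<xi> h + \<eta> h) \<le> ell2_norm G x \<xi> + ell2_norm G x \<eta>"
    using ell2_bounded[where G = G and x = x and \<xi> = "\<lambda>h. \<xi> h + \<eta> h", OF off _ bd]
    by (simp_all add: add_nonneg_nonneg ell2_norm_nonneg)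
qed

lemma ell2_scale:
  assumes "\<xi> \<in> ell2 G x"
  shows "(\<lambda>h. c * \<xi> h) \<in> ell2 G x" "ell2_norm G x (\<lambda>h. c * \<xi> h) = cmod c * ell2_norm G x \<xi>"
proof -
  show "(\<lambda>h. c * \<xi> h) \<in> ell2 G x"
    using assms by (auto simp: ell2_def norm_mult power_mult_distrib intro: summable_on_cmult_right)
  show "ell2_norm G x (\<lambda>h. c * \<xi> h) = cmod c * ell2_norm G x \<xi>"
    by (simp add: ell2_norm_def norm_mult power_mult_distrib infsum_cmult_right' real_sqrt_mult)
qed

lemma ell2_diff:
  assumes "\<xi> \<in> ell2 G x" "\<eta> \<in> ell2 G x"
  shows "(\<lambda>h. \<xi> h - \<eta> h) \<in> ell2 G x"
    "ell2_norm G x (\<lambda>h. \<xi> h - \<eta> h) \<le> ell2_norm G x \<xi> + ell2_norm G x \<eta>"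
  using ell2_add[OF assms(1) ell2_scale(1)[OF assms(2), of "-1"]] ell2_scale(2)[OF assms(2), of "-1"]
  by simp_all

lemma delta_ell2:
  assumes "g \<in> fibre G x"
  shows "delta g \<in> ell2 G x" "ell2_norm G x (delta g) \<le> 1"
proof -
  have off: "delta g h = 0" if "h \<notin> fibre G x" for h
    using assms that by (auto simp: delta_def)
  have bd: "L2_set (\<lambda>h. cmod (delta g h)) E \<le> 1" if "finite E" for E
  proof -
    have "(\<Sum>h\<in>E. (cmod (delta g h))\<^sup>2) = (\<Sum>h\<in>E. if h = g then 1 else 0)"
      by (intro sum.cong) (auto simp: delta_def)
    also have "\<dots> \<le> 1\<^sup>2"
      using that by simp
    finally show ?thesis
      by (rule iffD1[OF sum_cmod_sq_le_iff_L2_set[OF zero_le_one]])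
  qed
  show "delta g \<in> ell2 G x" "ell2_norm G x (delta g) \<le> 1"
    using ell2_bounded[OF off zero_le_one bd] by auto
qed

lemma ell2_inner_delta:
  assumes "g \<in> fibre G x"
  shows "ell2_inner G x \<xi> (delta g) = \<xi> g"
proof -
  have "ell2_inner G x \<xi> (delta g) = (\<Sum>\<^sub>\<infinity>h\<in>{g}. \<xi> h)"
    unfolding ell2_inner_def by (rule infsum_cong_neutral) (use assms in \<open>auto simp: delta_def\<close>)
  then show ?thesis by simp
qed

text \<open>Neither extensionality nor a norm bound is included: the pointwise difference of two
  extensional operators need not be extensional, but it is still linear in this sense.\<close>

definition linear_on_ell2 :: "'g groupoid_data \<Rightarrow> 'g \<Rightarrow> 'g operator \<Rightarrow> bool" where
  "linear_on_ell2 G x T \<longleftrightarrow> T \<in> ell2 G x \<rightarrow> ell2 G x \<and>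
     (\<forall>\<xi>\<in>ell2 G x. \<forall>\<eta>\<in>ell2 G x. T (\<lambda>h. \<xi> h + \<eta> h) = (\<lambda>h. T \<xi> h + T \<eta> h)) \<and>
     (\<forall>c. \<forall>\<xi>\<in>ell2 G x. T (\<lambda>h. c * \<xi> h) = (\<lambda>h. c * T \<xi> h))"

lemma linear_on_ell2_in: "linear_on_ell2 G x T \<Longrightarrow> \<xi> \<in> ell2 G x \<Longrightarrow> T \<xi> \<in> ell2 G x"
  by (auto simp: linear_on_ell2_def)

lemma bounded_operators_linear: "T \<in> bounded_operators G x \<Longrightarrow> linear_on_ell2 G x T"
  by (auto simp: bounded_operators_def linear_on_ell2_def PiE_def)

lemma restrict_bounded_operators:
  assumes "linear_on_ell2 G x T"
    and "\<And>\<xi>. \<xi> \<in> ell2 G x \<Longrightarrow> ell2_norm G x (T \<xi>) \<le> C * ell2_norm G x \<xi>"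
  shows "restrict T (ell2 G x) \<in> bounded_operators G x"
  using assms
  by (auto simp: bounded_operators_def linear_on_ell2_def Pi_iff ell2_add(1) ell2_scale(1) intro!: exI[of _ C])

lemma linear_on_ell2_diff:
  assumes "linear_on_ell2 G x T" "linear_on_ell2 G x S"
  shows "linear_on_ell2 G x (T - S)"
proof -
  have "(\<lambda>h. T \<xi> h - S \<xi> h) \<in> ell2 G x" if "\<xi> \<in> ell2 G x" for \<xi>
    using assms that by (intro ell2_diff) (auto intro: linear_on_ell2_in)
  then show ?thesis
    using assms by (simp add: linear_on_ell2_def fun_diff_def Pi_iff algebra_simps)
qed

lemma op_norm_le_iff:
  assumes T: "linear_on_ell2 G x T" and "0 \<le> C"
  shows "op_norm G x T \<le> ennreal C \<longleftrightarrow>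
    (\<forall>\<xi>\<in>ell2 G x. ell2_norm G x (T \<xi>) \<le> C * ell2_norm G x \<xi>)"
proof
  assume le: "op_norm G x T \<le> ennreal C"
  show "\<forall>\<xi>\<in>ell2 G x. ell2_norm G x (T \<xi>) \<le> C * ell2_norm G x \<xi>"
  proof
    fix \<xi> assume \<xi>: "\<xi> \<in> ell2 G x"
    show "ell2_norm G x (T \<xi>) \<le> C * ell2_norm G x \<xi>"
    proof (cases "ell2_norm G x \<xi> = 0")
      case True
      then have "\<xi> h = 0" for h
        using cmod_le_ell2_norm[OF \<xi>, of h] ell2_zero_off[OF \<xi>, of h] by fastforce
      \<comment> \<open>A vector of norm zero cannot be rescaled to the unit sphere, but it is 0
        times itself, and homogeneity with the scalar 0 gives \<open>T \<xi> = 0\<close>.\<close>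
      then have "\<xi> = (\<lambda>h. 0 * \<xi> h)" by auto
      then have "T \<xi> = (\<lambda>h. 0 * T \<xi> h)"
        using T \<xi> unfolding linear_on_ell2_def by metis
      then have "ell2_norm G x (T \<xi>) = 0"
        by (simp add: ell2_norm_def)
      then show ?thesis using True by simp
    next
      case False
      define r where "r = ell2_norm G x \<xi>"
      have r: "r > 0" using False ell2_norm_nonneg[of G x \<xi>] by (simp add: r_def)
      define \<eta> where "\<eta> = (\<lambda>h. complex_of_real (1/r) * \<xi> h)"
      have \<eta>: "\<eta> \<in> ell2 G x" "ell2_norm G x \<eta> \<le> 1"
        using ell2_scale[OF \<xi>, of "complex_of_real (1/r)"] r by (simp_all add: \<eta>_def r_def norm_divide)
      have "ennreal (ell2_norm G x (T \<eta>)) \<le> ennreal C"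
        using \<eta> le by (auto simp: op_norm_def SUP_le_iff)
      then have "ell2_norm G x (T \<eta>) \<le> C"
        using \<open>0 \<le> C\<close> by simp
      moreover have "T \<eta> = (\<lambda>h. complex_of_real (1/r) * T \<xi> h)"
        using T \<xi> unfolding linear_on_ell2_def \<eta>_def by blast
      then have "ell2_norm G x (T \<eta>) = ell2_norm G x (T \<xi>) / r"
        using ell2_scale(2)[OF linear_on_ell2_in[OF T \<xi>], of "complex_of_real (1/r)"] r
        by (simp add: norm_divide)
      ultimately show ?thesis
        using r by (simp add: field_simps r_def)
    qed
  qed
next
  assume *: "\<forall>\<xi>\<in>ell2 G x. ell2_norm G x (T \<xi>) \<le> C * ell2_norm G x \<xi>"
  have "ell2_norm G x (T \<xi>) \<le> C" if "\<xi> \<in> ell2 G x" "ell2_norm G x \<xi> \<le> 1" for \<xi>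
    using * that mult_left_mono[OF that(2) \<open>0 \<le> C\<close>] by fastforce
  then show "op_norm G x T \<le> ennreal C"
    by (auto simp: op_norm_def SUP_le_iff intro: ennreal_leI)
qed

text \<open>A real-valued substitute for a bound on \<open>family_norm G (T - S)\<close>, which
  takes values in \<open>ennreal\<close>. In this form symmetry and the triangle inequality are
  statements about single vectors.\<close>

definition op_dist_le ::
    "'g groupoid_data \<Rightarrow> ('g \<Rightarrow> 'g operator) \<Rightarrow> ('g \<Rightarrow> 'g operator) \<Rightarrow> real \<Rightarrow> bool" where
  "op_dist_le G T S C \<longleftrightarrow> (\<forall>x\<in>gunits G. \<forall>\<xi>\<in>ell2 G x.
     ell2_norm G x (\<lambda>h. T x \<xi> h - S x \<xi> h) \<le> C * ell2_norm G x \<xi>)"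

lemma family_norm_diff_le_iff:
  assumes "\<And>x. x \<in> gunits G \<Longrightarrow> linear_on_ell2 G x (T x)"
    and "\<And>x. x \<in> gunits G \<Longrightarrow> linear_on_ell2 G x (S x)" and "0 \<le> C"
  shows "family_norm G (T - S) \<le> ennreal C \<longleftrightarrow> op_dist_le G T S C"
proof -
  have "op_norm G x ((T - S) x) \<le> ennreal C \<longleftrightarrow> (\<forall>\<xi>\<in>ell2 G x.
      ell2_norm G x (\<lambda>h. T x \<xi> h - S x \<xi> h) \<le> C * ell2_norm G x \<xi>)" if "x \<in> gunits G" for x
    using op_norm_le_iff[OF linear_on_ell2_diff[OF assms(1,2)[OF that]] assms(3)]
    by (simp add: fun_diff_def)
  then show ?thesis
    by (simp add: family_norm_def SUP_le_iff op_dist_le_def)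
qed

lemma op_dist_le_sym: "op_dist_le G T S C \<Longrightarrow> op_dist_le G S T C"
proof -
  have "ell2_norm G x (\<lambda>h. S x \<xi> h - T x \<xi> h) = ell2_norm G x (\<lambda>h. T x \<xi> h - S x \<xi> h)" for x \<xi>
    by (simp add: ell2_norm_def norm_minus_commute)
  then show "op_dist_le G T S C \<Longrightarrow> op_dist_le G S T C"
    by (simp add: op_dist_le_def)
qed

lemma op_dist_le_trans:
  assumes lin: "\<And>x. x \<in> gunits G \<Longrightarrow> linear_on_ell2 G x (T x)"
    "\<And>x. x \<in> gunits G \<Longrightarrow> linear_on_ell2 G x (S x)"
    "\<And>x. x \<in> gunits G \<Longrightarrow> linear_on_ell2 G x (R x)"
    and "op_dist_le G T S C" "op_dist_le G S R D"
  shows "op_dist_le G T R (C + D)"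
  unfolding op_dist_le_def
proof (intro ballI)
  fix x \<xi> assume x: "x \<in> gunits G" and \<xi>: "\<xi> \<in> ell2 G x"
  have "ell2_norm G x (\<lambda>h. (T x \<xi> h - S x \<xi> h) + (S x \<xi> h - R x \<xi> h))
      \<le> ell2_norm G x (\<lambda>h. T x \<xi> h - S x \<xi> h) + ell2_norm G x (\<lambda>h. S x \<xi> h - R x \<xi> h)"
    using x \<xi> lin by (intro ell2_add ell2_diff) (auto intro: linear_on_ell2_in)
  also have "\<dots> \<le> C * ell2_norm G x \<xi> + D * ell2_norm G x \<xi>"
    using assms(4,5) x \<xi> by (intro add_mono) (auto simp: op_dist_le_def)
  finally show "ell2_norm G x (\<lambda>h. T x \<xi> h - R x \<xi> h) \<le> (C + D) * ell2_norm G x \<xi>"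
    by (simp add: algebra_simps)
qed

lemma ennreal_pos_real:
  fixes a :: ennreal
  assumes "0 < a"
  obtains e :: real where "0 < e" "ennreal e < a"
proof -
  obtain b where b: "0 < b" "b < a" using dense[OF assms] by blast
  then have "b < top" using order_less_le_trans top_greatest by blast
  then obtain r where "b = ennreal r" by (cases b) auto
  then show ?thesis using b that by simp
qed

lemma ennreal_tendsto_0_iff:
  fixes f :: "nat \<Rightarrow> ennreal"
  shows "f \<longlonglongrightarrow> 0 \<longleftrightarrow> (\<forall>e>0. \<forall>\<^sub>F n in sequentially. f n \<le> ennreal e)"
proof (intro iffI allI impI)
  fix e :: real assume "f \<longlonglongrightarrow> 0" "e > 0"
  then have "\<forall>\<^sub>F n in sequentially. f n < ennreal e"
    by (intro order_tendstoD) auto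
  then show "\<forall>\<^sub>F n in sequentially. f n \<le> ennreal e"
    by (rule eventually_mono) auto
next
  assume *: "\<forall>e>0. \<forall>\<^sub>F n in sequentially. f n \<le> ennreal e"
  show "f \<longlonglongrightarrow> 0"
  proof (rule order_tendstoI)
    fix a :: ennreal assume "0 < a"
    then obtain e :: real where e: "0 < e" "ennreal e < a" by (rule ennreal_pos_real)
    then have "\<forall>\<^sub>F n in sequentially. f n \<le> ennreal e" using * by simp
    then show "\<forall>\<^sub>F n in sequentially. f n < a"
      by (rule eventually_mono) (use e in auto)
  qed simp
qed

text \<open>The value at \<open>g\<close> is one coordinate of the image of a unit vector, so it is
  bounded by the operator norm: norm convergence implies uniform convergence of the associated
  functions. The unit laws appear as hypotheses so that the lemma can be applied to the cover as
  well as to \<open>G\<close>.\<close>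

lemma as_function_diff_le:
  assumes "g \<in> arrows G" "gsrc G g \<in> fibre G (gsrc G g)" "gsrc G g \<in> gunits G"
    and "linear_on_ell2 G (gsrc G g) (T (gsrc G g))" "linear_on_ell2 G (gsrc G g) (S (gsrc G g))"
    and "op_dist_le G T S C" "0 \<le> C"
  shows "cmod (as_function G T g - as_function G S g) \<le> C"
proof -
  define x where "x = gsrc G g"
  have g: "g \<in> fibre G x" using assms(1) by (simp add: fibre_def x_def)
  have x: "x \<in> fibre G x" "x \<in> gunits G" using assms by (simp_all add: x_def)
  note d = delta_ell2[OF x(1)]
  have "cmod (T x (delta x) g - S x (delta x) g) \<le> ell2_norm G x (\<lambda>h. T x (delta x) h - S x (delta x) h)"
    using assms d(1) g unfolding x_def[symmetric]
    by (intro cmod_le_ell2_norm[of "\<lambda>h. T x (delta x) h - S x (delta x) h"] ell2_diff)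
       (auto intro: linear_on_ell2_in)
  also have "\<dots> \<le> C * ell2_norm G x (delta x)"
    using assms(6) d(1) x(2) by (auto simp: op_dist_le_def)
  also have "\<dots> \<le> C"
    using d(2) \<open>0 \<le> C\<close> mult_left_mono by fastforce
  finally show ?thesis
    using g by (simp add: as_function_def ell2_inner_delta x_def)
qed

section \<open>Convolution operators with finite rows\<close>

text \<open>Makes every convolution sum finite, so that convolution is linear in both arguments
  without summability conditions.\<close>

definition row_finite :: "'g groupoid_data \<Rightarrow> ('g \<Rightarrow> complex) \<Rightarrow> bool" where
  "row_finite G f \<longleftrightarrow> (\<forall>g\<in>arrows G.
     finite {h \<in> fibre G (gsrc G g). f (gmul G g (ginv G h)) \<noteq> 0})"

text \<open>The norm bound \<open>C\<close> for all finite square blocks of the convolution matrix.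
  Each block involves only finitely many values of \<open>f\<close>, which is why this form of the
  bound can be carried over to the cover by pointwise limits.\<close>

definition mat_bound :: "'g groupoid_data \<Rightarrow> ('g \<Rightarrow> complex) \<Rightarrow> real \<Rightarrow> bool" where
  "mat_bound G f C \<longleftrightarrow> (\<forall>x\<in>gunits G. \<forall>E \<xi>. finite E \<and> E \<subseteq> fibre G x \<longrightarrow>
     L2_set (\<lambda>g. cmod (\<Sum>h\<in>E. f (gmul G g (ginv G h)) * \<xi> h)) E \<le> C * L2_set (\<lambda>h. cmod (\<xi> h)) E)"

lemma row_finite_lincomb:
  assumes "row_finite G f" "row_finite G k"
  shows "row_finite G (\<lambda>g. c * f g + k g)"
  unfolding row_finite_def
proof
  fix g assume "g \<in> arrows G"
  then have "finite ({h \<in> fibre G (gsrc G g). f (gmul G g (ginv G h)) \<noteq> 0} \<union>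
      {h \<in> fibre G (gsrc G g). k (gmul G g (ginv G h)) \<noteq> 0})"
    using assms by (simp add: row_finite_def)
  then show "finite {h \<in> fibre G (gsrc G g).
      c * f (gmul G g (ginv G h)) + k (gmul G g (ginv G h)) \<noteq> 0}"
    by (rule rev_finite_subset) auto
qed

lemma mat_bound_lincomb:
  assumes "mat_bound G f C" "mat_bound G k D"
  shows "mat_bound G (\<lambda>g. c * f g + k g) (cmod c * C + D)"
  unfolding mat_bound_def
proof (intro ballI allI impI, elim conjE)
  fix x E and \<xi> :: "'a \<Rightarrow> complex"
  assume E: "x \<in> gunits G" "finite E" "E \<subseteq> fibre G x"
  let ?s = "\<lambda>f g. \<Sum>h\<in>E. f (gmul G g (ginv G h)) * \<xi> h"
  let ?r = "L2_set (\<lambda>h. cmod (\<xi> h)) E"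
  have "L2_set (\<lambda>g. cmod (?s (\<lambda>g. c * f g + k g) g)) E
      \<le> L2_set (\<lambda>g. cmod c * cmod (?s f g) + cmod (?s k g)) E"
  proof (rule L2_set_mono)
    fix g
    have eq: "?s (\<lambda>g. c * f g + k g) g = c * ?s f g + ?s k g"
      by (simp add: sum_distrib_left sum.distrib algebra_simps)
    show "cmod (?s (\<lambda>g. c * f g + k g) g) \<le> cmod c * cmod (?s f g) + cmod (?s k g)"
      unfolding eq using norm_triangle_ineq[of "c * ?s f g" "?s k g"] by (simp only: norm_mult)
  qed simp
  also have "\<dots> \<le> L2_set (\<lambda>g. cmod c * cmod (?s f g)) E + L2_set (\<lambda>g. cmod (?s k g)) E"
    by (rule L2_set_triangle_ineq)
  also have "\<dots> = cmod c * L2_set (\<lambda>g. cmod (?s f g)) E + L2_set (\<lambda>g. cmod (?s k g)) E"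
    by (simp add: L2_set_right_distrib)
  also have "\<dots> \<le> cmod c * (C * ?r) + D * ?r"
    using assms E by (intro add_mono mult_left_mono) (auto simp: mat_bound_def)
  finally show "L2_set (\<lambda>g. cmod (?s (\<lambda>g. c * f g + k g) g)) E \<le> (cmod c * C + D) * ?r"
    by (simp add: algebra_simps)
qed

lemma convolution_off_arrows: "g \<notin> arrows G \<Longrightarrow> convolution G f \<xi> g = 0"
  by (simp add: convolution_def)

lemma convolution_eq_sum:
  assumes "g \<in> arrows G" "finite E" "E \<subseteq> fibre G (gsrc G g)"
    and "\<And>h. h \<in> fibre G (gsrc G g) \<Longrightarrow> f (gmul G g (ginv G h)) * \<xi> h \<noteq> 0 \<Longrightarrow> h \<in> E"
  shows "convolution G f \<xi> g = (\<Sum>h\<in>E. f (gmul G g (ginv G h)) * \<xi> h)"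
proof -
  have "convolution G f \<xi> g = (\<Sum>\<^sub>\<infinity>h\<in>E. f (gmul G g (ginv G h)) * \<xi> h)"
    unfolding convolution_def using assms(1)
    by (simp, intro infsum_cong_neutral) (use assms(3,4) in auto)
  then show ?thesis using assms(2) by simp
qed

lemma convolution_row_sum:
  assumes "row_finite G f" "g \<in> arrows G"
  shows "convolution G f \<xi> g =
    (\<Sum>h\<in>{h \<in> fibre G (gsrc G g). f (gmul G g (ginv G h)) \<noteq> 0}. f (gmul G g (ginv G h)) * \<xi> h)"
  using assms by (intro convolution_eq_sum) (auto simp: row_finite_def)

lemma convolution_lincomb_right:
  assumes "row_finite G f"
  shows "convolution G f (\<lambda>h. c * \<xi> h + \<eta> h) g = c * convolution G f \<xi> g + convolution G f \<eta> g"
proof (cases "g \<in> arrows G")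
  case True
  define E where "E = {h \<in> fibre G (gsrc G g). f (gmul G g (ginv G h)) \<noteq> 0}"
  have "convolution G f \<zeta> g = (\<Sum>h\<in>E. f (gmul G g (ginv G h)) * \<zeta> h)" for \<zeta>
    unfolding E_def by (rule convolution_row_sum[OF assms True])
  then show ?thesis
    by (simp add: sum_distrib_left sum.distrib algebra_simps)
qed (simp add: convolution_off_arrows)

lemma convolution_lincomb_left:
  assumes "row_finite G f" "row_finite G k"
  shows "convolution G (\<lambda>g. c * f g + k g) \<xi> g = c * convolution G f \<xi> g + convolution G k \<xi> g"
proof (cases "g \<in> arrows G")
  case True
  define E where "E = {h \<in> fibre G (gsrc G g). f (gmul G g (ginv G h)) \<noteq> 0} \<union>
      {h \<in> fibre G (gsrc G g). k (gmul G g (ginv G h)) \<noteq> 0}"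
  have E: "finite E" "E \<subseteq> fibre G (gsrc G g)"
    using assms True by (auto simp: E_def row_finite_def)
  have "convolution G p \<xi> g = (\<Sum>h\<in>E. p (gmul G g (ginv G h)) * \<xi> h)"
    if "p \<in> {f, k, \<lambda>g. c * f g + k g}" for p
    using that by (intro convolution_eq_sum True E) (auto simp: E_def)
  then show ?thesis
    by (simp add: sum_distrib_left sum.distrib algebra_simps)
qed (simp add: convolution_off_arrows)

lemma convolution_zero_off:
  assumes "\<xi> \<in> ell2 G x" "g \<notin> fibre G x"
  shows "convolution G f \<xi> g = 0"
proof (cases "g \<in> arrows G")
  case True
  then have "\<xi> h = 0" if "h \<in> fibre G (gsrc G g)" for h
    using that assms by (intro ell2_zero_off[OF assms(1)]) (auto simp: fibre_def)
  then show ?thesis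
    by (simp add: convolution_def infsum_0)
qed (simp add: convolution_off_arrows)

lemma mat_bound_convolution:
  assumes rf: "row_finite G f" and mb: "mat_bound G f C" and "0 \<le> C"
    and x: "x \<in> gunits G" and \<xi>: "\<xi> \<in> ell2 G x"
  shows "convolution G f \<xi> \<in> ell2 G x" "ell2_norm G x (convolution G f \<xi>) \<le> C * ell2_norm G x \<xi>"
proof -
  have bd: "L2_set (\<lambda>h. cmod (convolution G f \<xi> h)) E \<le> C * ell2_norm G x \<xi>"
    if E: "finite E" "E \<subseteq> fibre G x" for E
  proof -
    \<comment> \<open>All columns with a nonzero entry in a row of \<open>E\<close> are added. The
      values of the convolution on \<open>E\<close> then become sums over \<open>D\<close>, and the
      square block indexed by \<open>D\<close> bounds them.\<close>
    define D where "D = E \<union> (\<Union>g\<in>E. {h \<in> fibre G x. f (gmul G g (ginv G h)) \<noteq> 0})"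
    have src: "g \<in> arrows G" "gsrc G g = x" if "g \<in> fibre G x" for g
      using that E by (auto simp: fibre_def)
    then have D: "finite D" "D \<subseteq> fibre G x" "E \<subseteq> D"
      using E rf unfolding D_def row_finite_def by (auto, metis subsetD)
    have "L2_set (\<lambda>h. cmod (convolution G f \<xi> h)) E
        = L2_set (\<lambda>g. cmod (\<Sum>h\<in>D. f (gmul G g (ginv G h)) * \<xi> h)) E"
    proof (intro L2_set_cong refl arg_cong[where f = cmod])
      fix g assume "g \<in> E"
      moreover from this have "g \<in> arrows G" "gsrc G g = x"
        using E src by auto
      ultimately show "convolution G f \<xi> g = (\<Sum>h\<in>D. f (gmul G g (ginv G h)) * \<xi> h)"
        using D(1,2) by (intro convolution_eq_sum) (auto simp: D_def)
    qed
    also have "\<dots> \<le> L2_set (\<lambda>g. cmod (\<Sum>h\<in>D. f (gmul G g (ginv G h)) * \<xi> h)) D"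
      unfolding L2_set_def using D by (intro real_sqrt_le_mono sum_mono2) auto
    also have "\<dots> \<le> C * L2_set (\<lambda>h. cmod (\<xi> h)) D"
      using mb x D by (simp add: mat_bound_def)
    also have "\<dots> \<le> C * ell2_norm G x \<xi>"
      using \<open>0 \<le> C\<close> D \<xi> by (intro mult_left_mono L2_set_le_ell2_norm) auto
    finally show ?thesis .
  qed
  show "convolution G f \<xi> \<in> ell2 G x" "ell2_norm G x (convolution G f \<xi>) \<le> C * ell2_norm G x \<xi>"
    using ell2_bounded[where G = G and x = x and \<xi> = "convolution G f \<xi>", OF convolution_zero_off[OF \<xi>] _ bd]
      \<open>0 \<le> C\<close> by (simp_all add: ell2_norm_nonneg)
qed

text \<open>Converse of the previous estimate: a vector cut off outside \<open>E\<close> turns the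
  finite block into a part of the operator.\<close>

lemma convolution_mat_bound:
  assumes "row_finite G f"
    and "\<And>x \<xi>. x \<in> gunits G \<Longrightarrow> \<xi> \<in> ell2 G x \<Longrightarrow> convolution G f \<xi> \<in> ell2 G x"
    and "\<And>x \<xi>. x \<in> gunits G \<Longrightarrow> \<xi> \<in> ell2 G x \<Longrightarrow>
      ell2_norm G x (convolution G f \<xi>) \<le> C * ell2_norm G x \<xi>"
    and "0 \<le> C"
  shows "mat_bound G f C"
  unfolding mat_bound_def
proof (intro ballI allI impI, elim conjE)
  fix x E and \<xi> :: "'a \<Rightarrow> complex"
  assume x: "x \<in> gunits G" and E: "finite E" "E \<subseteq> fibre G x"
  define \<eta> where "\<eta> = (\<lambda>h. if h \<in> E then \<xi> h else 0)"
  have off: "\<eta> h = 0" if "h \<notin> fibre G x" for h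
    using that E by (auto simp: \<eta>_def)
  have bd: "L2_set (\<lambda>h. cmod (\<eta> h)) D \<le> L2_set (\<lambda>h. cmod (\<xi> h)) E" if "finite D" for D
  proof -
    have "(\<Sum>h\<in>D. (cmod (\<eta> h))\<^sup>2) = (\<Sum>h\<in>D \<inter> E. (cmod (\<xi> h))\<^sup>2)"
      using that by (intro sum.mono_neutral_cong_right) (auto simp: \<eta>_def)
    also have "\<dots> \<le> (\<Sum>h\<in>E. (cmod (\<xi> h))\<^sup>2)"
      using E by (intro sum_mono2) auto
    finally show ?thesis by (simp add: L2_set_def)
  qed
  have \<eta>: "\<eta> \<in> ell2 G x" "ell2_norm G x \<eta> \<le> L2_set (\<lambda>h. cmod (\<xi> h)) E"
    using ell2_bounded[OF off _ bd] by auto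
  have "L2_set (\<lambda>g. cmod (\<Sum>h\<in>E. f (gmul G g (ginv G h)) * \<xi> h)) E
      = L2_set (\<lambda>g. cmod (convolution G f \<eta> g)) E"
  proof (intro L2_set_cong refl arg_cong[where f = cmod])
    fix g assume "g \<in> E"
    then have "g \<in> arrows G" "gsrc G g = x" using E by (auto simp: fibre_def)
    then have "convolution G f \<eta> g = (\<Sum>h\<in>E. f (gmul G g (ginv G h)) * \<eta> h)"
      using E by (intro convolution_eq_sum) (auto simp: \<eta>_def split: if_splits)
    then show "(\<Sum>h\<in>E. f (gmul G g (ginv G h)) * \<xi> h) = convolution G f \<eta> g"
      by (simp add: \<eta>_def)
  qed
  also have "\<dots> \<le> ell2_norm G x (convolution G f \<eta>)"
    by (intro L2_set_le_ell2_norm assms x \<eta> E)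
  also have "\<dots> \<le> C * ell2_norm G x \<eta>"
    by (intro assms x \<eta>)
  also have "\<dots> \<le> C * L2_set (\<lambda>h. cmod (\<xi> h)) E"
    by (intro mult_left_mono \<eta> assms)
  finally show "L2_set (\<lambda>g. cmod (\<Sum>h\<in>E. f (gmul G g (ginv G h)) * \<xi> h)) E
      \<le> C * L2_set (\<lambda>h. cmod (\<xi> h)) E" .
qed

definition conv_bounded :: "'g groupoid_data \<Rightarrow> ('g \<Rightarrow> complex) \<Rightarrow> bool" where
  "conv_bounded G f \<longleftrightarrow> row_finite G f \<and> (\<exists>C\<ge>0. mat_bound G f C)"

lemma conv_bounded_lincomb:
  assumes "conv_bounded G f" "conv_bounded G k"
  shows "conv_bounded G (\<lambda>g. c * f g + k g)"
  unfolding conv_bounded_def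
proof (intro conjI)
  show "row_finite G (\<lambda>g. c * f g + k g)"
    using assms row_finite_lincomb by (auto simp: conv_bounded_def)
  obtain C D where "0 \<le> C" "0 \<le> D" "mat_bound G f C" "mat_bound G k D"
    using assms by (auto simp: conv_bounded_def)
  then show "\<exists>C\<ge>0. mat_bound G (\<lambda>g. c * f g + k g) C"
    by (intro exI[of _ "cmod c * C + D"]) (simp add: mat_bound_lincomb)
qed

lemma conv_bounded_zero: "conv_bounded G (\<lambda>_. 0)"
  by (auto simp: conv_bounded_def row_finite_def mat_bound_def L2_set_def intro!: exI[of _ 0])

lemma conv_bounded_diff:
  assumes "conv_bounded G f" "conv_bounded G k"
  shows "conv_bounded G (\<lambda>g. f g - k g)"
  using conv_bounded_lincomb[OF assms(2,1), of "-1"] by simp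

lemma reg_rep_bounded:
  assumes "conv_bounded G f" "x \<in> gunits G"
  shows "reg_rep G x f \<in> bounded_operators G x"
proof -
  obtain C where C: "0 \<le> C" "mat_bound G f C" and rf: "row_finite G f"
    using assms by (auto simp: conv_bounded_def)
  note b = mat_bound_convolution[OF rf C(2,1) assms(2)]
  have "convolution G f (\<lambda>h. \<xi> h + \<eta> h) = (\<lambda>h. convolution G f \<xi> h + convolution G f \<eta> h)" for \<xi> \<eta>
    using convolution_lincomb_right[OF rf, of 1] by auto
  moreover have "convolution G f (\<lambda>h. c * \<xi> h) = (\<lambda>h. c * convolution G f \<xi> h)" for c \<xi>
    using convolution_lincomb_right[OF rf, of c \<xi> "\<lambda>_. 0"] by (auto simp: convolution_def infsum_0)
  ultimately have "linear_on_ell2 G x (convolution G f)"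
    using b by (simp add: linear_on_ell2_def Pi_iff)
  then show ?thesis
    unfolding reg_rep_def using b(2) by (rule restrict_bounded_operators)
qed

lemma reg_family_apply:
  "x \<in> gunits G \<Longrightarrow> \<xi> \<in> ell2 G x \<Longrightarrow> reg_family G f x \<xi> = convolution G f \<xi>"
  by (simp add: reg_family_def reg_rep_def)

lemma reg_family_linear:
  assumes "conv_bounded G f" "x \<in> gunits G"
  shows "linear_on_ell2 G x (reg_family G f x)"
  using assms by (simp add: reg_family_def reg_rep_bounded bounded_operators_linear)

lemma convolution_diff_left:
  assumes "conv_bounded G f" "conv_bounded G k"
  shows "convolution G (\<lambda>g. f g - k g) \<xi> g = convolution G f \<xi> g - convolution G k \<xi> g"
  using convolution_lincomb_left[of G k f "-1" \<xi> g] assms by (simp add: conv_bounded_def)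

text \<open>The exchange between reduced norm and finite blocks. It is read from left to right on
  \<open>G\<close> and from right to left on the cover to transport Cauchy estimates.\<close>

lemma op_dist_le_reg_family_iff:
  assumes "conv_bounded G f" "conv_bounded G k" "0 \<le> C"
  shows "op_dist_le G (reg_family G f) (reg_family G k) C \<longleftrightarrow> mat_bound G (\<lambda>g. f g - k g) C"
proof
  note d = conv_bounded_diff[OF assms(1,2)]
  then have rf: "row_finite G (\<lambda>g. f g - k g)" by (simp add: conv_bounded_def)
  have eq: "(\<lambda>h. reg_family G f x \<xi> h - reg_family G k x \<xi> h) = convolution G (\<lambda>g. f g - k g) \<xi>"
    if "x \<in> gunits G" "\<xi> \<in> ell2 G x" for x \<xi>
    using that by (simp add: reg_family_apply fun_eq_iff convolution_diff_left[OF assms(1,2)])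
  show "op_dist_le G (reg_family G f) (reg_family G k) C" if "mat_bound G (\<lambda>g. f g - k g) C"
    unfolding op_dist_le_def using mat_bound_convolution(2)[OF rf that assms(3)] by (simp add: eq)
  show "mat_bound G (\<lambda>g. f g - k g) C" if "op_dist_le G (reg_family G f) (reg_family G k) C"
  proof (rule convolution_mat_bound[OF rf _ _ assms(3)])
    fix x \<xi> assume x: "x \<in> gunits G" "\<xi> \<in> ell2 G x"
    show "convolution G (\<lambda>g. f g - k g) \<xi> \<in> ell2 G x"
      using linear_on_ell2_in[OF reg_family_linear[OF d x(1)] x(2)] x by (simp add: reg_family_apply)
    show "ell2_norm G x (convolution G (\<lambda>g. f g - k g) \<xi>) \<le> C * ell2_norm G x \<xi>"
      using that x by (simp add: op_dist_le_def eq)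
  qed
qed

section \<open>Local structure of groupoids with open range map\<close>

context groupoid
begin

lemma unit_arrow: "x \<in> gunits G \<Longrightarrow> x \<in> arrows G"
  using units_subset by blast

lemma src_arrow: "g \<in> arrows G \<Longrightarrow> gsrc G g \<in> arrows G"
  and rng_arrow: "g \<in> arrows G \<Longrightarrow> grng G g \<in> arrows G"
  by (simp_all add: unit_arrow src_in rng_in)

lemma src_src: "g \<in> arrows G \<Longrightarrow> gsrc G (gsrc G g) = gsrc G g"
  and rng_src: "g \<in> arrows G \<Longrightarrow> grng G (gsrc G g) = gsrc G g"
  and src_rng: "g \<in> arrows G \<Longrightarrow> gsrc G (grng G g) = grng G g"
  and rng_rng: "g \<in> arrows G \<Longrightarrow> grng G (grng G g) = grng G g"
  by (simp_all add: src_in rng_in src_unit rng_unit)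

lemma unit_inv:
  assumes "x \<in> gunits G"
  shows "ginv G x = x"
  using mul_src[OF inv_in, of x] mul_inv_left[of x] src_inv[of x] assms
  by (simp add: unit_arrow src_unit rng_unit)

lemma inv_mul_cancel:
  assumes "g \<in> arrows G" "h \<in> arrows G" "gsrc G g = grng G h"
  shows "gmul G (ginv G g) (gmul G g h) = h"
  using assms mul_assoc[of "ginv G g" g h] by (simp add: inv_in src_inv rng_inv mul_inv_left rng_mul_left)

lemma inv_inv:
  assumes "g \<in> arrows G"
  shows "ginv G (ginv G g) = g"
proof -
  have "gmul G (ginv G (ginv G g)) (gmul G (ginv G g) g) = g"
    using assms by (intro inv_mul_cancel) (auto simp: inv_in src_inv rng_inv)
  then show ?thesis
    using mul_src[of "ginv G (ginv G g)"] assms by (simp add: inv_in src_inv rng_inv mul_inv_left)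
qed

lemma mul_inv_cancel_left:
  assumes "g \<in> arrows G" "h \<in> arrows G" "grng G g = grng G h"
  shows "gmul G g (gmul G (ginv G g) h) = h"
  using inv_mul_cancel[of "ginv G g" h] assms by (simp add: inv_inv inv_in src_inv)

lemma mul_inv_cancel_right:
  assumes "g \<in> arrows G" "h \<in> arrows G" "gsrc G g = grng G h"
  shows "gmul G (gmul G g h) (ginv G h) = g"
  using assms mul_src[of g] by (simp add: mul_assoc inv_in rng_inv mul_inv_right)

lemma mul_inv_cancel_right':
  assumes "g \<in> arrows G" "h \<in> arrows G" "gsrc G g = gsrc G h"
  shows "gmul G (gmul G g (ginv G h)) h = g"
  using mul_inv_cancel_right[of g "ginv G h"] assms by (simp add: inv_in inv_inv rng_inv)

lemmas groupoid_simps =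
  unit_arrow src_arrow rng_arrow src_in rng_in src_unit rng_unit src_src rng_src src_rng rng_rng
  mul_in src_mul rng_mul mul_src rng_mul_left inv_in src_inv rng_inv mul_inv_right mul_inv_left
  unit_inv inv_inv inv_mul_cancel mul_inv_cancel_left mul_inv_cancel_right mul_inv_cancel_right'

end

context etale_groupoid
begin

lemma local_homeomorphism_at:
  assumes "g \<in> arrows G"
  obtains U where "openin (gtop G) U" "g \<in> U" "inj_on (grng G) U"
    "openin (unit_top G) (grng G ` U)"
    "open_map (subtopology (gtop G) U) (subtopology (unit_top G) (grng G ` U)) (grng G)"
proof -
  obtain U where U: "openin (gtop G) U" "g \<in> U" "openin (unit_top G) (grng G ` U)"
    "homeomorphic_map (subtopology (gtop G) U) (subtopology (unit_top G) (grng G ` U)) (grng G)"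
    using etale assms unfolding local_homeomorphism_map_def by blast
  moreover have "inj_on (grng G) U"
    using homeomorphic_imp_injective_map[OF U(4)] openin_subset[OF U(1)] by (simp add: Int_absorb1)
  ultimately show ?thesis
    using that homeomorphic_imp_open_map by blast
qed

section \<open>Openness of the unit space and of the structure maps\<close>

lemma openin_src_preimage_units:
  "openin (unit_top G) A \<Longrightarrow> openin (gtop G) {g \<in> arrows G. gsrc G g \<in> A}"
  using openin_continuous_map_preimage[OF continuous_src] by simp

lemma openin_rng_preimage_units:
  "openin (unit_top G) A \<Longrightarrow> openin (gtop G) {g \<in> arrows G. grng G g \<in> A}"
  using openin_continuous_map_preimage[OF continuous_rng] by simp

lemma openin_units: "openin (gtop G) (gunits G)"
proof (subst openin_subopen, intro ballI)
  fix x assume x: "x \<in> gunits G"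
  obtain U where U: "openin (gtop G) U" "x \<in> U" "inj_on (grng G) U"
    using local_homeomorphism_at[OF unit_arrow[OF x]] by metis
  \<comment> \<open>An arrow \<open>g\<close> of \<open>V\<close> and its range both lie in
    \<open>U\<close> and have the same range. Injectivity on \<open>U\<close> identifies them, so
    \<open>g\<close> is a unit.\<close>
  define V where "V = U \<inter> {g \<in> arrows G. grng G g \<in> gunits G \<inter> U}"
  have "openin (gtop G) V"
    unfolding V_def using U(1) by (intro openin_Int openin_rng_preimage_units openin_subtopology_Int2)
  moreover have "x \<in> V"
    using U x by (simp add: V_def groupoid_simps)
  moreover have "V \<subseteq> gunits G"
  proof
    fix g assume g: "g \<in> V"
    have "g = grng G g"
      by (rule inj_onD[OF U(3)]) (use g in \<open>simp_all add: V_def rng_rng\<close>)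
    moreover have "grng G g \<in> gunits G"
      using g by (simp add: V_def)
    ultimately show "g \<in> gunits G" by simp
  qed
  ultimately show "\<exists>T. openin (gtop G) T \<and> x \<in> T \<and> T \<subseteq> gunits G" by blast
qed

lemma openin_unit_top_iff: "openin (unit_top G) A \<longleftrightarrow> openin (gtop G) A \<and> A \<subseteq> gunits G"
  by (rule openin_open_subtopology[OF openin_units])

lemma topspace_unit_top [simp]: "topspace (unit_top G) = gunits G"
  using units_subset by auto

lemma openin_src_preimage:
  assumes "openin (gtop G) A"
  shows "openin (gtop G) {g \<in> arrows G. gsrc G g \<in> A}"
proof -
  have "{g \<in> arrows G. gsrc G g \<in> A} = {g \<in> arrows G. gsrc G g \<in> A \<inter> gunits G}"
    by (auto simp: groupoid_simps)
  then show ?thesis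
    using openin_src_preimage_units[of "A \<inter> gunits G"] assms
    by (simp add: openin_unit_top_iff openin_Int openin_units)
qed

lemma openin_rng_preimage:
  assumes "openin (gtop G) A"
  shows "openin (gtop G) {g \<in> arrows G. grng G g \<in> A}"
proof -
  have "{g \<in> arrows G. grng G g \<in> A} = {g \<in> arrows G. grng G g \<in> A \<inter> gunits G}"
    by (auto simp: groupoid_simps)
  then show ?thesis
    using openin_rng_preimage_units[of "A \<inter> gunits G"] assms
    by (simp add: openin_unit_top_iff openin_Int openin_units)
qed

lemma inv_image_eq:
  assumes "A \<subseteq> arrows G"
  shows "ginv G ` A = {g \<in> arrows G. ginv G g \<in> A}"
  using assms by (force simp: groupoid_simps intro: rev_image_eqI)

lemma openin_inv_preimage:
  "openin (gtop G) A \<Longrightarrow> openin (gtop G) {g \<in> arrows G. ginv G g \<in> A}"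
  using openin_continuous_map_preimage[OF continuous_inv] .

lemma openin_inv_image: "openin (gtop G) A \<Longrightarrow> openin (gtop G) (ginv G ` A)"
  using openin_inv_preimage inv_image_eq[OF openin_subset] by simp

lemma openin_rng_image:
  assumes U: "openin (gtop G) U"
  shows "openin (gtop G) (grng G ` U)"
proof (subst openin_subopen, intro ballI)
  fix y assume "y \<in> grng G ` U"
  then obtain g where g: "g \<in> U" "y = grng G g" by blast
  then have "g \<in> arrows G" using openin_subset[OF U] by blast
  then obtain W where W: "openin (gtop G) W" "g \<in> W" "openin (unit_top G) (grng G ` W)"
    "open_map (subtopology (gtop G) W) (subtopology (unit_top G) (grng G ` W)) (grng G)"
    using local_homeomorphism_at by metis
  have "openin (subtopology (gtop G) W) (U \<inter> W)"
    using U by (auto simp: openin_subtopology)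
  then have "openin (subtopology (unit_top G) (grng G ` W)) (grng G ` (U \<inter> W))"
    using W(4) by (simp add: open_map_def)
  then have "openin (unit_top G) (grng G ` (U \<inter> W))"
    using W(3) openin_trans_full by blast
  then have "openin (gtop G) (grng G ` (U \<inter> W))"
    by (simp add: openin_unit_top_iff)
  then show "\<exists>T. openin (gtop G) T \<and> y \<in> T \<and> T \<subseteq> grng G ` U"
    using g W(2) by (intro exI[of _ "grng G ` (U \<inter> W)"]) auto
qed

lemma openin_src_image:
  assumes "openin (gtop G) U"
  shows "openin (gtop G) (gsrc G ` U)"
proof -
  have "gsrc G ` U = grng G ` ginv G ` U"
    using openin_subset[OF assms] by (force simp: image_image groupoid_simps)
  then show ?thesis
    using openin_rng_image openin_inv_image assms by simp
qed

section \<open>Open bisections and local compactness\<close>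

lemma bisection_openin: "open_bisection G U \<Longrightarrow> openin (gtop G) U"
  by (simp add: open_bisection_def)

lemma bisection_arrows: "open_bisection G U \<Longrightarrow> g \<in> U \<Longrightarrow> g \<in> arrows G"
  using bisection_openin openin_subset by blast

lemma bisection_src_inj:
  "open_bisection G U \<Longrightarrow> g \<in> U \<Longrightarrow> h \<in> U \<Longrightarrow> gsrc G g = gsrc G h \<Longrightarrow> g = h"
  by (auto simp: open_bisection_def inj_on_def)

lemma bisection_rng_inj:
  "open_bisection G U \<Longrightarrow> g \<in> U \<Longrightarrow> h \<in> U \<Longrightarrow> grng G g = grng G h \<Longrightarrow> g = h"
  by (auto simp: open_bisection_def inj_on_def)

lemma bisection_units: "open_bisection G (gunits G)"
  by (auto simp: open_bisection_def openin_units inj_on_def groupoid_simps)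

lemma bisection_inv:
  assumes "open_bisection G U"
  shows "open_bisection G (ginv G ` U)"
  using assms bisection_arrows[OF assms]
  by (auto simp: open_bisection_def openin_inv_image inj_on_def groupoid_simps)

text \<open>The etale condition only speaks of the range. Injectivity of the source comes from the
  range condition at the inverse arrow.\<close>

lemma bisection_at:
  assumes "openin (gtop G) W" "g \<in> W"
  obtains U where "open_bisection G U" "g \<in> U" "U \<subseteq> W"
proof -
  have g: "g \<in> arrows G" using assms openin_subset by blast
  obtain A where A: "openin (gtop G) A" "g \<in> A" "inj_on (grng G) A"
    using local_homeomorphism_at[OF g] by metis
  obtain B where B: "openin (gtop G) B" "ginv G g \<in> B" "inj_on (grng G) B"
    using local_homeomorphism_at[OF inv_in[OF g]] by metis
  define U where "U = W \<inter> A \<inter> {h \<in> arrows G. ginv G h \<in> B}"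
  have "inj_on (gsrc G) U"
  proof (rule inj_onI)
    fix h k assume *: "h \<in> U" "k \<in> U" "gsrc G h = gsrc G k"
    have "ginv G h = ginv G k"
      by (rule inj_onD[OF B(3)]) (use * in \<open>simp_all add: U_def rng_inv\<close>)
    then have "ginv G (ginv G h) = ginv G (ginv G k)" by simp
    then show "h = k"
      using * by (simp add: U_def inv_inv)
  qed
  then have "open_bisection G U"
    using assms A B openin_inv_preimage by (auto simp: open_bisection_def U_def intro: inj_on_subset)
  then show ?thesis
    using that[of U] g assms A B by (auto simp: U_def)
qed

lemma units_separate:
  assumes "p \<in> gunits G" "q \<in> gunits G" "p \<noteq> q"
  obtains A B where "openin (gtop G) A" "openin (gtop G) B" "p \<in> A" "q \<in> B" "A \<inter> B = {}"
  using Hausdorff_units assms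
  unfolding Hausdorff_space_def topspace_unit_top openin_unit_top_iff disjnt_def by metis

text \<open>Bisections are Hausdorff even when \<open>G\<close> is not, because the range maps them
  injectively and continuously to the unit space.\<close>

lemma bisection_separate:
  assumes U: "open_bisection G U" and gh: "g \<in> U" "h \<in> U" "g \<noteq> h"
  obtains A B where "openin (gtop G) A" "openin (gtop G) B" "g \<in> A" "h \<in> B" "A \<inter> B = {}"
proof -
  have a: "g \<in> arrows G" "h \<in> arrows G" using bisection_arrows[OF U] gh by auto
  have "grng G g \<noteq> grng G h"
    using bisection_rng_inj[OF U gh(1,2)] gh(3) by blast
  then obtain A B where "openin (gtop G) A" "openin (gtop G) B" "grng G g \<in> A" "grng G h \<in> B" "A \<inter> B = {}"
    using units_separate[OF rng_in[OF a(1)] rng_in[OF a(2)]] by blast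
  then show ?thesis
    using that[of "{g \<in> arrows G. grng G g \<in> A}" "{g \<in> arrows G. grng G g \<in> B}"] a
    by (auto simp: openin_rng_preimage)
qed

text \<open>Needed for \<open>{g}\<close> to be a point of the Fell topology at all. A bisection
  around \<open>h\<close> either avoids \<open>g\<close> or contains both arrows, and then it
  separates them.\<close>

lemma closedin_singleton:
  assumes g: "g \<in> arrows G"
  shows "closedin (gtop G) {g}"
proof -
  have "openin (gtop G) (arrows G - {g})"
  proof (subst openin_subopen, intro ballI)
    fix h assume h: "h \<in> arrows G - {g}"
    then obtain U where U: "open_bisection G U" "h \<in> U"
      using bisection_at[of "arrows G" h] by blast
    show "\<exists>T. openin (gtop G) T \<and> h \<in> T \<and> T \<subseteq> arrows G - {g}"
    proof (cases "g \<in> U")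
      case True
      then obtain A B where "openin (gtop G) A" "openin (gtop G) B" "g \<in> A" "h \<in> B" "A \<inter> B = {}"
        using bisection_separate[OF U(1), of g h] U(2) h by blast
      then show ?thesis using openin_subset[of "gtop G" B] by blast
    next
      case False
      then show ?thesis using U bisection_openin[of U] openin_subset[of "gtop G" U] by blast
    qed
  qed
  then show ?thesis using g by (simp add: closedin_def)
qed

text \<open>The range map is continuous and open, so it carries a compact neighbourhood in
  \<open>G\<close> to one in the unit space.\<close>

lemma locally_compact_units: "locally_compact_space (unit_top G)"
  unfolding locally_compact_space_def
proof
  fix x assume "x \<in> topspace (unit_top G)"
  then have x: "x \<in> gunits G" by simp
  then obtain U K where UK: "openin (gtop G) U" "compactin (gtop G) K" "x \<in> U" "U \<subseteq> K"
    using locally_compact unit_arrow[OF x] unfolding locally_compact_space_def by meson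
  have "grng G ` U \<subseteq> gunits G"
    using openin_subset[OF UK(1)] by (auto simp: groupoid_simps)
  then have "openin (unit_top G) (grng G ` U)"
    using UK(1) by (simp add: openin_unit_top_iff openin_rng_image)
  moreover have "compactin (unit_top G) (grng G ` K)"
    by (rule image_compactin[OF UK(2) continuous_rng])
  moreover have "x \<in> grng G ` U"
    using UK(3) x by (metis image_eqI rng_unit)
  ultimately show "\<exists>U K. openin (unit_top G) U \<and> compactin (unit_top G) K \<and> x \<in> U \<and> U \<subseteq> K"
    using UK(4) by blast
qed

text \<open>On a bisection the range is a homeomorphism onto an open set of units. A cover of the
  preimage is pushed forward, reduced to a finite one there, and pulled back by injectivity.\<close>

lemma compactin_rng_section:
  assumes U: "open_bisection G U" and K: "compactin (unit_top G) K" "K \<subseteq> grng G ` U"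
  shows "compactin (gtop G) {g \<in> U. grng G g \<in> K}"
  unfolding compactin_def
proof (intro conjI allI impI)
  show "{g \<in> U. grng G g \<in> K} \<subseteq> arrows G"
    using bisection_arrows[OF U] by blast
  fix \<U> assume \<U>: "(\<forall>W\<in>\<U>. openin (gtop G) W) \<and> {g \<in> U. grng G g \<in> K} \<subseteq> \<Union>\<U>"
  have op: "openin (unit_top G) (grng G ` (U \<inter> W))" if "W \<in> \<U>" for W
    using \<U> that bisection_arrows[OF U]
    by (auto simp: openin_unit_top_iff groupoid_simps intro!: openin_rng_image bisection_openin[OF U])
  have cov: "K \<subseteq> \<Union>((\<lambda>W. grng G ` (U \<inter> W)) ` \<U>)"
  proof
    fix p assume p: "p \<in> K"
    then obtain g where "g \<in> U" "p = grng G g" using K(2) by blast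
    then show "p \<in> \<Union>((\<lambda>W. grng G ` (U \<inter> W)) ` \<U>)" using \<U> p by blast
  qed
  obtain \<F> where \<F>: "finite \<F>" "\<F> \<subseteq> (\<lambda>W. grng G ` (U \<inter> W)) ` \<U>" "K \<subseteq> \<Union>\<F>"
  proof -
    have "\<exists>\<F>. finite \<F> \<and> \<F> \<subseteq> (\<lambda>W. grng G ` (U \<inter> W)) ` \<U> \<and> K \<subseteq> \<Union>\<F>"
      by (rule compactinD[OF K(1)]) (use op cov in blast)+
    then show ?thesis using that by blast
  qed
  obtain \<G> where \<G>: "\<G> \<subseteq> \<U>" "finite \<G>" "\<F> = (\<lambda>W. grng G ` (U \<inter> W)) ` \<G>"
    using finite_subset_image[OF \<F>(1,2)] by blast
  have "{g \<in> U. grng G g \<in> K} \<subseteq> \<Union>\<G>"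
  proof
    fix g assume g: "g \<in> {g \<in> U. grng G g \<in> K}"
    then obtain W h where W: "W \<in> \<G>" "h \<in> U" "h \<in> W" "grng G g = grng G h"
      using \<F>(3) \<G>(3) by blast
    then have "g = h" using bisection_rng_inj[OF U] g by blast
    then show "g \<in> \<Union>\<G>" using W by blast
  qed
  then show "\<exists>\<F>. finite \<F> \<and> \<F> \<subseteq> \<U> \<and> {g \<in> U. grng G g \<in> K} \<subseteq> \<Union>\<F>"
    using \<G> by blast
qed

text \<open>Local compactness is assumed in the weak form (one compact neighbourhood for each point).
  Since \<open>G\<close> is locally Hausdorff, every point has arbitrarily small compact neighbourhoods.\<close>

lemma compact_neighbourhood:
  assumes W: "openin (gtop G) W" "g \<in> W"
  obtains V K where "openin (gtop G) V" "compactin (gtop G) K" "g \<in> V" "V \<subseteq> K" "K \<subseteq> W"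
proof -
  obtain U where U: "open_bisection G U" "g \<in> U" "U \<subseteq> W"
    using bisection_at[OF W] .
  have rU: "openin (unit_top G) (grng G ` U)"
    using bisection_arrows[OF U(1)]
    by (auto simp: openin_unit_top_iff groupoid_simps intro!: openin_rng_image bisection_openin[OF U(1)])
  have "neighbourhood_base_of (compactin (unit_top G)) (unit_top G)"
    using locally_compact_space_neighbourhood_base Hausdorff_units locally_compact_units by blast
  then obtain A K where AK: "openin (unit_top G) A" "compactin (unit_top G) K" "grng G g \<in> A"
      "A \<subseteq> K" "K \<subseteq> grng G ` U"
    using rU U(2) unfolding neighbourhood_base_of by (metis imageI)
  show ?thesis
  proof
    show "openin (gtop G) (U \<inter> {g \<in> arrows G. grng G g \<in> A})"
      using AK(1) bisection_openin[OF U(1)] openin_rng_preimage_units by blast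
    show "compactin (gtop G) {g \<in> U. grng G g \<in> K}"
      by (rule compactin_rng_section[OF U(1) AK(2,5)])
  qed (use U AK bisection_arrows[OF U(1)] in auto)
qed

section \<open>Multiplication in terms of neighbourhoods and compact sets\<close>

lemma mul_neighbourhood:
  assumes "g \<in> arrows G" "h \<in> arrows G" "gsrc G g = grng G h"
    and W: "openin (gtop G) W" "gmul G g h \<in> W"
  obtains U V where "openin (gtop G) U" "openin (gtop G) V" "g \<in> U" "h \<in> V"
    "\<And>u v. u \<in> U \<Longrightarrow> v \<in> V \<Longrightarrow> gsrc G u = grng G v \<Longrightarrow> gmul G u v \<in> W"
proof -
  define P where "P = {(g, h). gsrc G g = grng G h}"
  let ?T = "prod_topology (gtop G) (gtop G)"
  have "openin (subtopology ?T P) {x \<in> topspace (subtopology ?T P). (case x of (g, h) \<Rightarrow> gmul G g h) \<in> W}"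
    using openin_continuous_map_preimage[OF continuous_mul W(1)] unfolding P_def .
  then obtain Q where Q: "openin ?T Q"
      "{x \<in> topspace (subtopology ?T P). (case x of (g, h) \<Rightarrow> gmul G g h) \<in> W} = Q \<inter> P"
    unfolding openin_subtopology by blast
  have gh: "(g, h) \<in> Q"
  proof -
    have "(g, h) \<in> {x \<in> topspace (subtopology ?T P). (case x of (g, h) \<Rightarrow> gmul G g h) \<in> W}"
      using assms(1-3) W(2) by (simp add: P_def)
    then show ?thesis unfolding Q(2) by simp
  qed
  have "\<exists>U V. openin (gtop G) U \<and> openin (gtop G) V \<and> g \<in> U \<and> h \<in> V \<and> U \<times> V \<subseteq> Q"
    using Q(1) gh unfolding openin_prod_topology_alt by simp
  then obtain U V where UV: "openin (gtop G) U" "openin (gtop G) V" "g \<in> U" "h \<in> V" "U \<times> V \<subseteq> Q"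
    by blast
  have "gmul G u v \<in> W" if "u \<in> U" "v \<in> V" "gsrc G u = grng G v" for u v
  proof -
    have "(u, v) \<in> Q \<inter> P" using UV(5) that by (auto simp: P_def)
    then show ?thesis unfolding Q(2)[symmetric] by simp
  qed
  then show ?thesis using that UV by blast
qed

lemma mul3_neighbourhood:
  assumes "g \<in> arrows G" "k \<in> arrows G" "h \<in> arrows G" "gsrc G g = grng G k" "gsrc G k = grng G h"
    and W: "openin (gtop G) W" "gmul G (gmul G g k) h \<in> W"
  obtains U N V where "openin (gtop G) U" "openin (gtop G) N" "openin (gtop G) V"
    "g \<in> U" "k \<in> N" "h \<in> V"
    "\<And>u z v. u \<in> U \<Longrightarrow> z \<in> N \<Longrightarrow> v \<in> V \<Longrightarrow> gsrc G u = grng G z \<Longrightarrow> gsrc G z = grng G v \<Longrightarrow>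
      gmul G (gmul G u z) v \<in> W"
proof -
  obtain A V where A: "openin (gtop G) A" "openin (gtop G) V" "gmul G g k \<in> A" "h \<in> V"
    "\<And>u v. u \<in> A \<Longrightarrow> v \<in> V \<Longrightarrow> gsrc G u = grng G v \<Longrightarrow> gmul G u v \<in> W"
    using mul_neighbourhood[of "gmul G g k" h W] assms by (metis mul_in src_mul)
  obtain U N where U: "openin (gtop G) U" "openin (gtop G) N" "g \<in> U" "k \<in> N"
    "\<And>u v. u \<in> U \<Longrightarrow> v \<in> N \<Longrightarrow> gsrc G u = grng G v \<Longrightarrow> gmul G u v \<in> A"
    using mul_neighbourhood[OF assms(1,2,4) A(1,3)] by metis
  have "gmul G (gmul G u z) v \<in> W"
    if "u \<in> U" "z \<in> N" "v \<in> V" "gsrc G u = grng G z" "gsrc G z = grng G v" for u z v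
    using that U A openin_subset[OF U(1)] openin_subset[OF U(2)] by (metis src_mul subsetD)
  then show ?thesis using that A U by blast
qed

text \<open>Since the units are Hausdorff, the composable pairs are closed in the product space. So
  the composable part of \<open>A \<times> B\<close> is compact although \<open>A\<close> and
  \<open>B\<close> need not be closed.\<close>

lemma compactin_set_mul:
  assumes A: "compactin (gtop G) A" and B: "compactin (gtop G) B"
  shows "compactin (gtop G) (set_mul G A B)"
proof -
  let ?T = "prod_topology (gtop G) (gtop G)"
  define P where "P = {(g, h). gsrc G g = grng G h}"
  have "continuous_map ?T (unit_top G) (gsrc G \<circ> fst)"
    by (intro continuous_map_compose[OF continuous_map_fst continuous_src])
  moreover have "continuous_map ?T (unit_top G) (grng G \<circ> snd)"
    by (intro continuous_map_compose[OF continuous_map_snd continuous_rng])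
  ultimately have "closedin ?T {x \<in> topspace ?T. (gsrc G \<circ> fst) x = (grng G \<circ> snd) x}"
    by (rule closedin_continuous_maps_eq[OF Hausdorff_units])
  moreover have "compactin ?T (A \<times> B)"
    using A B by (simp add: compactin_Times)
  ultimately have "compactin ?T ({x \<in> topspace ?T. (gsrc G \<circ> fst) x = (grng G \<circ> snd) x} \<inter> (A \<times> B))"
    by (rule closed_Int_compactin)
  moreover have "{x \<in> topspace ?T. (gsrc G \<circ> fst) x = (grng G \<circ> snd) x} \<inter> (A \<times> B) = (A \<times> B) \<inter> P"
    using compactin_subset_topspace[OF A] compactin_subset_topspace[OF B] by (auto simp: P_def)
  ultimately have "compactin (subtopology ?T P) ((A \<times> B) \<inter> P)"
    by (simp add: compactin_subtopology)
  then have "compactin (gtop G) ((\<lambda>(g, h). gmul G g h) ` ((A \<times> B) \<inter> P))"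
    using image_compactin continuous_mul unfolding P_def by blast
  moreover have "(\<lambda>(g, h). gmul G g h) ` ((A \<times> B) \<inter> P) = set_mul G A B"
    by (force simp: set_mul_def P_def)
  ultimately show ?thesis by simp
qed

lemma compactin_inv_image: "compactin (gtop G) A \<Longrightarrow> compactin (gtop G) (ginv G ` A)"
  by (rule image_compactin[OF _ continuous_inv])

end

section \<open>The Fell topology\<close>

lemma openin_fell_basic:
  assumes "finite \<U>" "\<And>U. U \<in> \<U> \<Longrightarrow> openin S U" "compactin S K"
  shows "openin (fell_topology S) {F. closedin S F \<and> (\<forall>U\<in>\<U>. F \<inter> U \<noteq> {}) \<and> F \<inter> K = {}}"
  unfolding fell_topology_def using assms by (intro topology_generated_by_Basis) blast

lemma topspace_fell_topology: "topspace (fell_topology S) = {F. closedin S F}"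
proof -
  have "{F. closedin S F} = {F. closedin S F \<and> (\<forall>U\<in>{}. F \<inter> U \<noteq> {}) \<and> F \<inter> {} = {}}" by simp
  then have "{F. closedin S F} \<in> {{F. closedin S F \<and> (\<forall>U\<in>\<U>. F \<inter> U \<noteq> {}) \<and> F \<inter> K = {}} | \<U> K.
        finite \<U> \<and> (\<forall>U\<in>\<U>. openin S U) \<and> compactin S K}"
    by (intro CollectI exI[of _ "{}"]) simp
  then show ?thesis
    unfolding fell_topology_def topology_generated_by_topspace by blast
qed

text \<open>The generating sets are stable under finite intersections, hence they form a base and
  not merely a subbase.\<close>

lemma fell_open_contains_basic:
  assumes "openin (fell_topology S) W" "Z \<in> W"
  obtains \<U> K where "finite \<U>" "\<And>U. U \<in> \<U> \<Longrightarrow> openin S U" "compactin S K"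
    "\<And>U. U \<in> \<U> \<Longrightarrow> Z \<inter> U \<noteq> {}" "Z \<inter> K = {}"
    "{F. closedin S F \<and> (\<forall>U\<in>\<U>. F \<inter> U \<noteq> {}) \<and> F \<inter> K = {}} \<subseteq> W"
proof -
  define P where "P \<U> K W \<longleftrightarrow> finite \<U> \<and> (\<forall>U\<in>\<U>. openin S U) \<and> compactin S K \<and> (\<forall>U\<in>\<U>. Z \<inter> U \<noteq> {}) \<and>
    Z \<inter> K = {} \<and> {F. closedin S F \<and> (\<forall>U\<in>\<U>. F \<inter> U \<noteq> {}) \<and> F \<inter> K = {}} \<subseteq> W" for \<U> K W
  have mono: "P \<U> K V" if "P \<U> K W" "W \<subseteq> V" for \<U> K V W
    using that by (auto simp: P_def)
  have "generate_topology_on {{F. closedin S F \<and> (\<forall>U\<in>\<U>. F \<inter> U \<noteq> {}) \<and> F \<inter> K = {}} | \<U> K.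
        finite \<U> \<and> (\<forall>U\<in>\<U>. openin S U) \<and> compactin S K} W"
    using assms(1) unfolding fell_topology_def by (rule openin_topology_generated_by)
  then have "Z \<in> W \<Longrightarrow> \<exists>\<U> K. P \<U> K W"
  proof induction
    case (Int A B)
    then obtain \<U> K \<V> L where "P \<U> K A" "P \<V> L B" by auto
    then have "P (\<U> \<union> \<V>) (K \<union> L) (A \<inter> B)"
      by (auto simp: P_def compactin_Un Int_Un_distrib)
    then show ?case by blast
  next
    case (UN \<K>)
    then show ?case using mono by blast
  next
    case (Basis A)
    then obtain \<U> K where A: "A = {F. closedin S F \<and> (\<forall>U\<in>\<U>. F \<inter> U \<noteq> {}) \<and> F \<inter> K = {}}"
      "finite \<U>" "\<forall>U\<in>\<U>. openin S U" "compactin S K" by blast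
    then have "P \<U> K A" using Basis by (auto simp: P_def)
    then show ?case by blast
  qed simp
  then obtain \<U> K where "P \<U> K W" using assms(2) by blast
  then show ?thesis unfolding P_def using that[of \<U> K] by simp
qed

text \<open>Alexander's subbase theorem applies to the sets "meets \<open>U\<close>" and "misses
  \<open>K\<close>". The empty set counts as a point here, and no separation axiom on
  \<open>S\<close> enters. The result is the source of compact supports on the cover.\<close>

lemma compact_space_fell_topology: "compact_space (fell_topology S)"
proof -
  define \<B> where "\<B> = {{F. closedin S F \<and> F \<inter> U \<noteq> {}} | U. openin S U} \<union>
    {{F. closedin S F \<and> F \<inter> K = {}} | K. compactin S K}"
  let ?T = "topology (arbitrary union_of (finite intersection_of (\<lambda>x. x \<in> \<B>) relative_to \<Union>\<B>))"
  have UB: "\<Union>\<B> = {F. closedin S F}"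
  proof -
    have "{F. closedin S F \<and> F \<inter> {} = {}} \<in> \<B>"
      using compactin_empty[of S] unfolding \<B>_def by blast
    then have "{F. closedin S F} \<in> \<B>" by simp
    then show ?thesis by (auto simp: \<B>_def)
  qed
  have openB: "openin ?T A" if "A \<in> \<B>" for A
  proof -
    have "(finite intersection_of (\<lambda>x. x \<in> \<B>) relative_to \<Union>\<B>) A"
      unfolding relative_to_def using that by (intro exI[of _ A]) (auto simp: finite_intersection_of_inc)
    then show ?thesis by (simp add: openin_subbase arbitrary_union_of_inc)
  qed
  have fellB: "openin (fell_topology S) A" if A: "A \<in> \<B>" for A
  proof -
    consider U where "openin S U" "A = {F. closedin S F \<and> F \<inter> U \<noteq> {}}"
      | K where "compactin S K" "A = {F. closedin S F \<and> F \<inter> K = {}}"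
      using A by (auto simp: \<B>_def)
    then show ?thesis
    proof cases
      case 1
      then show ?thesis using openin_fell_basic[of "{U}" S "{}"] by simp
    next
      case 2
      then show ?thesis using openin_fell_basic[of "{}" S K] by simp
    qed
  qed
  \<comment> \<open>The subbase theorem expects a topology in the form \<open>?T\<close>, so the
    Fell topology is first rewritten with the simpler generators that test one open or one compact
    set.\<close>
  have eq: "?T = fell_topology S"
  proof (subst topology_eq, intro allI iffI)
    fix W assume "openin ?T W"
    moreover have "openin (fell_topology S) (\<Union>\<B>)"
      using openin_topspace[of "fell_topology S"] by (simp add: UB topspace_fell_topology)
    ultimately show "openin (fell_topology S) W"
      using minimal_topology_subbase[of "\<lambda>x. x \<in> \<B>", OF fellB] by blast
  next
    fix W assume W: "openin (fell_topology S) W"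
    show "openin ?T W"
    proof (subst openin_subopen, intro ballI)
      fix Z assume Z: "Z \<in> W"
      then have "closedin S Z" using W openin_subset topspace_fell_topology by blast
      obtain \<U> K where UK: "finite \<U>" "\<And>U. U \<in> \<U> \<Longrightarrow> openin S U" "compactin S K"
        "\<And>U. U \<in> \<U> \<Longrightarrow> Z \<inter> U \<noteq> {}" "Z \<inter> K = {}"
        "{F. closedin S F \<and> (\<forall>U\<in>\<U>. F \<inter> U \<noteq> {}) \<and> F \<inter> K = {}} \<subseteq> W"
        using fell_open_contains_basic[OF W Z] by blast
      define N where "N = \<Inter>(insert {F. closedin S F \<and> F \<inter> K = {}} ((\<lambda>U. {F. closedin S F \<and> F \<inter> U \<noteq> {}}) ` \<U>))"
      have "openin ?T N"
        unfolding N_def by (intro openin_Inter openB) (use UK in \<open>auto simp: \<B>_def\<close>)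
      moreover have "Z \<in> N" using UK(4,5) \<open>closedin S Z\<close> by (auto simp: N_def)
      moreover have "N \<subseteq> W"
        using UK(6) by (rule order_trans[rotated]) (auto simp: N_def)
      ultimately show "\<exists>T. openin ?T T \<and> Z \<in> T \<and> T \<subseteq> W"
        by (intro exI[of _ N] conjI)
    qed
  qed
  show ?thesis
  proof (rule Alexander_subbase[OF eq])
    fix C assume C: "C \<subseteq> \<B>" "\<Union>C = topspace (fell_topology S)"
    then have UC: "\<Union>C = {F. closedin S F}" by (simp add: topspace_fell_topology)
    define \<U> where "\<U> = {U. openin S U \<and> {F. closedin S F \<and> F \<inter> U \<noteq> {}} \<in> C}"
    text \<open>The complement of all the open sets that occur in the cover can only be covered by one of
      the sets \<open>{F. F \<inter> K = {}}\<close>; then these open sets cover \<open>K\<close>.\<close>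
    have "closedin S (topspace S - \<Union>\<U>)"
      by (intro closedin_diff) (auto simp: \<U>_def)
    then obtain A where A: "A \<in> C" "topspace S - \<Union>\<U> \<in> A"
      using UC by blast
    have "\<exists>K. compactin S K \<and> A = {F. closedin S F \<and> F \<inter> K = {}}"
      using A C(1) by (force simp: \<B>_def \<U>_def)
    then obtain K where K: "compactin S K" "A = {F. closedin S F \<and> F \<inter> K = {}}" by blast
    have "K \<subseteq> \<Union>\<U>"
      using A(2) K compactin_subset_topspace[OF K(1)] by blast
    then obtain \<F> where \<F>: "finite \<F>" "\<F> \<subseteq> \<U>" "K \<subseteq> \<Union>\<F>"
      using K(1) unfolding compactin_def by (metis (no_types, lifting) \<U>_def mem_Collect_eq)
    define C' where "C' = insert A ((\<lambda>U. {F. closedin S F \<and> F \<inter> U \<noteq> {}}) ` \<F>)"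
    have "finite C'" "C' \<subseteq> C" using \<F> A by (auto simp: C'_def \<U>_def)
    moreover have "\<Union>C' = {F. closedin S F}"
    proof
      show "\<Union>C' \<subseteq> {F. closedin S F}" using \<open>C' \<subseteq> C\<close> UC by blast
      show "{F. closedin S F} \<subseteq> \<Union>C'"
      proof
        fix F assume F: "F \<in> {F. closedin S F}"
        show "F \<in> \<Union>C'"
        proof (cases "F \<inter> K = {}")
          case True
          then show ?thesis using F K by (auto simp: C'_def)
        next
          case False
          then obtain U where "U \<in> \<F>" "F \<inter> U \<noteq> {}" using \<F>(3) by blast
          then show ?thesis using F by (auto simp: C'_def)
        qed
      qed
    qed
    ultimately show "\<exists>C'. finite C' \<and> C' \<subseteq> C \<and> \<Union>C' = topspace (fell_topology S)"
      by (intro exI[of _ C']) (simp add: topspace_fell_topology)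
  qed
qed

text \<open>The neighbourhood filter of \<open>Z\<close> in the Fell topology, restricted to singletons.\<close>

definition fell_filter :: "'a topology \<Rightarrow> 'a set \<Rightarrow> 'a filter" where
  "fell_filter S Z =
     (INF (\<U>, K)\<in>{(\<U>, K). finite \<U> \<and> (\<forall>U\<in>\<U>. openin S U \<and> Z \<inter> U \<noteq> {}) \<and> compactin S K \<and> Z \<inter> K = {}}.
        principal {z \<in> topspace S. (\<forall>U\<in>\<U>. z \<in> U) \<and> z \<notin> K})"

lemma eventually_fell_filter:
  "eventually P (fell_filter S Z) \<longleftrightarrow>
    (\<exists>\<U> K. finite \<U> \<and> (\<forall>U\<in>\<U>. openin S U \<and> Z \<inter> U \<noteq> {}) \<and> compactin S K \<and> Z \<inter> K = {} \<and>
      (\<forall>z\<in>topspace S. (\<forall>U\<in>\<U>. z \<in> U) \<and> z \<notin> K \<longrightarrow> P z))"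
proof -
  let ?B = "{(\<U>, K). finite \<U> \<and> (\<forall>U\<in>\<U>. openin S U \<and> Z \<inter> U \<noteq> {}) \<and> compactin S K \<and> Z \<inter> K = {}}"
  let ?F = "\<lambda>(\<U>, K). principal {z \<in> topspace S. (\<forall>U\<in>\<U>. z \<in> U) \<and> z \<notin> K}"
  have "eventually P (fell_filter S Z) \<longleftrightarrow> (\<exists>b\<in>?B. eventually P (?F b))"
    unfolding fell_filter_def
  proof (rule eventually_INF_base)
    have "({}, {}) \<in> ?B" by simp
    then show "?B \<noteq> {}" by blast
    fix a b assume "a \<in> ?B" "b \<in> ?B"
    moreover obtain \<U> K \<V> L where "a = (\<U>, K)" "b = (\<V>, L)" by (cases a, cases b)
    moreover from calculation have "(\<U> \<union> \<V>, K \<union> L) \<in> ?B"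
      by (auto simp: compactin_Un Int_Un_distrib)
    ultimately show "\<exists>x\<in>?B. ?F x \<le> inf (?F a) (?F b)"
      by (intro bexI[of _ "(\<U> \<union> \<V>, K \<union> L)"]) auto
  qed
  also have "\<dots> \<longleftrightarrow> (\<exists>\<U> K. finite \<U> \<and> (\<forall>U\<in>\<U>. openin S U \<and> Z \<inter> U \<noteq> {}) \<and> compactin S K \<and> Z \<inter> K = {} \<and>
      (\<forall>z\<in>topspace S. (\<forall>U\<in>\<U>. z \<in> U) \<and> z \<notin> K \<longrightarrow> P z))"
  proof -
    have "eventually P (?F (\<U>, K)) \<longleftrightarrow> (\<forall>z\<in>topspace S. (\<forall>U\<in>\<U>. z \<in> U) \<and> z \<notin> K \<longrightarrow> P z)" for \<U> K
      by (auto simp: eventually_principal)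
    then show ?thesis
      unfolding Bex_def split_paired_Ex by simp
  qed
  finally show ?thesis .
qed

lemma eventually_fell_filter_topspace: "\<forall>\<^sub>F z in fell_filter S Z. z \<in> topspace S"
  unfolding eventually_fell_filter by (intro exI[of _ "{}"]) simp

lemma eventually_fell_filter_open:
  "openin S U \<Longrightarrow> Z \<inter> U \<noteq> {} \<Longrightarrow> \<forall>\<^sub>F z in fell_filter S Z. z \<in> U"
  unfolding eventually_fell_filter by (intro exI[of _ "{U}"] exI[of _ "{}"]) simp

lemma eventually_fell_filter_compact:
  "compactin S K \<Longrightarrow> Z \<inter> K = {} \<Longrightarrow> \<forall>\<^sub>F z in fell_filter S Z. z \<notin> K"
  unfolding eventually_fell_filter by (intro exI[of _ "{}"] exI[of _ K]) simp

lemma filterlim_fell_filterI: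
  assumes top: "\<forall>\<^sub>F w in F. f w \<in> topspace S"
    and op: "\<And>U. openin S U \<Longrightarrow> Z \<inter> U \<noteq> {} \<Longrightarrow> \<forall>\<^sub>F w in F. f w \<in> U"
    and cp: "\<And>K. compactin S K \<Longrightarrow> Z \<inter> K = {} \<Longrightarrow> \<forall>\<^sub>F w in F. f w \<notin> K"
  shows "filterlim f (fell_filter S Z) F"
  unfolding filterlim_iff
proof (intro allI impI)
  fix P assume "eventually P (fell_filter S Z)"
  then obtain \<U> K where UK: "finite \<U>" "\<And>U. U \<in> \<U> \<Longrightarrow> openin S U \<and> Z \<inter> U \<noteq> {}" "compactin S K"
      "Z \<inter> K = {}" "\<And>z. z \<in> topspace S \<Longrightarrow> (\<forall>U\<in>\<U>. z \<in> U) \<Longrightarrow> z \<notin> K \<Longrightarrow> P z"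
    unfolding eventually_fell_filter by metis
  have "\<forall>\<^sub>F w in F. \<forall>U\<in>\<U>. f w \<in> U"
    using UK op by (intro eventually_ball_finite) auto
  with top cp[OF UK(3,4)] show "\<forall>\<^sub>F w in F. P (f w)"
    by eventually_elim (use UK(5) in blast)
qed

text \<open>Lets a filter on the points of \<open>S\<close> replace the topology on sets of points:
  closure becomes a statement with \<open>\<exists>\<^sub>F\<close>, and limits along singletons
  become ordinary limits of functions on \<open>S\<close>.\<close>

lemma in_fell_closure_singletons:
  assumes Z: "closedin S Z" and Y: "\<And>y. y \<in> Y \<Longrightarrow> closedin S {y}"
  shows "Z \<in> fell_topology S closure_of ((\<lambda>g. {g}) ` Y) \<longleftrightarrow> (\<exists>\<^sub>F z in fell_filter S Z. z \<in> Y)"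
proof
  assume L: "Z \<in> fell_topology S closure_of ((\<lambda>g. {g}) ` Y)"
  show "\<exists>\<^sub>F z in fell_filter S Z. z \<in> Y"
    unfolding frequently_def
  proof
    assume "\<forall>\<^sub>F z in fell_filter S Z. \<not> z \<in> Y"
    then obtain \<U> K where UK: "finite \<U>" "\<And>U. U \<in> \<U> \<Longrightarrow> openin S U" "\<And>U. U \<in> \<U> \<Longrightarrow> Z \<inter> U \<noteq> {}"
      "compactin S K" "Z \<inter> K = {}"
      "\<And>z. z \<in> topspace S \<Longrightarrow> (\<forall>U\<in>\<U>. z \<in> U) \<Longrightarrow> z \<notin> K \<Longrightarrow> z \<notin> Y"
      unfolding eventually_fell_filter by metis
    have "Z \<in> {F. closedin S F \<and> (\<forall>U\<in>\<U>. F \<inter> U \<noteq> {}) \<and> F \<inter> K = {}}"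
      using UK Z by auto
    then have "\<exists>A. A \<in> (\<lambda>g. {g}) ` Y \<and> A \<in> {F. closedin S F \<and> (\<forall>U\<in>\<U>. F \<inter> U \<noteq> {}) \<and> F \<inter> K = {}}"
      by (intro L[unfolded in_closure_of, THEN conjunct2, THEN spec, THEN mp] conjI
          openin_fell_basic UK)
    then obtain y where "y \<in> Y" "{y} \<in> {F. closedin S F \<and> (\<forall>U\<in>\<U>. F \<inter> U \<noteq> {}) \<and> F \<inter> K = {}}"
      by auto
    then show False
      using UK(6)[of y] closedin_subset[of S "{y}"] by auto
  qed
next
  assume R: "\<exists>\<^sub>F z in fell_filter S Z. z \<in> Y"
  show "Z \<in> fell_topology S closure_of ((\<lambda>g. {g}) ` Y)"
    unfolding in_closure_of topspace_fell_topology
  proof (intro conjI allI impI CollectI)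
    fix W assume W: "Z \<in> W \<and> openin (fell_topology S) W"
    obtain \<U> K where UK: "finite \<U>" "\<And>U. U \<in> \<U> \<Longrightarrow> openin S U" "compactin S K"
      "\<And>U. U \<in> \<U> \<Longrightarrow> Z \<inter> U \<noteq> {}" "Z \<inter> K = {}"
      "{F. closedin S F \<and> (\<forall>U\<in>\<U>. F \<inter> U \<noteq> {}) \<and> F \<inter> K = {}} \<subseteq> W"
      using fell_open_contains_basic[of S W Z] W by blast
    have "\<forall>\<^sub>F z in fell_filter S Z. (\<forall>U\<in>\<U>. z \<in> U) \<and> z \<notin> K"
      unfolding eventually_fell_filter using UK by (intro exI[of _ \<U>] exI[of _ K]) auto
    then obtain y where y: "y \<in> Y" "\<forall>U\<in>\<U>. y \<in> U" "y \<notin> K"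
      using frequently_ex[OF frequently_eventually_conj[OF R]] by blast
    then have "{y} \<in> W" using UK(6) Y[OF y(1)] by auto
    then show "\<exists>A. A \<in> (\<lambda>g. {g}) ` Y \<and> A \<in> W" using y by blast
  qed (rule Z)
qed

section \<open>The Hausdorff cover\<close>

text \<open>The set \<open>g Z h\<close>. The source of an arrow \<open>A\<close> of the cover, the
  recovery of \<open>A\<close> from its source, and the products \<open>A B\<^sup>-\<^sup>1\<close>
  all have this form, so one continuity statement covers them.\<close>

definition translate :: "'g groupoid_data \<Rightarrow> 'g \<Rightarrow> 'g set \<Rightarrow> 'g \<Rightarrow> 'g set" where
  "translate G g Z h = (\<lambda>k. gmul G (gmul G g k) h) ` Z"

abbreviation src_section :: "'g groupoid_data \<Rightarrow> 'g set \<Rightarrow> 'g \<Rightarrow> 'g" where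
  "src_section G U \<equiv> inv_into U (gsrc G)"

abbreviation rng_section :: "'g groupoid_data \<Rightarrow> 'g set \<Rightarrow> 'g \<Rightarrow> 'g" where
  "rng_section G U \<equiv> inv_into U (grng G)"

lemma set_mulI:
  "a \<in> A \<Longrightarrow> b \<in> B \<Longrightarrow> gsrc G a = grng G b \<Longrightarrow> gmul G a b \<in> set_mul G A B"
  by (auto simp: set_mul_def)

context etale_groupoid
begin

abbreviation "H \<equiv> hausdorff_cover G"
abbreviation "near \<equiv> fell_filter (gtop G)"

lemma src_section: "open_bisection G U \<Longrightarrow> u \<in> U \<Longrightarrow> src_section G U (gsrc G u) = u"
  by (simp add: open_bisection_def)

lemma rng_section: "open_bisection G U \<Longrightarrow> u \<in> U \<Longrightarrow> rng_section G U (grng G u) = u"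
  by (simp add: open_bisection_def)

lemma cover_carrier_eq:
  "cover_carrier G = {F. F \<noteq> {}} \<inter> fell_topology (gtop G) closure_of ((\<lambda>g. {g}) ` arrows G)"
proof -
  have "{F. F \<noteq> {}} \<inter> (\<lambda>g. {g}) ` arrows G = (\<lambda>g. {g}) ` arrows G" by auto
  then show ?thesis by (simp add: cover_carrier_def closure_of_subtopology)
qed

lemma cover_arrows_eq: "arrows H = cover_carrier G"
proof -
  have "cover_carrier G \<subseteq> topspace (fell_topology (gtop G))"
    using closure_of_subset_topspace by (fastforce simp: cover_carrier_eq)
  then show ?thesis
    by (auto simp: hausdorff_cover_def cover_top_def)
qed

text \<open>Every basic Fell neighbourhood of \<open>Z\<close> has to contain a singleton, which is
  what properness of \<open>near Z\<close> expresses.\<close>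

lemma cover_arrow_iff:
  "Z \<in> arrows H \<longleftrightarrow> closedin (gtop G) Z \<and> Z \<noteq> {} \<and> near Z \<noteq> bot"
proof (cases "closedin (gtop G) Z")
  case True
  have "near Z \<noteq> bot \<longleftrightarrow> (\<exists>\<^sub>F z in near Z. z \<in> arrows G)"
    unfolding trivial_limit_def frequently_def
    by (intro arg_cong[where f = Not] eventually_subst
        eventually_mono[OF eventually_fell_filter_topspace[of "gtop G" Z]]) simp
  then show ?thesis
    using True in_fell_closure_singletons[OF True, of "arrows G"] closedin_singleton
    by (auto simp: cover_arrows_eq cover_carrier_eq)
next
  case False
  then show ?thesis
    using closure_of_subset_topspace[of "fell_topology (gtop G)"] topspace_fell_topology[of "gtop G"]
    by (auto simp: cover_arrows_eq cover_carrier_eq)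
qed

lemma eventually_near_singleton: "g \<in> arrows G \<Longrightarrow> eventually P (near {g}) \<Longrightarrow> P g"
  unfolding eventually_fell_filter by auto

lemma singleton_cover_arrow:
  assumes "g \<in> arrows G"
  shows "{g} \<in> arrows H"
  using assms closedin_singleton eventually_near_singleton[OF assms, of "\<lambda>_. False"]
  by (auto simp: cover_arrow_iff trivial_limit_def)

lemma cover_unit_iff:
  "Z \<in> gunits H \<longleftrightarrow> Z \<in> arrows H \<and> (\<exists>\<^sub>F z in near Z. z \<in> gunits G)"
proof -
  have "(\<lambda>x. {x}) ` gunits G \<subseteq> cover_carrier G"
    using singleton_cover_arrow unit_arrow cover_arrows_eq by blast
  then have "gunits H = cover_carrier G \<inter> fell_topology (gtop G) closure_of ((\<lambda>x. {x}) ` gunits G)"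
    by (simp add: hausdorff_cover_def cover_top_def closure_of_subtopology Int_absorb1)
  then show ?thesis
    using in_fell_closure_singletons[of "gtop G" Z "gunits G"] closedin_singleton unit_arrow cover_arrow_iff[of Z]
    by (auto simp: cover_arrows_eq)
qed

lemma singleton_cover_unit:
  assumes "x \<in> gunits G"
  shows "{x} \<in> gunits H"
  unfolding cover_unit_iff frequently_def
  using assms singleton_cover_arrow eventually_near_singleton[of x "\<lambda>z. z \<notin> gunits G"] unit_arrow by auto

lemma cover_near_bot: "Z \<in> arrows H \<Longrightarrow> near Z \<noteq> bot"
  and cover_closed: "Z \<in> arrows H \<Longrightarrow> closedin (gtop G) Z"
  and cover_nonempty: "Z \<in> arrows H \<Longrightarrow> Z \<noteq> {}"
  by (simp_all add: cover_arrow_iff)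

lemma cover_elem_arrow: "Z \<in> arrows H \<Longrightarrow> a \<in> Z \<Longrightarrow> a \<in> arrows G"
  using cover_closed closedin_subset by blast

text \<open>Different values in the Hausdorff unit space would have disjoint neighbourhoods, and the
  singletons near \<open>Z\<close> would have to lie over both. The map \<open>f\<close> is abstract
  in order to serve range and source alike.\<close>

lemma cover_const:
  assumes Z: "Z \<in> arrows H" and ab: "a \<in> Z" "b \<in> Z"
    and f: "\<And>g. g \<in> arrows G \<Longrightarrow> f g \<in> gunits G"
    and op: "\<And>A. openin (gtop G) A \<Longrightarrow> openin (gtop G) {g \<in> arrows G. f g \<in> A}"
  shows "f a = f b"
proof (rule ccontr)
  assume ne: "f a \<noteq> f b"
  have a: "a \<in> arrows G" "b \<in> arrows G" using cover_elem_arrow[OF Z] ab by auto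
  obtain A B where AB: "openin (gtop G) A" "openin (gtop G) B" "f a \<in> A" "f b \<in> B" "A \<inter> B = {}"
    using units_separate[OF f[OF a(1)] f[OF a(2)] ne] .
  have "\<forall>\<^sub>F z in near Z. z \<in> {g \<in> arrows G. f g \<in> A}" "\<forall>\<^sub>F z in near Z. z \<in> {g \<in> arrows G. f g \<in> B}"
    by ((rule eventually_fell_filter_open[OF op]; use ab a AB in auto)+)
  then have "\<forall>\<^sub>F z in near Z. False"
    by eventually_elim (use AB in blast)
  then show False using cover_near_bot[OF Z] by (simp add: trivial_limit_def)
qed

lemmas cover_rng_const = cover_const[OF _ _ _ rng_in openin_rng_preimage]
  and cover_src_const = cover_const[OF _ _ _ src_in openin_src_preimage]

text \<open>The standard way to show membership in \<open>Z\<close>: a point outside has a compact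
  neighbourhood outside, and the Fell topology keeps the singletons near \<open>Z\<close> away from
  it.\<close>

lemma cover_limit_in:
  assumes Z: "Z \<in> arrows H" and c: "c \<in> arrows G"
    and lim: "\<And>W. openin (gtop G) W \<Longrightarrow> c \<in> W \<Longrightarrow> \<exists>\<^sub>F z in near Z. z \<in> W"
  shows "c \<in> Z"
proof (rule ccontr)
  assume "c \<notin> Z"
  then have "c \<in> arrows G - Z" using c by blast
  moreover have "openin (gtop G) (arrows G - Z)"
    using cover_closed[OF Z] by (simp add: closedin_def)
  ultimately obtain V K where VK: "openin (gtop G) V" "compactin (gtop G) K" "c \<in> V" "V \<subseteq> K" "K \<subseteq> arrows G - Z"
    using compact_neighbourhood by metis
  have "\<forall>\<^sub>F z in near Z. z \<notin> K"
    using VK by (intro eventually_fell_filter_compact) auto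
  then have "\<forall>\<^sub>F z in near Z. z \<notin> V"
    by (rule eventually_mono) (use VK in blast)
  with lim[OF VK(1,3)] show False by (simp add: frequently_def)
qed

lemma eventually_near_rng:
  assumes "Z \<inter> {g \<in> arrows G. grng G g \<in> A} \<noteq> {}" "openin (gtop G) A"
  shows "\<forall>\<^sub>F z in near Z. grng G z \<in> A"
  using eventually_fell_filter_open[OF openin_rng_preimage[OF assms(2)] assms(1)]
  by (rule eventually_mono) simp

lemma eventually_near_src:
  assumes "Z \<inter> {g \<in> arrows G. gsrc G g \<in> A} \<noteq> {}" "openin (gtop G) A"
  shows "\<forall>\<^sub>F z in near Z. gsrc G z \<in> A"
  using eventually_fell_filter_open[OF openin_src_preimage[OF assms(2)] assms(1)]
  by (rule eventually_mono) simp

text \<open>The factors \<open>g\<close> and \<open>h\<close> are replaced by the nearby arrows of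
  \<open>U\<close> and \<open>V\<close> that compose with \<open>z\<close>. Conditions "meets an
  open set" pull back by continuity of the multiplication. Conditions "misses a compact set" pull
  back after \<open>g\<close> and \<open>h\<close> are fattened to compact sets, since products of
  compact sets are compact.\<close>

lemma filterlim_translate:
  assumes Z: "Z \<subseteq> arrows G" "Z \<noteq> {}"
    and rZ: "\<And>k. k \<in> Z \<Longrightarrow> grng G k = gsrc G g" and sZ: "\<And>k. k \<in> Z \<Longrightarrow> gsrc G k = grng G h"
    and U: "open_bisection G U" "g \<in> U" and V: "open_bisection G V" "h \<in> V"
  shows "filterlim (\<lambda>z. gmul G (gmul G (src_section G U (grng G z)) z) (rng_section G V (gsrc G z)))
    (near (translate G g Z h)) (near Z)"
proof -
  define w where "w z = gmul G (gmul G (src_section G U (grng G z)) z) (rng_section G V (gsrc G z))" for z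
  obtain k0 where k0: "k0 \<in> Z" using Z by blast
  have g: "g \<in> arrows G" and h: "h \<in> arrows G"
    using bisection_arrows U V by auto
  \<comment> \<open>Shrinking \<open>U\<close> and \<open>V\<close> does not change the sections
    near the given points, so the two factors may be assumed to lie in any prescribed neighbourhoods
    of \<open>g\<close> and \<open>h\<close>.\<close>
  have local: "\<forall>\<^sub>F z in near Z. z \<in> arrows G \<and> (\<exists>u\<in>U'. \<exists>v\<in>V'. gsrc G u = grng G z \<and> gsrc G z = grng G v \<and>
      w z = gmul G (gmul G u z) v)"
    if U': "openin (gtop G) U'" "g \<in> U'" "U' \<subseteq> U" and V': "openin (gtop G) V'" "h \<in> V'" "V' \<subseteq> V" for U' V'
  proof -
    have "\<forall>\<^sub>F z in near Z. grng G z \<in> gsrc G ` U'"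
      by (rule eventually_near_rng) (use U' k0 rZ Z openin_src_image in auto)
    moreover have "\<forall>\<^sub>F z in near Z. gsrc G z \<in> grng G ` V'"
      by (rule eventually_near_src) (use V' k0 sZ Z openin_rng_image in auto)
    ultimately show ?thesis
      using eventually_fell_filter_topspace[of "gtop G" Z]
    proof eventually_elim
      case (elim z)
      then obtain u v where uv: "u \<in> U'" "v \<in> V'" "grng G z = gsrc G u" "gsrc G z = grng G v" by blast
      then have "w z = gmul G (gmul G u z) v"
        using U' V' U(1) V(1) by (simp add: w_def src_section rng_section subsetD)
      then show ?case using uv elim by auto
    qed
  qed
  have "filterlim w (near (translate G g Z h)) (near Z)"
  proof (rule filterlim_fell_filterI)
    have "\<forall>\<^sub>F z in near Z. z \<in> arrows G \<and> (\<exists>u\<in>U. \<exists>v\<in>V. gsrc G u = grng G z \<and> gsrc G z = grng G v \<and>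
      w z = gmul G (gmul G u z) v)"
      using U V by (intro local) (auto simp: bisection_openin)
    then show "\<forall>\<^sub>F z in near Z. w z \<in> arrows G"
      by (rule eventually_mono) (auto simp: mul_in src_mul bisection_arrows[OF U(1)] bisection_arrows[OF V(1)])
  next
    fix W assume W: "openin (gtop G) W" "translate G g Z h \<inter> W \<noteq> {}"
    then obtain k where k: "k \<in> Z" "gmul G (gmul G g k) h \<in> W" by (auto simp: translate_def)
    have ka: "k \<in> arrows G" "gsrc G g = grng G k" "gsrc G k = grng G h"
      using k Z rZ sZ by auto
    obtain A N B where ANB: "openin (gtop G) A" "openin (gtop G) N" "openin (gtop G) B"
      "g \<in> A" "k \<in> N" "h \<in> B"
      "\<And>u z v. u \<in> A \<Longrightarrow> z \<in> N \<Longrightarrow> v \<in> B \<Longrightarrow> gsrc G u = grng G z \<Longrightarrow> gsrc G z = grng G v \<Longrightarrow>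
        gmul G (gmul G u z) v \<in> W"
      using mul3_neighbourhood[OF g ka(1) h ka(2,3) W(1) k(2)] by metis
    have "\<forall>\<^sub>F z in near Z. z \<in> N"
      using ANB k by (intro eventually_fell_filter_open) auto
    moreover have "\<forall>\<^sub>F z in near Z. z \<in> arrows G \<and> (\<exists>u\<in>U \<inter> A. \<exists>v\<in>V \<inter> B. gsrc G u = grng G z \<and>
        gsrc G z = grng G v \<and> w z = gmul G (gmul G u z) v)"
      using U V ANB by (intro local) (auto simp: bisection_openin openin_Int)
    ultimately show "\<forall>\<^sub>F z in near Z. w z \<in> W"
      by eventually_elim (use ANB(7) in auto)
  next
    fix K assume K: "compactin (gtop G) K" "translate G g Z h \<inter> K = {}"
    obtain A C where A: "openin (gtop G) A" "compactin (gtop G) C" "g \<in> A" "A \<subseteq> C" "C \<subseteq> U"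
      using compact_neighbourhood[OF bisection_openin[OF U(1)] U(2)] by metis
    obtain B D where B: "openin (gtop G) B" "compactin (gtop G) D" "h \<in> B" "B \<subseteq> D" "D \<subseteq> V"
      using compact_neighbourhood[OF bisection_openin[OF V(1)] V(2)] by metis
    \<comment> \<open>If \<open>u z v\<close> is in \<open>K\<close> with \<open>u\<close> in
      \<open>C\<close> and \<open>v\<close> in \<open>D\<close>, then \<open>z\<close> is in
      \<open>L\<close>; so it suffices to avoid \<open>L\<close>. The set \<open>Z\<close> misses
      \<open>L\<close> because \<open>C\<close> and \<open>D\<close> lie in bisections:
      \<open>g\<close> is the only arrow of \<open>C\<close> with its source, and \<open>h\<close>
      the only arrow of \<open>D\<close> with its range.\<close>
    define L where "L = set_mul G (set_mul G (ginv G ` C) K) (ginv G ` D)"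
    have "compactin (gtop G) L"
      unfolding L_def using A B K by (intro compactin_set_mul compactin_inv_image)
    moreover have "Z \<inter> L = {}"
    proof (rule ccontr)
      assume "Z \<inter> L \<noteq> {}"
      then obtain z u k v where *: "z \<in> Z" "u \<in> C" "k \<in> K" "v \<in> D" "gsrc G (ginv G u) = grng G k"
        "gsrc G (gmul G (ginv G u) k) = grng G (ginv G v)" "z = gmul G (gmul G (ginv G u) k) (ginv G v)"
        by (auto simp: L_def set_mul_def)
      have a: "u \<in> arrows G" "v \<in> arrows G" "k \<in> arrows G"
        using * compactin_subset_topspace A(2) B(2) K(1) by blast+
      have 1: "grng G u = grng G k" "gsrc G k = gsrc G v"
        using *(5,6) a by (simp_all add: src_inv rng_inv src_mul inv_in)
      have "grng G z = gsrc G u" "gsrc G z = grng G v"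
        using a 1 *(7) by (simp_all add: src_mul rng_mul mul_in inv_in src_inv rng_inv)
      then have "gsrc G g = gsrc G u" "grng G h = grng G v"
        using rZ sZ *(1) by auto
      then have gh: "g = u" "h = v"
        using bisection_src_inj[OF U(1) U(2)] bisection_rng_inj[OF V(1) V(2)] *(2,4) A(5) B(5) by blast+
      have "gmul G u z = gmul G k (ginv G v)"
        using a 1 *(7) by (simp add: mul_assoc inv_in src_inv rng_inv mul_in rng_mul mul_inv_cancel_left)
      then have "gmul G u z = gmul G k (ginv G v)" .
      then have "gmul G (gmul G g z) h = k"
        using a 1 gh by (simp add: mul_inv_cancel_right')
      then show False using K(2) *(1,3) by (auto simp: translate_def)
    qed
    ultimately have "\<forall>\<^sub>F z in near Z. z \<notin> L"
      by (rule eventually_fell_filter_compact)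
    moreover have "\<forall>\<^sub>F z in near Z. z \<in> arrows G \<and> (\<exists>u\<in>A. \<exists>v\<in>B. gsrc G u = grng G z \<and>
        gsrc G z = grng G v \<and> w z = gmul G (gmul G u z) v)"
      using A B by (intro local) auto
    ultimately show "\<forall>\<^sub>F z in near Z. w z \<notin> K"
    proof eventually_elim
      case (elim z)
      then obtain u v where *: "z \<in> arrows G" "u \<in> A" "v \<in> B" "gsrc G u = grng G z" "gsrc G z = grng G v"
        "w z = gmul G (gmul G u z) v" by blast
      have a: "u \<in> arrows G" "v \<in> arrows G"
        using * openin_subset A(1) B(1) by blast+
      show ?case
      proof
        assume k: "w z \<in> K"
        have "gmul G (ginv G u) (w z) = gmul G z v"
          using * a by (simp add: mul_assoc mul_in rng_mul inv_mul_cancel)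
        moreover have "gsrc G (ginv G u) = grng G (w z)"
          using * a by (simp add: src_inv rng_mul mul_in src_mul)
        ultimately have "gmul G z v \<in> set_mul G (ginv G ` C) K"
          using k *(2) A(4) set_mulI[of "ginv G u" "ginv G ` C" "w z" K G] by auto
        moreover have "gmul G (gmul G z v) (ginv G v) = z"
          using * a by (simp add: mul_inv_cancel_right)
        moreover have "gsrc G (gmul G z v) = grng G (ginv G v)"
          using * a by (simp add: src_mul rng_inv)
        ultimately have "z \<in> L"
          using *(3) B(4) set_mulI[of "gmul G z v" _ "ginv G v" "ginv G ` D" G] unfolding L_def by auto
        then show False using elim by blast
      qed
    qed
  qed
  then show ?thesis by (simp only: w_def[abs_def])
qed

end

lemma filterlim_frequently:
  assumes "filterlim f F E" "\<forall>\<^sub>F x in E. P (f x)" "E \<noteq> bot"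
  shows "\<exists>\<^sub>F y in F. P y"
  unfolding frequently_def
proof
  assume "\<forall>\<^sub>F y in F. \<not> P y"
  then have "\<forall>\<^sub>F x in E. \<not> P (f x)"
    using assms(1) by (auto simp: filterlim_iff)
  with assms(2) have "\<forall>\<^sub>F x in E. False" by eventually_elim simp
  then show False using assms(3) by (simp add: trivial_limit_def)
qed

context etale_groupoid
begin

section \<open>Translates, cosets and sources in the cover\<close>

lemma cover_src_def: "gsrc H A = set_mul G (ginv G ` A) A"
  and cover_rng_def: "grng H A = set_mul G A (ginv G ` A)"
  and cover_mul_def: "gmul H A B = set_mul G A B"
  and cover_inv_def: "ginv H A = ginv G ` A"
  and cover_gtop: "gtop H = cover_top G"
  by (simp_all add: hausdorff_cover_def)

text \<open>Range and source are constant on \<open>g Z h\<close>. An arrow with another range or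
  source is separated in the Hausdorff unit space; any other arrow is translated back by the
  inverses of \<open>g\<close> and \<open>h\<close>, where the complement of \<open>Z\<close> is
  open.\<close>

lemma closedin_translate:
  assumes Z: "closedin (gtop G) Z" and g: "g \<in> arrows G" and h: "h \<in> arrows G"
    and rZ: "\<And>k. k \<in> Z \<Longrightarrow> grng G k = gsrc G g" and sZ: "\<And>k. k \<in> Z \<Longrightarrow> gsrc G k = grng G h"
  shows "closedin (gtop G) (translate G g Z h)"
proof -
  have Za: "k \<in> arrows G" if "k \<in> Z" for k using that closedin_subset[OF Z] by blast
  have tr: "grng G c = grng G g" "gsrc G c = gsrc G h" "c \<in> arrows G"
    "gmul G (gmul G (ginv G g) c) (ginv G h) \<in> Z" if "c \<in> translate G g Z h" for c
  proof -
    obtain k where k: "k \<in> Z" "c = gmul G (gmul G g k) h" using \<open>c \<in> _\<close> by (auto simp: translate_def)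
    then have k': "k \<in> arrows G" "gsrc G g = grng G k" "gsrc G k = grng G h" using Za rZ sZ by auto
    show "grng G c = grng G g" "gsrc G c = gsrc G h" "c \<in> arrows G"
      using k(2) k' g h by (simp_all add: mul_in src_mul rng_mul)
    have "gmul G (gmul G (ginv G g) c) (ginv G h) = k"
      using k(2) k' g h by (simp add: mul_assoc mul_in rng_mul inv_mul_cancel mul_inv_cancel_right)
    then show "gmul G (gmul G (ginv G g) c) (ginv G h) \<in> Z" using k by simp
  qed
  have "openin (gtop G) (arrows G - translate G g Z h)"
  proof (subst openin_subopen, intro ballI)
    fix c assume c: "c \<in> arrows G - translate G g Z h"
    consider "grng G c \<noteq> grng G g" | "gsrc G c \<noteq> gsrc G h" | "grng G c = grng G g" "gsrc G c = gsrc G h"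
      by blast
    then obtain W where "openin (gtop G) W" "c \<in> W" "\<And>d. d \<in> W \<Longrightarrow> d \<notin> translate G g Z h"
    proof cases
      case 1
      obtain A B where AB: "openin (gtop G) A" "openin (gtop G) B" "grng G c \<in> A" "grng G g \<in> B" "A \<inter> B = {}"
        using units_separate[OF _ _ 1] rng_in c g by blast
      show ?thesis
        by (rule that[OF openin_rng_preimage[OF AB(1)]]) (use AB c tr(1) in auto)
    next
      case 2
      obtain A B where AB: "openin (gtop G) A" "openin (gtop G) B" "gsrc G c \<in> A" "gsrc G h \<in> B" "A \<inter> B = {}"
        using units_separate[OF _ _ 2] src_in c h by blast
      show ?thesis
        by (rule that[OF openin_src_preimage[OF AB(1)]]) (use AB c tr(2) in auto)
    next
      case 3
      define m where "m = gmul G (gmul G (ginv G g) c) (ginv G h)"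
      have ca: "c \<in> arrows G" using c by blast
      have "gmul G (gmul G g m) h = c"
        using 3 ca g h mul_src[OF ca] by (simp add: m_def mul_assoc mul_in src_mul rng_mul inv_in
            src_inv rng_inv mul_inv_cancel_left mul_inv_left)
      then have "m \<notin> Z" using c unfolding translate_def by (metis DiffD2 imageI)
      moreover have "m \<in> arrows G"
        using 3 ca g h by (simp add: m_def mul_in src_mul inv_in src_inv rng_inv)
      ultimately have m: "m \<in> arrows G - Z" by blast
      have "openin (gtop G) (arrows G - Z)" using Z by (simp add: closedin_def)
      then obtain A N B where ANB: "openin (gtop G) N" "ginv G g \<in> A" "c \<in> N" "ginv G h \<in> B"
        "\<And>u z v. u \<in> A \<Longrightarrow> z \<in> N \<Longrightarrow> v \<in> B \<Longrightarrow> gsrc G u = grng G z \<Longrightarrow> gsrc G z = grng G v \<Longrightarrow>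
          gmul G (gmul G u z) v \<in> arrows G - Z"
        using mul3_neighbourhood[of "ginv G g" c "ginv G h" "arrows G - Z"] 3 ca g h m
        unfolding m_def by (metis inv_in src_inv rng_inv)
      have "d \<notin> translate G g Z h" if d: "d \<in> N" for d
      proof
        assume t: "d \<in> translate G g Z h"
        have "gmul G (gmul G (ginv G g) d) (ginv G h) \<in> arrows G - Z"
          using ANB(2,4) d tr[OF t] g h by (intro ANB(5)) (simp_all add: src_inv rng_inv)
        then show False using tr(4)[OF t] by blast
      qed
      then show ?thesis using that ANB by blast
    qed
    then show "\<exists>T. openin (gtop G) T \<and> c \<in> T \<and> T \<subseteq> arrows G - translate G g Z h"
      using openin_subset[of "gtop G" W] by blast
  qed
  then show ?thesis
    using tr(3) by (auto simp: closedin_def)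
qed

lemma translate_cover_arrow:
  assumes Z: "Z \<in> arrows H" and g: "g \<in> arrows G" and h: "h \<in> arrows G"
    and k: "k \<in> Z" "grng G k = gsrc G g" "gsrc G k = grng G h"
  shows "translate G g Z h \<in> arrows H"
proof -
  have c: "grng G k = gsrc G g" "gsrc G k = grng G h" if "k \<in> Z" for k
    using cover_rng_const[OF Z that k(1)] cover_src_const[OF Z that k(1)] k by simp_all
  obtain U V where UV: "open_bisection G U" "g \<in> U" "open_bisection G V" "h \<in> V"
    using bisection_at[OF openin_topspace] g h by metis
  have "filterlim (\<lambda>z. gmul G (gmul G (src_section G U (grng G z)) z) (rng_section G V (gsrc G z)))
    (near (translate G g Z h)) (near Z)"
    using c UV cover_elem_arrow[OF Z] cover_nonempty[OF Z] by (intro filterlim_translate) auto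
  then have "near (translate G g Z h) \<noteq> bot"
    using cover_near_bot[OF Z] by (auto simp: filterlim_def bot_unique filtermap_bot_iff)
  moreover have "closedin (gtop G) (translate G g Z h)"
    using c by (intro closedin_translate cover_closed Z g h)
  moreover have "translate G g Z h \<noteq> {}"
    using k by (auto simp: translate_def)
  ultimately show ?thesis by (simp add: cover_arrow_iff)
qed

text \<open>Singletons near \<open>A\<close> satisfy \<open>z = z z\<^sup>-\<^sup>1 z\<close>, and
  the three factors are at the same time close to \<open>a\<close>, to the inverse of
  \<open>b\<close> and to \<open>c\<close>. The product of the limits is thus a limit of the same
  \<open>z\<close>. This makes \<open>A\<close> a coset of its source.\<close>

lemma cover_coset:
  assumes A: "A \<in> arrows H" and abc: "a \<in> A" "b \<in> A" "c \<in> A"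
  shows "gmul G (gmul G a (ginv G b)) c \<in> A"
proof (rule cover_limit_in[OF A])
  have arr: "a \<in> arrows G" "b \<in> arrows G" "c \<in> arrows G"
    using cover_elem_arrow[OF A] abc by auto
  have eq: "gsrc G a = gsrc G b" "grng G b = grng G c"
    using cover_src_const[OF A abc(1,2)] cover_rng_const[OF A abc(2,3)] by simp_all
  have comp: "gsrc G a = grng G (ginv G b)" "gsrc G (ginv G b) = grng G c"
    using arr eq by (simp_all add: src_inv rng_inv)
  show "gmul G (gmul G a (ginv G b)) c \<in> arrows G"
    using arr eq by (simp add: mul_in src_mul inv_in src_inv rng_inv)
  fix W assume W: "openin (gtop G) W" "gmul G (gmul G a (ginv G b)) c \<in> W"
  obtain U N V where UNV: "openin (gtop G) U" "openin (gtop G) N" "openin (gtop G) V"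
    "a \<in> U" "ginv G b \<in> N" "c \<in> V"
    "\<And>u z v. u \<in> U \<Longrightarrow> z \<in> N \<Longrightarrow> v \<in> V \<Longrightarrow> gsrc G u = grng G z \<Longrightarrow> gsrc G z = grng G v \<Longrightarrow>
      gmul G (gmul G u z) v \<in> W"
    using mul3_neighbourhood[OF arr(1) inv_in[OF arr(2)] arr(3) comp W] by metis
  have "\<forall>\<^sub>F z in near A. z \<in> U" "\<forall>\<^sub>F z in near A. z \<in> V"
    using UNV abc by (auto intro!: eventually_fell_filter_open)
  moreover have "\<forall>\<^sub>F z in near A. z \<in> {g \<in> arrows G. ginv G g \<in> N}"
    using UNV abc arr by (intro eventually_fell_filter_open openin_inv_preimage) auto
  ultimately have "\<forall>\<^sub>F z in near A. z \<in> W"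
  proof eventually_elim
    case (elim z)
    then have z: "z \<in> arrows G" by simp
    have "gmul G (gmul G z (ginv G z)) z \<in> W"
      using elim z by (intro UNV(7)) (simp_all add: src_inv rng_inv)
    then show ?case using z by (simp add: mul_inv_right rng_mul_left)
  qed
  then show "\<exists>\<^sub>F z in near A. z \<in> W"
    using cover_near_bot[OF A] eventually_frequently by blast
qed

text \<open>The definition ranges over all pairs from \<open>A\<close>; the coset property allows
  the left factor to be fixed.\<close>

lemma cover_src_eq:
  assumes A: "A \<in> arrows H" and g: "g \<in> A"
  shows "gsrc H A = (\<lambda>k. gmul G (ginv G g) k) ` A"
proof (intro subset_antisym subsetI)
  note arr = cover_elem_arrow[OF A] and rc = cover_rng_const[OF A] and sc = cover_src_const[OF A]
  fix k assume "k \<in> gsrc H A"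
  then obtain a b where ab: "a \<in> A" "b \<in> A" "k = gmul G (ginv G a) b"
    by (auto simp: cover_src_def set_mul_def)
  have "gmul G (ginv G g) (gmul G (gmul G g (ginv G a)) b) = k"
    using ab g arr rc[OF g ab(1)] rc[OF g ab(2)] sc[OF g ab(1)]
    by (simp add: mul_assoc mul_in inv_in src_inv rng_inv rng_mul inv_mul_cancel)
  then show "k \<in> (\<lambda>k. gmul G (ginv G g) k) ` A"
    using cover_coset[OF A g ab(1,2)] by (metis imageI)
next
  fix k assume "k \<in> (\<lambda>k. gmul G (ginv G g) k) ` A"
  then obtain b where b: "b \<in> A" "k = gmul G (ginv G g) b" by blast
  then show "k \<in> gsrc H A"
    using g cover_rng_const[OF A g b(1)] cover_elem_arrow[OF A]
    by (auto simp: cover_src_def src_inv intro!: set_mulI)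
qed

lemma translate_unit_right:
  assumes "Z \<subseteq> arrows G" "g \<in> arrows G" "x \<in> gunits G"
    and "\<And>k. k \<in> Z \<Longrightarrow> gsrc G g = grng G k" "\<And>k. k \<in> Z \<Longrightarrow> gsrc G k = x"
  shows "translate G g Z x = (\<lambda>k. gmul G g k) ` Z"
proof -
  have "gmul G (gmul G g k) x = gmul G g k" if "k \<in> Z" for k
    using mul_src[of "gmul G g k"] that assms by (auto simp: mul_in src_mul subset_iff)
  then show ?thesis by (simp add: translate_def)
qed

lemma cover_src_translate:
  assumes A: "A \<in> arrows H" and g: "g \<in> A"
  shows "gsrc H A = translate G (ginv G g) A (gsrc G g)"
  unfolding cover_src_eq[OF A g]
proof (rule translate_unit_right[symmetric])
  note ga = cover_elem_arrow[OF A g]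
  show "A \<subseteq> arrows G" using cover_elem_arrow[OF A] by blast
  show "ginv G g \<in> arrows G" "gsrc G g \<in> gunits G" using ga by (simp_all add: inv_in src_in)
  show "gsrc G (ginv G g) = grng G k" if "k \<in> A" for k
    using cover_rng_const[OF A that g] ga by (simp add: src_inv)
  show "gsrc G k = gsrc G g" if "k \<in> A" for k
    by (rule cover_src_const[OF A that g])
qed

text \<open>The source is the translate of \<open>A\<close> by the inverse of \<open>g\<close>. Near
  \<open>A\<close> every \<open>z\<close> lies in the bisection \<open>U\<close>, so the moving left
  factor is the inverse of \<open>z\<close> and the translated point collapses to
  \<open>gsrc G z\<close>.\<close>

lemma filterlim_near_src:
  assumes A: "A \<in> arrows H"
  shows "filterlim (gsrc G) (near (gsrc H A)) (near A)"
proof -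
  obtain g where g: "g \<in> A" using cover_nonempty[OF A] by blast
  note arr = cover_elem_arrow[OF A]
  obtain U where U: "open_bisection G U" "g \<in> U"
    using bisection_at[OF openin_topspace arr[OF g]] by metis
  have "gsrc H A = translate G (ginv G g) A (gsrc G g)"
    by (rule cover_src_translate[OF A g])
  moreover have "filterlim (\<lambda>z. gmul G (gmul G (src_section G (ginv G ` U) (grng G z)) z)
      (rng_section G (gunits G) (gsrc G z))) (near (translate G (ginv G g) A (gsrc G g))) (near A)"
  proof (rule filterlim_translate[OF _ cover_nonempty[OF A] _ _ bisection_inv[OF U(1)] _ bisection_units])
    show "A \<subseteq> arrows G" using arr by blast
    show "grng G k = gsrc G (ginv G g)" if "k \<in> A" for k
      using cover_rng_const[OF A that g] arr[OF g] by (simp add: src_inv)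
    show "gsrc G k = grng G (gsrc G g)" if "k \<in> A" for k
      using cover_src_const[OF A that g] arr[OF g] by (simp add: rng_src)
    show "ginv G g \<in> ginv G ` U" "gsrc G g \<in> gunits G"
      using U(2) arr[OF g] by (simp_all add: src_in)
  qed
  ultimately have lim: "filterlim (\<lambda>z. gmul G (gmul G (src_section G (ginv G ` U) (grng G z)) z)
      (rng_section G (gunits G) (gsrc G z))) (near (gsrc H A)) (near A)" by simp
  have "\<forall>\<^sub>F z in near A. z \<in> U"
    using U g by (intro eventually_fell_filter_open bisection_openin) auto
  then have "\<forall>\<^sub>F z in near A. gmul G (gmul G (src_section G (ginv G ` U) (grng G z)) z)
      (rng_section G (gunits G) (gsrc G z)) = gsrc G z"
  proof eventually_elim
    case (elim z)
    then have z: "z \<in> arrows G" using bisection_arrows[OF U(1)] by blast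
    have "src_section G (ginv G ` U) (grng G z) = ginv G z"
      using src_section[OF bisection_inv[OF U(1)], of "ginv G z"] elim z by (simp add: src_inv)
    moreover have "rng_section G (gunits G) (gsrc G z) = gsrc G z"
      using rng_section[OF bisection_units, of "gsrc G z"] z by (simp add: src_in rng_src)
    ultimately show ?case
      using z mul_src[of "gsrc G z"] by (simp add: mul_inv_left src_arrow src_src)
  qed
  then show ?thesis
    using lim by (rule filterlim_cong[OF refl refl, THEN iffD1])
qed

lemma cover_src_arrow:
  assumes A: "A \<in> arrows H"
  shows "gsrc H A \<in> arrows H"
proof -
  obtain g where g: "g \<in> A" using cover_nonempty[OF A] by blast
  note arr = cover_elem_arrow[OF A]
  have "gsrc H A = translate G (ginv G g) A (gsrc G g)"
    by (rule cover_src_translate[OF A g])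
  then show ?thesis
    using translate_cover_arrow[OF A, of "ginv G g" "gsrc G g" g] arr[OF g] g
    by (simp add: inv_in src_arrow src_inv rng_src)
qed

lemma cover_src_in:
  assumes A: "A \<in> arrows H"
  shows "gsrc H A \<in> gunits H"
proof -
  have "\<forall>\<^sub>F z in near A. gsrc G z \<in> gunits G"
    using eventually_fell_filter_topspace[of "gtop G" A] by (rule eventually_mono) (rule src_in)
  then have "\<exists>\<^sub>F z in near (gsrc H A). z \<in> gunits G"
    by (rule filterlim_frequently[OF filterlim_near_src[OF A] _ cover_near_bot[OF A]])
  then show ?thesis using cover_src_arrow[OF A] by (simp add: cover_unit_iff)
qed

section \<open>Inversion and the units of the cover\<close>

lemma filterlim_near_inv:
  assumes "Z \<subseteq> arrows G"
  shows "filterlim (ginv G) (near (ginv G ` Z)) (near Z)"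
proof (rule filterlim_fell_filterI)
  note top = eventually_fell_filter_topspace[of "gtop G" Z]
  show "\<forall>\<^sub>F z in near Z. ginv G z \<in> arrows G"
    using top by (rule eventually_mono) (rule inv_in)
  show "\<forall>\<^sub>F z in near Z. ginv G z \<in> W" if "openin (gtop G) W" "ginv G ` Z \<inter> W \<noteq> {}" for W
  proof -
    have "Z \<inter> {g \<in> arrows G. ginv G g \<in> W} \<noteq> {}" using that(2) assms by auto
    from eventually_fell_filter_open[OF openin_inv_preimage[OF that(1)] this] show ?thesis
      by (rule eventually_mono) simp
  qed
  show "\<forall>\<^sub>F z in near Z. ginv G z \<notin> K" if "compactin (gtop G) K" "ginv G ` Z \<inter> K = {}" for K
  proof -
    have "Z \<inter> ginv G ` K = {}"
    proof (rule equals0I)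
      fix z assume "z \<in> Z \<inter> ginv G ` K"
      then obtain k where k: "k \<in> K" "z = ginv G k" "z \<in> Z" by blast
      then have "ginv G z = k" using compactin_subset_topspace[OF that(1)] by (simp add: inv_inv subset_iff)
      then show False using k that(2) by blast
    qed
    from eventually_fell_filter_compact[OF compactin_inv_image[OF that(1)] this] top show ?thesis
    proof eventually_elim
      case (elim z)
      then show ?case using inv_inv[of z] by (metis imageI)
    qed
  qed
qed

lemma inv_inv_image: "A \<subseteq> arrows G \<Longrightarrow> ginv G ` ginv G ` A = A"
  by (force simp: image_image inv_inv subset_iff)

lemma cover_inv_arrow:
  assumes A: "A \<in> arrows H"
  shows "ginv G ` A \<in> arrows H"
proof -
  have sub: "A \<subseteq> arrows G" using cover_elem_arrow[OF A] by blast
  have "closedin (gtop G) (ginv G ` A)"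
    using closedin_continuous_map_preimage[OF continuous_inv cover_closed[OF A]] inv_image_eq[OF sub] by simp
  moreover have "near (ginv G ` A) \<noteq> bot"
    using filterlim_near_inv[OF sub] cover_near_bot[OF A]
    by (auto simp: filterlim_def bot_unique filtermap_bot_iff)
  ultimately show ?thesis using cover_nonempty[OF A] by (simp add: cover_arrow_iff)
qed

lemma cover_src_inv:
  assumes A: "A \<in> arrows H"
  shows "gsrc H (ginv G ` A) = grng H A"
  using inv_inv_image[of A] cover_elem_arrow[OF A] by (simp add: cover_src_def cover_rng_def subset_iff)

lemma cover_unit_arrow: "X \<in> gunits H \<Longrightarrow> X \<in> arrows H"
  by (simp add: cover_unit_iff)

text \<open>Units \<open>z\<close> with \<open>{z}\<close> close to \<open>X\<close> are their own
  sources, so they approach the source of every element of \<open>X\<close>; closedness puts that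
  source into \<open>X\<close>. It is the point of the base space under \<open>X\<close>.\<close>

lemma cover_unit_src_mem:
  assumes X: "X \<in> gunits H" and a: "a \<in> X"
  shows "gsrc G a \<in> X"
proof (rule cover_limit_in[OF cover_unit_arrow[OF X]])
  have arr: "a \<in> arrows G" using cover_elem_arrow[OF cover_unit_arrow[OF X] a] .
  then show "gsrc G a \<in> arrows G" by (rule src_arrow)
  fix W assume W: "openin (gtop G) W" "gsrc G a \<in> W"
  have "\<forall>\<^sub>F z in near X. gsrc G z \<in> W"
    using W a arr by (intro eventually_near_src) auto
  moreover have "\<exists>\<^sub>F z in near X. z \<in> gunits G" using X by (simp add: cover_unit_iff)
  ultimately have "\<exists>\<^sub>F z in near X. gsrc G z \<in> W \<and> z \<in> gunits G"
    using frequently_eventually_conj by fastforce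
  then show "\<exists>\<^sub>F z in near X. z \<in> W"
    by (rule frequently_elim1) (auto simp: src_unit)
qed

lemma cover_unit_mem_unit_iff:
  assumes X: "X \<in> gunits H" and a: "a \<in> X"
  shows "x \<in> X \<and> x \<in> gunits G \<longleftrightarrow> x = gsrc G a"
proof -
  note XA = cover_unit_arrow[OF X]
  show ?thesis
    using cover_unit_src_mem[OF X a] src_in[OF cover_elem_arrow[OF XA a]]
      cover_src_const[OF XA _ a, of x] src_unit[of x] by auto
qed

lemma cover_unit_src_rng:
  assumes X: "X \<in> gunits H" and a: "a \<in> X" and b: "b \<in> X"
  shows "grng G b = gsrc G a"
proof -
  note XA = cover_unit_arrow[OF X]
  show ?thesis
    using cover_rng_const[OF XA b cover_unit_src_mem[OF X a]] cover_elem_arrow[OF XA a]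
    by (simp add: rng_src)
qed

lemma cover_proj_eq:
  assumes X: "X \<in> gunits H" and a: "a \<in> X"
  shows "cover_proj G X = gsrc G a"
proof -
  have "X \<inter> gunits G = {gsrc G a}"
    using cover_unit_mem_unit_iff[OF X a] by auto
  then show ?thesis by (simp add: cover_proj_def)
qed

lemma cover_unit_obtain:
  assumes X: "X \<in> gunits H"
  obtains x where "x \<in> gunits G" "x \<in> X" "\<And>k. k \<in> X \<Longrightarrow> gsrc G k = x" "\<And>k. k \<in> X \<Longrightarrow> grng G k = x"
proof -
  note XA = cover_unit_arrow[OF X]
  obtain a where a: "a \<in> X" using cover_nonempty[OF XA] by blast
  show ?thesis
    using that[of "gsrc G a"] cover_unit_mem_unit_iff[OF X a, of "gsrc G a"] cover_src_const[OF XA _ a]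
      cover_unit_src_rng[OF X a] by blast
qed

lemma cover_src_unit:
  assumes X: "X \<in> gunits H"
  shows "gsrc H X = X"
proof -
  note XA = cover_unit_arrow[OF X]
  obtain x where x: "x \<in> gunits G" "x \<in> X" "\<And>k. k \<in> X \<Longrightarrow> grng G k = x"
    using cover_unit_obtain[OF X] by metis
  have "gmul G (ginv G x) k = k" if "k \<in> X" for k
    using rng_mul_left[OF cover_elem_arrow[OF XA that]] x(3)[OF that] unit_inv[OF x(1)] by simp
  then show ?thesis
    using cover_src_eq[OF XA x(2)] by simp
qed

lemma cover_src_coset:
  assumes A: "A \<in> arrows H" and g: "g \<in> A"
  shows "A = (\<lambda>k. gmul G g k) ` gsrc H A"
proof -
  have "gmul G g (gmul G (ginv G g) k) = k" if "k \<in> A" for k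
    using cover_elem_arrow[OF A] cover_rng_const[OF A g that] g that by (simp add: mul_inv_cancel_left)
  then show ?thesis
    by (simp add: cover_src_eq[OF A g] image_image)
qed

lemma cover_src_elem:
  assumes A: "A \<in> arrows H" and g: "g \<in> A" and k: "k \<in> gsrc H A"
  shows "gsrc G k = gsrc G g" "grng G k = gsrc G g"
proof -
  have "gmul G (ginv G g) g \<in> gsrc H A" using g by (simp add: cover_src_eq[OF A g])
  then have "gsrc G g \<in> gsrc H A" using cover_elem_arrow[OF A g] by (simp add: mul_inv_left)
  then show "gsrc G k = gsrc G g" "grng G k = gsrc G g"
    using cover_src_const[OF cover_src_arrow[OF A] k] cover_rng_const[OF cover_src_arrow[OF A] k]
      cover_elem_arrow[OF A g] by (auto simp: src_src rng_src)
qed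

text \<open>For \<open>b\<close> in \<open>B\<close> one has \<open>a b\<^sup>-\<^sup>1 = (a
  b\<^sup>-\<^sup>1 h) h\<^sup>-\<^sup>1\<close>, and \<open>b\<^sup>-\<^sup>1 h\<close> lies in the
  common source, so that \<open>a b\<^sup>-\<^sup>1 h\<close> is again in the coset
  \<open>A\<close>. One representative \<open>h\<close> therefore describes the whole
  product.\<close>

lemma cover_mul_inv:
  assumes A: "A \<in> arrows H" and B: "B \<in> arrows H" and AB: "gsrc H A = gsrc H B"
    and h: "h \<in> B"
  shows "gmul H A (ginv H B) = (\<lambda>a. gmul G a (ginv G h)) ` A"
proof (intro subset_antisym subsetI)
  note arrA = cover_elem_arrow[OF A] and arrB = cover_elem_arrow[OF B]
  fix c assume "c \<in> gmul H A (ginv H B)"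
  then obtain a b where ab: "a \<in> A" "b \<in> B" "c = gmul G a (ginv G b)" "gsrc G a = grng G (ginv G b)"
    by (auto simp: cover_mul_def cover_inv_def set_mul_def)
  have s: "gsrc G a = gsrc G b" "grng G b = grng G h"
    using ab arrB cover_rng_const[OF B ab(2) h] by (simp_all add: rng_inv)
  have "gmul G (ginv G b) h \<in> gsrc H A"
    using h ab by (simp add: AB cover_src_eq[OF B ab(2)])
  then have "gmul G a (gmul G (ginv G b) h) \<in> A"
    using cover_src_coset[OF A ab(1)] by blast
  moreover have "gmul G (gmul G a (gmul G (ginv G b) h)) (ginv G h) = c"
    using ab(1-3) h arrA arrB s
    by (simp add: mul_assoc[symmetric] mul_in inv_in src_inv rng_inv src_mul mul_inv_cancel_right)
  ultimately show "c \<in> (\<lambda>a. gmul G a (ginv G h)) ` A" by (metis imageI)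
next
  fix c assume "c \<in> (\<lambda>a. gmul G a (ginv G h)) ` A"
  then obtain a where a: "a \<in> A" "c = gmul G a (ginv G h)" by blast
  obtain k where k: "k \<in> gsrc H A" using cover_nonempty[OF cover_src_arrow[OF A]] by blast
  have "gsrc G a = gsrc G h"
    using cover_src_elem(1)[OF A a(1) k] cover_src_elem(1)[OF B h, of k] k AB by simp
  then show "c \<in> gmul H A (ginv H B)"
    using a h cover_elem_arrow[OF B h] by (auto simp: cover_mul_def cover_inv_def rng_inv intro!: set_mulI)
qed

lemma cover_mul_inv_translate:
  assumes A: "A \<in> arrows H" and B: "B \<in> arrows H" and AB: "gsrc H A = gsrc H B"
    and g: "g \<in> A" and h: "h \<in> B"
  shows "gmul H A (ginv H B) = translate G g (gsrc H A) (ginv G h)"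
  unfolding cover_mul_inv[OF A B AB h] translate_def
  by (subst cover_src_coset[OF A g]) (simp add: image_image)

lemma cover_src_eq_src:
  assumes A: "A \<in> arrows H" and B: "B \<in> arrows H" and AB: "gsrc H A = gsrc H B"
    and g: "g \<in> A" and h: "h \<in> B"
  shows "gsrc G g = gsrc G h"
proof -
  obtain k where k: "k \<in> gsrc H A" using cover_nonempty[OF cover_src_arrow[OF A]] by blast
  then show ?thesis
    using cover_src_elem(1)[OF A g k] cover_src_elem(1)[OF B h, of k] AB by simp
qed

lemma cover_mul_inv_arrow:
  assumes A: "A \<in> arrows H" and B: "B \<in> arrows H" and AB: "gsrc H A = gsrc H B"
  shows "gmul H A (ginv H B) \<in> arrows H"
proof -
  obtain g h k where gh: "g \<in> A" "h \<in> B" "k \<in> gsrc H A"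
    using cover_nonempty[OF A] cover_nonempty[OF B] cover_nonempty[OF cover_src_arrow[OF A]] by blast
  have "translate G g (gsrc H A) (ginv G h) \<in> arrows H"
    using cover_elem_arrow[OF A gh(1)] cover_elem_arrow[OF B gh(2)] cover_src_elem[OF A gh(1,3)]
      cover_src_eq_src[OF A B AB gh(1,2)]
    by (intro translate_cover_arrow[OF cover_src_arrow[OF A] _ _ gh(3)]) (simp_all add: inv_in rng_inv)
  then show ?thesis by (simp add: cover_mul_inv_translate[OF A B AB gh(1,2)])
qed

text \<open>Identifies the matrix entry in the column of the unit, which is what
  \<open>as_function\<close> reads off.\<close>

lemma cover_mul_inv_src:
  assumes A: "A \<in> arrows H"
  shows "gmul H A (ginv H (gsrc H A)) = A"
proof -
  obtain g where g: "g \<in> A" using cover_nonempty[OF A] by blast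
  have "gmul G (ginv G g) g \<in> gsrc H A" using g by (simp add: cover_src_eq[OF A g])
  then have x: "gsrc G g \<in> gsrc H A" using cover_elem_arrow[OF A g] by (simp add: mul_inv_left)
  have "gmul G a (ginv G (gsrc G g)) = a" if "a \<in> A" for a
    using mul_src[OF cover_elem_arrow[OF A that]] cover_src_const[OF A that g]
      unit_inv[OF src_in[OF cover_elem_arrow[OF A g]]] by simp
  then show ?thesis
    using cover_mul_inv[OF A cover_src_arrow[OF A] _ x] cover_src_unit[OF cover_src_in[OF A]] by simp
qed

lemma cover_src_singleton:
  assumes g: "g \<in> arrows G"
  shows "gsrc H {g} = {gsrc G g}"
  using cover_src_eq[OF singleton_cover_arrow[OF g], of g] g by (simp add: mul_inv_left)

lemma cover_elem_bisection_unique: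
  assumes A: "A \<in> arrows H" and U: "open_bisection G U" and "a \<in> A \<inter> U" "b \<in> A \<inter> U"
  shows "a = b"
  using bisection_rng_inj[OF U, of a b] cover_rng_const[OF A, of a b] assms(3,4) by blast

text \<open>Both sets are the coset through \<open>g\<close> of the same source. Injectivity
  arguments on the cover rest on this.\<close>

lemma cover_eq_of_common:
  assumes A: "A \<in> arrows H" and B: "B \<in> arrows H" and AB: "gsrc H A = gsrc H B"
    and "g \<in> A" "g \<in> B"
  shows "A = B"
  using cover_src_coset[OF A assms(4)] cover_src_coset[OF B assms(5)] AB by metis

definition cover_bisection :: "'g set \<Rightarrow> 'g set set" where
  "cover_bisection U = {A \<in> arrows H. A \<inter> U \<noteq> {}}"

section \<open>Open sets, compact sets and bisections of the cover\<close>

lemma openin_cover_meets: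
  assumes "openin (gtop G) U"
  shows "openin (gtop H) {A \<in> arrows H. A \<inter> U \<noteq> {}}"
proof -
  have "openin (fell_topology (gtop G)) {F. closedin (gtop G) F \<and> (\<forall>U\<in>{U}. F \<inter> U \<noteq> {}) \<and> F \<inter> {} = {}}"
    by (rule openin_fell_basic) (use assms in auto)
  then have "openin (gtop H) (cover_carrier G \<inter>
      {F. closedin (gtop G) F \<and> (\<forall>U\<in>{U}. F \<inter> U \<noteq> {}) \<and> F \<inter> {} = {}})"
    unfolding cover_gtop cover_top_def by (rule openin_subtopology_Int2)
  moreover have "cover_carrier G \<inter> {F. closedin (gtop G) F \<and> (\<forall>U\<in>{U}. F \<inter> U \<noteq> {}) \<and> F \<inter> {} = {}}
      = {A \<in> arrows H. A \<inter> U \<noteq> {}}"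
    using cover_closed by (auto simp: cover_arrows_eq)
  ultimately show ?thesis by simp
qed

lemma openin_cover_misses:
  assumes "compactin (gtop G) K"
  shows "openin (gtop H) {A \<in> arrows H. A \<inter> K = {}}"
proof -
  have "openin (fell_topology (gtop G)) {F. closedin (gtop G) F \<and> (\<forall>U\<in>{}. F \<inter> U \<noteq> {}) \<and> F \<inter> K = {}}"
    by (rule openin_fell_basic) (use assms in auto)
  then have "openin (gtop H) (cover_carrier G \<inter>
      {F. closedin (gtop G) F \<and> (\<forall>U\<in>{}. F \<inter> U \<noteq> {}) \<and> F \<inter> K = {}})"
    unfolding cover_gtop cover_top_def by (rule openin_subtopology_Int2)
  moreover have "cover_carrier G \<inter> {F. closedin (gtop G) F \<and> (\<forall>U\<in>{}. F \<inter> U \<noteq> {}) \<and> F \<inter> K = {}}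
      = {A \<in> arrows H. A \<inter> K = {}}"
    using cover_closed by (auto simp: cover_arrows_eq)
  ultimately show ?thesis by simp
qed

text \<open>The closed sets that meet \<open>K\<close> form a closed part of the compact Fell space.
  The closure of the singletons differs from the cover at most by the empty set, and the empty set
  does not meet \<open>K\<close>.\<close>

lemma compactin_cover_meets:
  assumes "compactin (gtop G) K"
  shows "compactin (gtop H) {A \<in> arrows H. A \<inter> K \<noteq> {}}"
proof -
  let ?F = "fell_topology (gtop G)"
  define C where "C = ?F closure_of ((\<lambda>g. {g}) ` arrows G)"
  define M where "M = topspace ?F - {F. closedin (gtop G) F \<and> (\<forall>U\<in>{}. F \<inter> U \<noteq> {}) \<and> F \<inter> K = {}}"
  have "closedin ?F M"
    unfolding M_def using assms by (intro closedin_diff closedin_topspace openin_fell_basic) auto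
  then have "closedin ?F (C \<inter> M)"
    by (intro closedin_Int) (simp_all add: C_def)
  then have "compactin ?F (C \<inter> M)"
    using compact_space_fell_topology closedin_compact_space by blast
  moreover have eq: "C \<inter> M = {A \<in> arrows H. A \<inter> K \<noteq> {}}"
    using closure_of_subset_topspace[of ?F "(\<lambda>g. {g}) ` arrows G"]
    by (auto simp: M_def C_def cover_arrows_eq cover_carrier_eq topspace_fell_topology)
  ultimately show ?thesis
    by (auto simp: cover_gtop cover_top_def compactin_subtopology cover_arrows_eq)
qed

lemma inj_on_src_cover_bisection:
  assumes U: "open_bisection G U"
  shows "inj_on (gsrc H) (cover_bisection U)"
proof (rule inj_onI)
  fix A B assume "A \<in> cover_bisection U" "B \<in> cover_bisection U" and s: "gsrc H A = gsrc H B"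
  then obtain g h where *: "A \<in> arrows H" "B \<in> arrows H" "g \<in> A" "h \<in> B" "g \<in> U" "h \<in> U"
    by (auto simp: cover_bisection_def)
  then have "g = h"
    using cover_src_eq_src[OF *(1,2) s *(3,4)] bisection_src_inj[OF U] by blast
  then show "A = B" using cover_eq_of_common[OF *(1,2) s] * by blast
qed

lemma open_bisection_cover:
  assumes U: "open_bisection G U"
  shows "open_bisection H (cover_bisection U)"
  unfolding open_bisection_def
proof (intro conjI inj_on_src_cover_bisection[OF U])
  show "openin (gtop H) (cover_bisection U)"
    unfolding cover_bisection_def by (rule openin_cover_meets[OF bisection_openin[OF U]])
  show "inj_on (grng H) (cover_bisection U)"
  proof (rule inj_onI)
    fix A B assume AB: "A \<in> cover_bisection U" "B \<in> cover_bisection U" and r: "grng H A = grng H B"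
    then have arr: "A \<in> arrows H" "B \<in> arrows H" by (simp_all add: cover_bisection_def)
    have "ginv G ` A \<in> cover_bisection (ginv G ` U)" "ginv G ` B \<in> cover_bisection (ginv G ` U)"
      using AB cover_inv_arrow by (auto simp: cover_bisection_def)
    then have "ginv G ` A = ginv G ` B"
      using r inj_onD[OF inj_on_src_cover_bisection[OF bisection_inv[OF U]]]
      by (simp add: cover_src_inv arr)
    then show "A = B"
      using inv_inv_image[of A] inv_inv_image[of B] cover_elem_arrow arr by (metis subsetI)
  qed
qed

end

section \<open>The map induced on the convolution algebras\<close>

lemma Cc_zero: "(\<lambda>_. 0) \<in> Cc G"
proof -
  have "\<exists>(n::nat) c f. (\<lambda>_. 0) = (\<lambda>g. \<Sum>i<n. c i * f i g) \<and>
      (\<forall>i<n. \<exists>U. open_bisection G U \<and> f i \<in> Cc_bisection G U)"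
    by (intro exI[of _ 0]) simp
  then show ?thesis by (simp add: Cc_def)
qed

lemma Cc_lincomb_bisection:
  assumes "open_bisection G U" "f \<in> Cc_bisection G U" "k \<in> Cc G"
  shows "(\<lambda>g. c * f g + k g) \<in> Cc G"
proof -
  obtain n :: nat and d p where k: "k = (\<lambda>g. \<Sum>i<n. d i * p i g)"
    "\<forall>i<n. \<exists>U. open_bisection G U \<and> p i \<in> Cc_bisection G U"
    using assms(3) unfolding Cc_def by blast
  define d' where "d' = d(n := c)"
  define p' where "p' = p(n := f)"
  have "(\<Sum>i<Suc n. d' i * p' i g) = c * f g + k g" for g
    by (simp add: k d'_def p'_def)
  then have "(\<lambda>g. c * f g + k g) = (\<lambda>g. \<Sum>i<Suc n. d' i * p' i g)" by simp
  moreover have "\<forall>i<Suc n. \<exists>U. open_bisection G U \<and> p' i \<in> Cc_bisection G U"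
    using k(2) assms by (auto simp: p'_def less_Suc_eq)
  ultimately show ?thesis unfolding Cc_def by blast
qed

lemma Cc_induct [consumes 1, case_names zero lincomb]:
  assumes "f \<in> Cc G" and "P (\<lambda>_. 0)"
    and step: "\<And>U f k c. open_bisection G U \<Longrightarrow> f \<in> Cc_bisection G U \<Longrightarrow> k \<in> Cc G \<Longrightarrow> P k \<Longrightarrow>
      P (\<lambda>g. c * f g + k g)"
  shows "P f"
proof -
  obtain n :: nat and d p where f: "f = (\<lambda>g. \<Sum>i<n. d i * p i g)"
    "\<forall>i<n. \<exists>U. open_bisection G U \<and> p i \<in> Cc_bisection G U"
    using assms(1) unfolding Cc_def by blast
  have "(\<lambda>g. \<Sum>i<m. d i * p i g) \<in> Cc G \<and> P (\<lambda>g. \<Sum>i<m. d i * p i g)" if "m \<le> n" for m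
    using that
  proof (induction m)
    case 0
    then show ?case using assms(2) Cc_zero by simp
  next
    case (Suc m)
    then obtain U where "open_bisection G U" "p m \<in> Cc_bisection G U"
      using f(2) Suc_le_lessD[OF Suc.prems] by blast
    moreover have "(\<lambda>g. \<Sum>i<Suc m. d i * p i g) = (\<lambda>g. d m * p m g + (\<Sum>i<m. d i * p i g))"
      by (simp add: add.commute)
    ultimately show ?case
      using Suc.IH Suc.prems step[of U "p m" _ "d m"] Cc_lincomb_bisection[of G U "p m" _ "d m"]
      by simp
  qed
  then show ?thesis using f(1) by simp
qed

lemma Cc_diff:
  assumes "f \<in> Cc G" "k \<in> Cc G"
  shows "(\<lambda>g. f g - k g) \<in> Cc G"
  using assms(2)
proof (induction k rule: Cc_induct)
  case zero
  then show ?case using assms(1) by simp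
next
  case (lincomb U p k c)
  then have "(\<lambda>g. (- c) * p g + (f g - k g)) \<in> Cc G"
    by (intro Cc_lincomb_bisection)
  moreover have "(\<lambda>g. (- c) * p g + (f g - k g)) = (\<lambda>g. f g - (c * p g + k g))"
    by (simp add: fun_eq_iff algebra_simps)
  ultimately show ?case by simp
qed

lemma Cc_bisection_support:
  assumes f: "f \<in> Cc_bisection G U"
  obtains K where "compactin (gtop G) K" "compactin (subtopology (gtop G) U) K" "K \<subseteq> U"
    "\<And>g. g \<in> topspace (gtop G) \<Longrightarrow> g \<notin> K \<Longrightarrow> f g = 0"
proof -
  let ?S = "subtopology (gtop G) U"
  define K where "K = ?S closure_of {g \<in> U. f g \<noteq> 0}"
  have K: "compactin ?S K" using f by (simp add: Cc_bisection_def K_def)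
  have "{g \<in> U. f g \<noteq> 0} \<inter> topspace ?S \<subseteq> K"
    unfolding K_def using closure_of_subset_Int[of ?S "{g \<in> U. f g \<noteq> 0}"] by blast
  then have "f g = 0" if "g \<in> topspace (gtop G)" "g \<notin> K" for g
    using that f by (auto simp: Cc_bisection_def)
  then show ?thesis
    using that[of K] K by (simp add: compactin_subtopology)
qed

lemma Cc_bisection_bounded:
  assumes f: "f \<in> Cc_bisection G U" and U: "U \<subseteq> topspace (gtop G)"
  obtains M where "0 \<le> M" "\<And>g. cmod (f g) \<le> M"
proof -
  obtain K where K: "compactin (subtopology (gtop G) U) K"
    "\<And>g. g \<in> topspace (gtop G) \<Longrightarrow> g \<notin> K \<Longrightarrow> f g = 0"
    using Cc_bisection_support[OF f] by metis
  have "compactin euclidean (f ` K)"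
    using K(1) f by (intro image_compactin[OF K(1)]) (simp add: Cc_bisection_def)
  then have "bounded (f ` K)" by (simp add: compact_imp_bounded)
  then obtain M where M: "\<And>g. g \<in> K \<Longrightarrow> cmod (f g) \<le> M" by (auto simp: bounded_iff)
  have "cmod (f g) \<le> max M 0" for g
  proof (cases "g \<in> K")
    case False
    then have "f g = 0" using K(2) f U by (auto simp: Cc_bisection_def)
    then show ?thesis by simp
  qed (use M in \<open>simp add: le_max_iff_disj\<close>)
  then show ?thesis using that[of "max M 0"] by simp
qed

lemma finite_of_all_eq: "(\<And>a b. a \<in> S \<Longrightarrow> b \<in> S \<Longrightarrow> a = b) \<Longrightarrow> finite S"
  by (metis finite.emptyI finite_insert finite_subset insertI1 subsetI)

text \<open>On each fibre the positions whose entry lies in \<open>U\<close> form the graph of a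
  partial injection. A matrix with at most one nonzero entry in each row and column is bounded by
  the largest modulus of its entries.\<close>

lemma conv_bounded_of_partial_injection:
  assumes "0 \<le> M" and bd: "\<And>g. cmod (f g) \<le> M" and off: "\<And>g. g \<notin> U \<Longrightarrow> f g = 0"
    and row: "\<And>g h k. g \<in> arrows G \<Longrightarrow> h \<in> fibre G (gsrc G g) \<Longrightarrow> k \<in> fibre G (gsrc G g) \<Longrightarrow>
      gmul G g (ginv G h) \<in> U \<Longrightarrow> gmul G g (ginv G k) \<in> U \<Longrightarrow> h = k"
    and col: "\<And>g g' h. h \<in> arrows G \<Longrightarrow> g \<in> fibre G (gsrc G h) \<Longrightarrow> g' \<in> fibre G (gsrc G h) \<Longrightarrow>
      gmul G g (ginv G h) \<in> U \<Longrightarrow> gmul G g' (ginv G h) \<in> U \<Longrightarrow> g = g'"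
  shows "conv_bounded G f"
  unfolding conv_bounded_def
proof (intro conjI exI[of _ M])
  show "row_finite G f"
    unfolding row_finite_def
  proof
    fix g assume g: "g \<in> arrows G"
    show "finite {h \<in> fibre G (gsrc G g). f (gmul G g (ginv G h)) \<noteq> 0}"
      by (rule finite_of_all_eq) (use row[OF g] off in blast)
  qed
  show "mat_bound G f M"
    unfolding mat_bound_def
  proof (intro ballI allI impI, elim conjE)
    fix x E and \<xi> :: "'a \<Rightarrow> complex"
    assume E: "finite E" "E \<subseteq> fibre G x"
    let ?R = "\<lambda>g h. gmul G g (ginv G h) \<in> U"
    have arr: "g \<in> arrows G" "gsrc G g = x" if "g \<in> E" for g
      using that E by (auto simp: fibre_def)
    have rowE: "h = k" if "g \<in> E" "h \<in> E" "k \<in> E" "?R g h" "?R g k" for g h k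
      using row[of g h k] that E arr by auto
    have colE: "g = g'" if "g \<in> E" "g' \<in> E" "h \<in> E" "?R g h" "?R g' h" for g g' h
      using col[of h g g'] that E arr by auto
    have r: "(cmod (\<Sum>h\<in>E. f (gmul G g (ginv G h)) * \<xi> h))\<^sup>2 \<le> (\<Sum>h | h \<in> E \<and> ?R g h. M\<^sup>2 * (cmod (\<xi> h))\<^sup>2)"
      if g: "g \<in> E" for g
    proof (cases "\<exists>h\<in>E. ?R g h")
      case True
      then obtain h0 where h0: "h0 \<in> E" "?R g h0" by blast
      then have eq: "{h. h \<in> E \<and> ?R g h} = {h0}" using rowE[OF g] by blast
      have "(\<Sum>h\<in>E. f (gmul G g (ginv G h)) * \<xi> h) = (\<Sum>h\<in>{h0}. f (gmul G g (ginv G h)) * \<xi> h)"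
        by (rule sum.mono_neutral_right) (use E h0 eq off in auto)
      moreover have "(cmod (f (gmul G g (ginv G h0)) * \<xi> h0))\<^sup>2 \<le> (M * cmod (\<xi> h0))\<^sup>2"
        unfolding norm_mult by (intro power_mono mult_right_mono bd) auto
      ultimately show ?thesis by (simp add: eq power_mult_distrib)
    next
      case False
      then have "(\<Sum>h\<in>E. f (gmul G g (ginv G h)) * \<xi> h) = 0"
        using off by (intro sum.neutral) auto
      then show ?thesis by (simp add: sum_nonneg)
    qed
    have c: "(\<Sum>g | g \<in> E \<and> ?R g h. M\<^sup>2 * (cmod (\<xi> h))\<^sup>2) \<le> M\<^sup>2 * (cmod (\<xi> h))\<^sup>2" if h: "h \<in> E" for h
    proof (cases "\<exists>g\<in>E. ?R g h")
      case True
      then obtain g0 where "{g. g \<in> E \<and> ?R g h} = {g0}" using colE[OF _ _ h] by blast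
      then show ?thesis by simp
    next
      case False
      then have eq: "{g. g \<in> E \<and> ?R g h} = {}" by blast
      show ?thesis unfolding eq by simp
    qed
    have "(\<Sum>g\<in>E. (cmod (\<Sum>h\<in>E. f (gmul G g (ginv G h)) * \<xi> h))\<^sup>2)
        \<le> (\<Sum>g\<in>E. \<Sum>h | h \<in> E \<and> ?R g h. M\<^sup>2 * (cmod (\<xi> h))\<^sup>2)"
      by (intro sum_mono r)
    also have "\<dots> = (\<Sum>h\<in>E. \<Sum>g | g \<in> E \<and> ?R g h. M\<^sup>2 * (cmod (\<xi> h))\<^sup>2)"
      by (rule sum.swap_restrict[OF E(1) E(1)])
    also have "\<dots> \<le> (\<Sum>h\<in>E. M\<^sup>2 * (cmod (\<xi> h))\<^sup>2)"
      by (intro sum_mono c)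
    finally have "sqrt (\<Sum>g\<in>E. (cmod (\<Sum>h\<in>E. f (gmul G g (ginv G h)) * \<xi> h))\<^sup>2)
        \<le> sqrt (M\<^sup>2 * (\<Sum>h\<in>E. (cmod (\<xi> h))\<^sup>2))"
      by (intro real_sqrt_le_mono) (simp add: sum_distrib_left)
    then show "L2_set (\<lambda>g. cmod (\<Sum>h\<in>E. f (gmul G g (ginv G h)) * \<xi> h)) E \<le> M * L2_set (\<lambda>h. cmod (\<xi> h)) E"
      using \<open>0 \<le> M\<close> by (simp add: L2_set_def real_sqrt_mult)
  qed
qed (rule \<open>0 \<le> M\<close>)

context etale_groupoid
begin

text \<open>The arrows \<open>g h\<^sup>-\<^sup>1\<close> in one row share their range and those in
  one column share their source, so each row and each column meets a bisection at most once.\<close>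

lemma conv_bounded_bisection:
  assumes U: "open_bisection G U" and f: "f \<in> Cc_bisection G U"
  shows "conv_bounded G f"
proof -
  obtain M where M: "0 \<le> M" "\<And>g. cmod (f g) \<le> M"
    using Cc_bisection_bounded[OF f] openin_subset[OF bisection_openin[OF U]] by metis
  show ?thesis
  proof (rule conv_bounded_of_partial_injection[OF M])
    show "f g = 0" if "g \<notin> U" for g using f that by (simp add: Cc_bisection_def)
  next
    fix g h k
    assume g: "g \<in> arrows G" and "h \<in> fibre G (gsrc G g)" "k \<in> fibre G (gsrc G g)"
      and u: "gmul G g (ginv G h) \<in> U" "gmul G g (ginv G k) \<in> U"
    then have hk: "h \<in> arrows G" "gsrc G h = gsrc G g" "k \<in> arrows G" "gsrc G k = gsrc G g"
      by (auto simp: fibre_def)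
    have "gmul G g (ginv G h) = gmul G g (ginv G k)"
      by (rule bisection_rng_inj[OF U u]) (use g hk in \<open>simp add: rng_mul inv_in rng_inv\<close>)
    then have "gmul G (ginv G g) (gmul G g (ginv G h)) = gmul G (ginv G g) (gmul G g (ginv G k))"
      by simp
    then have "ginv G h = ginv G k"
      using g hk by (simp add: inv_mul_cancel inv_in rng_inv)
    then show "h = k" using hk inv_inv by metis
  next
    fix g g' h
    assume h: "h \<in> arrows G" and "g \<in> fibre G (gsrc G h)" "g' \<in> fibre G (gsrc G h)"
      and u: "gmul G g (ginv G h) \<in> U" "gmul G g' (ginv G h) \<in> U"
    then have gg: "g \<in> arrows G" "gsrc G g = gsrc G h" "g' \<in> arrows G" "gsrc G g' = gsrc G h"
      by (auto simp: fibre_def)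
    have "gmul G g (ginv G h) = gmul G g' (ginv G h)"
      by (rule bisection_src_inj[OF U u]) (use h gg in \<open>simp add: src_mul inv_in rng_inv\<close>)
    then have "gmul G (gmul G g (ginv G h)) h = gmul G (gmul G g' (ginv G h)) h"
      by simp
    then show "g = g'" using h gg by (simp add: mul_inv_cancel_right')
  qed
qed

lemma conv_bounded_Cc:
  assumes "f \<in> Cc G"
  shows "conv_bounded G f"
  using assms
proof (induction rule: Cc_induct)
  case (lincomb U f k c)
  then show ?case by (intro conv_bounded_lincomb[OF conv_bounded_bisection])
qed (rule conv_bounded_zero)

section \<open>Values, continuity and supports of the transferred functions\<close>

lemma cover_map_off: "A \<notin> arrows H \<Longrightarrow> cover_map G f A = 0"
  by (simp add: cover_map_def)

lemma cover_map_bisection_eq: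
  assumes U: "open_bisection G U" and off: "\<And>g. g \<notin> U \<Longrightarrow> f g = 0"
    and A: "A \<in> arrows H" and k: "k \<in> A" "k \<in> U"
  shows "cover_map G f A = f k"
proof -
  have "(\<Sum>\<^sub>\<infinity>g\<in>A. f g) = (\<Sum>\<^sub>\<infinity>g\<in>{k}. f g)"
    by (rule infsum_cong_neutral) (use k off cover_elem_bisection_unique[OF A U] in auto)
  then show ?thesis using A by (simp add: cover_map_def)
qed

lemma cover_map_bisection_zero:
  assumes "\<And>g. g \<notin> U \<Longrightarrow> f g = 0" "A \<inter> U = {}"
  shows "cover_map G f A = 0"
proof -
  have "(\<Sum>\<^sub>\<infinity>g\<in>A. f g) = 0"
    by (rule infsum_0) (use assms in auto)
  then show ?thesis by (simp add: cover_map_def)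
qed

text \<open>Range is constant on \<open>A\<close> and injective on a bisection, so \<open>A\<close>
  meets each bisection at most once. The infinite sum in \<open>cover_map\<close> is therefore
  finite and linear in \<open>f\<close>.\<close>

lemma Cc_finite_on_cover:
  assumes f: "f \<in> Cc G" and A: "A \<in> arrows H"
  shows "finite {k \<in> A. f k \<noteq> 0}"
  using f
proof (induction rule: Cc_induct)
  case (lincomb U f k c)
  have "finite {k \<in> A. f k \<noteq> 0}"
    by (rule finite_of_all_eq)
      (use lincomb(2) cover_elem_bisection_unique[OF A lincomb(1)] in \<open>auto simp: Cc_bisection_def\<close>)
  then have "finite ({k \<in> A. f k \<noteq> 0} \<union> {g \<in> A. k g \<noteq> 0})" using lincomb by simp
  then show ?case by (rule rev_finite_subset) auto
qed simp

lemma Cc_bisection_imp_Cc: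
  assumes "open_bisection G U" "f \<in> Cc_bisection G U"
  shows "f \<in> Cc G"
  using Cc_lincomb_bisection[OF assms Cc_zero, of 1] by simp

lemma cover_map_lincomb:
  assumes f: "f \<in> Cc G" and k: "k \<in> Cc G"
  shows "cover_map G (\<lambda>g. c * f g + k g) A = c * cover_map G f A + cover_map G k A"
proof (cases "A \<in> arrows H")
  case True
  define S where "S = {g \<in> A. f g \<noteq> 0} \<union> {g \<in> A. k g \<noteq> 0}"
  have S: "finite S" "S \<subseteq> A"
    using Cc_finite_on_cover[OF f True] Cc_finite_on_cover[OF k True] by (auto simp: S_def)
  have "(\<Sum>\<^sub>\<infinity>g\<in>A. p g) = (\<Sum>g\<in>S. p g)" if "p \<in> {f, k, \<lambda>g. c * f g + k g}" for p
  proof -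
    have "(\<Sum>\<^sub>\<infinity>g\<in>A. p g) = (\<Sum>\<^sub>\<infinity>g\<in>S. p g)"
      by (rule infsum_cong_neutral) (use that S in \<open>auto simp: S_def\<close>)
    then show ?thesis using S by simp
  qed
  then show ?thesis
    using True by (simp add: cover_map_def sum.distrib sum_distrib_left)
qed (simp add: cover_map_off)

lemma cover_map_diff:
  assumes f: "f \<in> Cc G" and k: "k \<in> Cc G"
  shows "cover_map G (\<lambda>g. f g - k g) A = cover_map G f A - cover_map G k A"
  using cover_map_lincomb[OF k f, of "-1" A] by simp

lemma cover_map_zero: "cover_map G (\<lambda>_. 0) = (\<lambda>_. 0)"
  by (auto simp: cover_map_def)

text \<open>For one bisection there are two cases. If \<open>Z\<close> misses \<open>U\<close>, the
  singletons near \<open>Z\<close> avoid the compact support, although it need not be closed in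
  \<open>G\<close>, and \<open>f\<close> is eventually 0. If \<open>Z\<close> meets \<open>U\<close>
  in \<open>k\<close>, the singletons eventually lie in \<open>U\<close>, where \<open>f\<close> is
  continuous. Thus \<open>cover_map\<close> records the limits of a function that may be
  discontinuous on \<open>G\<close>.\<close>

lemma tendsto_cover_map:
  assumes f: "f \<in> Cc G" and Z: "Z \<in> arrows H"
  shows "(f \<longlongrightarrow> cover_map G f Z) (near Z)"
  using f
proof (induction rule: Cc_induct)
  case zero
  then show ?case by (simp add: cover_map_zero)
next
  case (lincomb U f k c)
  note U = lincomb(1) and f = lincomb(2)
  have off: "f g = 0" if "g \<notin> U" for g using f that by (simp add: Cc_bisection_def)
  have "(f \<longlongrightarrow> cover_map G f Z) (near Z)"
  proof (cases "Z \<inter> U = {}")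
    case True
    obtain K where K: "compactin (gtop G) K" "K \<subseteq> U" "\<And>g. g \<in> arrows G \<Longrightarrow> g \<notin> K \<Longrightarrow> f g = 0"
      using Cc_bisection_support[OF f] by metis
    have "\<forall>\<^sub>F z in near Z. z \<notin> K"
      using True K by (intro eventually_fell_filter_compact) auto
    then have "\<forall>\<^sub>F z in near Z. f z = 0"
      using eventually_fell_filter_topspace[of "gtop G" Z] by eventually_elim (use K(3) in blast)
    then show ?thesis
      using cover_map_bisection_zero[OF off True] by (simp add: tendsto_eventually)
  next
    case False
    then obtain k where k: "k \<in> Z" "k \<in> U" by blast
    have eq: "cover_map G f Z = f k"
      by (rule cover_map_bisection_eq[OF U off Z k])
    show ?thesis
      unfolding eq tendsto_def
    proof (intro allI impI)
      fix S assume S: "open S" "f k \<in> S"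
      have "openin (subtopology (gtop G) U) {g \<in> topspace (subtopology (gtop G) U). f g \<in> S}"
        using f S by (intro openin_continuous_map_preimage[of _ euclidean]) (auto simp: Cc_bisection_def)
      then have "openin (gtop G) {g \<in> topspace (subtopology (gtop G) U). f g \<in> S}"
        using bisection_openin[OF U] openin_trans_full by blast
      then have "\<forall>\<^sub>F z in near Z. z \<in> {g \<in> topspace (subtopology (gtop G) U). f g \<in> S}"
        by (rule eventually_fell_filter_open) (use k S bisection_arrows[OF U] in auto)
      then show "\<forall>\<^sub>F z in near Z. f z \<in> S" by (rule eventually_mono) simp
    qed
  qed
  then have "((\<lambda>g. c * f g + k g) \<longlongrightarrow> c * cover_map G f Z + cover_map G k Z) (near Z)"
    by (intro tendsto_intros lincomb)
  then show ?case
    using cover_map_lincomb[OF Cc_bisection_imp_Cc[OF U f] lincomb(3)] by simp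
qed

text \<open>On \<open>cover_bisection U\<close> the value at \<open>A\<close> is \<open>f k\<close>
  for the single point \<open>k\<close> of \<open>A\<close> in \<open>U\<close>, so preimages of
  open sets are given by meeting an open set. The support lies among the arrows that meet a compact
  set \<open>K\<close>; these are compact, and closed because missing \<open>K\<close> is an open
  condition.\<close>

lemma cover_map_Cc_bisection:
  assumes U: "open_bisection G U" and f: "f \<in> Cc_bisection G U"
  shows "cover_map G f \<in> Cc_bisection H (cover_bisection U)"
proof -
  have off: "f g = 0" if "g \<notin> U" for g using f that by (simp add: Cc_bisection_def)
  let ?S = "subtopology (gtop H) (cover_bisection U)"
  have BU: "cover_bisection U \<subseteq> arrows H" by (auto simp: cover_bisection_def)
  then have topS: "topspace ?S = cover_bisection U" by auto
  have cont: "continuous_map ?S euclidean (cover_map G f)"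
    unfolding continuous_map_def
  proof (intro conjI allI impI)
    fix W :: "complex set" assume "openin euclidean W"
    then have "openin (subtopology (gtop G) U) {g \<in> topspace (subtopology (gtop G) U). f g \<in> W}"
      using f by (intro openin_continuous_map_preimage[of _ euclidean]) (auto simp: Cc_bisection_def)
    then have "openin (gtop G) {g \<in> topspace (subtopology (gtop G) U). f g \<in> W}"
      using bisection_openin[OF U] openin_trans_full by blast
    then have "openin (gtop H) {A \<in> arrows H. A \<inter> {g \<in> topspace (subtopology (gtop G) U). f g \<in> W} \<noteq> {}}"
      by (rule openin_cover_meets)
    then have "openin ?S (cover_bisection U \<inter>
        {A \<in> arrows H. A \<inter> {g \<in> topspace (subtopology (gtop G) U). f g \<in> W} \<noteq> {}})"
      by (rule openin_subtopology_Int2)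
    moreover have "cover_bisection U \<inter>
        {A \<in> arrows H. A \<inter> {g \<in> topspace (subtopology (gtop G) U). f g \<in> W} \<noteq> {}}
        = {A \<in> topspace ?S. cover_map G f A \<in> W}"
    proof (intro subset_antisym subsetI)
      fix A assume "A \<in> cover_bisection U \<inter>
        {A \<in> arrows H. A \<inter> {g \<in> topspace (subtopology (gtop G) U). f g \<in> W} \<noteq> {}}"
      then obtain k where "A \<in> cover_bisection U" "A \<in> arrows H" "k \<in> A" "k \<in> U" "f k \<in> W" by auto
      then show "A \<in> {A \<in> topspace ?S. cover_map G f A \<in> W}"
        using cover_map_bisection_eq[OF U off] unfolding topS by auto
    next
      fix A assume "A \<in> {A \<in> topspace ?S. cover_map G f A \<in> W}"
      then have A: "A \<in> cover_bisection U" "cover_map G f A \<in> W" unfolding topS by auto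
      then obtain k where k: "A \<in> arrows H" "k \<in> A" "k \<in> U" by (auto simp: cover_bisection_def)
      then have "f k \<in> W" using cover_map_bisection_eq[OF U off] A by simp
      then show "A \<in> cover_bisection U \<inter>
        {A \<in> arrows H. A \<inter> {g \<in> topspace (subtopology (gtop G) U). f g \<in> W} \<noteq> {}}"
        using A k bisection_arrows[OF U] by auto
    qed
    ultimately show "openin ?S {A \<in> topspace ?S. cover_map G f A \<in> W}" by simp
  qed simp
  obtain K where K: "compactin (gtop G) K" "K \<subseteq> U" "\<And>g. g \<in> arrows G \<Longrightarrow> g \<notin> K \<Longrightarrow> f g = 0"
    using Cc_bisection_support[OF f] by metis
  define L where "L = {A \<in> arrows H. A \<inter> K \<noteq> {}}"
  have LU: "L \<subseteq> cover_bisection U" using K(2) by (auto simp: L_def cover_bisection_def)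
  have cpt: "compactin ?S L"
    using compactin_cover_meets[OF K(1)] LU by (simp add: compactin_subtopology L_def)
  have "closedin (gtop H) L"
  proof -
    have "L = topspace (gtop H) - {A \<in> arrows H. A \<inter> K = {}}" by (auto simp: L_def)
    then show ?thesis using openin_cover_misses[OF K(1)] by (simp add: closedin_diff)
  qed
  then have closed: "closedin ?S L"
    using LU by (simp add: closedin_subset_topspace)
  have sub: "{A \<in> cover_bisection U. cover_map G f A \<noteq> 0} \<subseteq> L"
  proof
    fix A assume "A \<in> {A \<in> cover_bisection U. cover_map G f A \<noteq> 0}"
    then obtain k where k: "A \<in> arrows H" "k \<in> A" "k \<in> U" "cover_map G f A \<noteq> 0"
      by (auto simp: cover_bisection_def)
    then have "f k \<noteq> 0" using cover_map_bisection_eq[OF U off] by simp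
    then have "k \<in> K" using K(3) cover_elem_arrow[OF k(1,2)] by blast
    then show "A \<in> L" using k by (auto simp: L_def)
  qed
  have "compactin ?S (?S closure_of {A \<in> cover_bisection U. cover_map G f A \<noteq> 0})"
    by (rule closed_compactin[OF cpt closure_of_minimal[OF sub closed] closedin_closure_of])
  moreover have "cover_map G f A = 0" if "A \<notin> cover_bisection U" for A
    using that cover_map_bisection_zero[where U = U and f = f and A = A, OF off] cover_map_off[of A f] by (auto simp: cover_bisection_def)
  ultimately show ?thesis
    using cont by (simp add: Cc_bisection_def)
qed

lemma cover_map_Cc:
  assumes "f \<in> Cc G"
  shows "cover_map G f \<in> Cc H"
  using assms
proof (induction rule: Cc_induct)
  case zero
  then show ?case using Cc_zero[of H] by (simp add: cover_map_zero)
next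
  case (lincomb U f k c)
  have "(\<lambda>A. c * cover_map G f A + cover_map G k A) \<in> Cc H"
    using lincomb by (intro Cc_lincomb_bisection[OF open_bisection_cover] cover_map_Cc_bisection)
  then show ?case
    using cover_map_lincomb[OF Cc_bisection_imp_Cc[OF lincomb(1,2)] lincomb(3)] by simp
qed

text \<open>Along a row \<open>A\<close> all products \<open>A B\<^sup>-\<^sup>1\<close> have the
  same range of elements, so two of them that meet \<open>U\<close> do so in the same arrow, written
  \<open>a h\<^sup>-\<^sup>1\<close> and \<open>b l\<^sup>-\<^sup>1\<close>. Then \<open>l\<close>
  equals \<open>h\<close> times \<open>a\<^sup>-\<^sup>1 b\<close>, which lies in the common source;
  hence \<open>l\<close> is in \<open>B\<close> as well as in \<open>C\<close>, and the two columns
  coincide.\<close>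

lemma row_finite_cover_map:
  assumes "f \<in> Cc G"
  shows "row_finite H (cover_map G f)"
  using assms
proof (induction rule: Cc_induct)
  case zero
  then show ?case by (simp add: cover_map_zero row_finite_def)
next
  case (lincomb U f k c)
  note U = lincomb(1) and f = lincomb(2)
  have off: "f g = 0" if "g \<notin> U" for g using f that by (simp add: Cc_bisection_def)
  have "row_finite H (cover_map G f)"
    unfolding row_finite_def
  proof
    fix A assume A: "A \<in> arrows H"
    show "finite {B \<in> fibre H (gsrc H A). cover_map G f (gmul H A (ginv H B)) \<noteq> 0}"
    proof (rule finite_of_all_eq)
      fix B C
      assume "B \<in> {B \<in> fibre H (gsrc H A). cover_map G f (gmul H A (ginv H B)) \<noteq> 0}"
        "C \<in> {B \<in> fibre H (gsrc H A). cover_map G f (gmul H A (ginv H B)) \<noteq> 0}"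
      then have B: "B \<in> arrows H" "gsrc H A = gsrc H B" "gmul H A (ginv H B) \<inter> U \<noteq> {}"
        and C: "C \<in> arrows H" "gsrc H A = gsrc H C" "gmul H A (ginv H C) \<inter> U \<noteq> {}"
        using cover_map_bisection_zero[OF off] by (auto simp: fibre_def)
      obtain h where h: "h \<in> B" using cover_nonempty[OF B(1)] by blast
      obtain l where l: "l \<in> C" using cover_nonempty[OF C(1)] by blast
      obtain a where a: "a \<in> A" "gmul G a (ginv G h) \<in> U"
        using B(3) cover_mul_inv[OF A B(1,2) h] by auto
      obtain b where b: "b \<in> A" "gmul G b (ginv G l) \<in> U"
        using C(3) cover_mul_inv[OF A C(1,2) l] by auto
      have arr: "a \<in> arrows G" "b \<in> arrows G" "h \<in> arrows G" "l \<in> arrows G"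
        using cover_elem_arrow A B(1) C(1) a b h l by blast+
      have s: "gsrc G a = gsrc G h" "gsrc G b = gsrc G l" "grng G a = grng G b" "gsrc G a = gsrc G b"
        using cover_src_eq_src[OF A B(1,2) a(1) h] cover_src_eq_src[OF A C(1,2) b(1) l]
          cover_rng_const[OF A a(1) b(1)] cover_src_const[OF A a(1) b(1)] by simp_all
      have u: "gmul G a (ginv G h) = gmul G b (ginv G l)"
        by (rule bisection_rng_inj[OF U a(2) b(2)]) (use arr s in \<open>simp add: rng_mul inv_in rng_inv\<close>)
      have hl: "grng G h = grng G l"
        using arg_cong[OF u, of "gsrc G"] arr s by (simp add: src_mul inv_in src_inv rng_inv)
      have "gmul G (ginv G a) b \<in> gsrc H B"
        using b(1) B(2) cover_src_eq[OF A a(1)] by auto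
      then have "gmul G h (gmul G (ginv G a) b) \<in> B"
        using cover_src_coset[OF B(1) h] by blast
      moreover have "gmul G (ginv G a) b = gmul G (ginv G h) l"
      proof -
        have "gmul G a (gmul G (ginv G h) l) = gmul G (gmul G a (ginv G h)) l"
          using arr s hl by (simp add: mul_assoc inv_in src_inv rng_inv)
        also have "\<dots> = b"
          unfolding u using arr s by (simp add: mul_inv_cancel_right')
        finally have "b = gmul G a (gmul G (ginv G h) l)" ..
        then show ?thesis
          using arr s hl by (simp add: inv_mul_cancel mul_in inv_in src_inv rng_inv rng_mul)
      qed
      moreover have "gmul G h (gmul G (ginv G h) l) = l"
        by (rule mul_inv_cancel_left) (use arr hl in auto)
      ultimately have "l \<in> B" by simp
      then show "B = C"
        using cover_eq_of_common[OF B(1) C(1) _ _ l] B(2) C(2) by simp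
    qed
  qed
  then have "row_finite H (\<lambda>A. c * cover_map G f A + cover_map G k A)"
    using lincomb by (intro row_finite_lincomb)
  then show ?case
    using cover_map_lincomb[OF Cc_bisection_imp_Cc[OF U f] lincomb(3)] by simp
qed


section \<open>Local sections over unit singletons and contractivity\<close>

abbreviation near_units :: "'g set \<Rightarrow> 'g filter" where
  "near_units X \<equiv> inf (near X) (principal (gunits G))"

lemma eventually_src_section:
  assumes A: "A \<in> arrows H" and g: "g \<in> A" and U: "open_bisection G U" "g \<in> U"
  shows "\<forall>\<^sub>F z in near_units (gsrc H A). z \<in> gunits G \<and> src_section G U z \<in> U \<and> gsrc G (src_section G U z) = z"
proof -
  obtain k where k: "k \<in> gsrc H A" using cover_nonempty[OF cover_src_arrow[OF A]] by blast
  have "\<forall>\<^sub>F z in near (gsrc H A). gsrc G z \<in> gsrc G ` U"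
  proof (rule eventually_near_src)
    have "gsrc G k \<in> gsrc G ` U" using cover_src_elem(1)[OF A g k] U(2) by simp
    then show "gsrc H A \<inter> {g \<in> arrows G. gsrc G g \<in> gsrc G ` U} \<noteq> {}"
      using k cover_elem_arrow[OF cover_src_arrow[OF A] k] by blast
  qed (rule openin_src_image[OF bisection_openin[OF U(1)]])
  then show ?thesis
    unfolding eventually_inf_principal
  proof eventually_elim
    case (elim z)
    show ?case
    proof
      assume z: "z \<in> gunits G"
      then obtain u where "u \<in> U" "z = gsrc G u" using elim by (auto simp: src_unit)
      then show "z \<in> gunits G \<and> src_section G U z \<in> U \<and> gsrc G (src_section G U z) = z"
        using z src_section[OF U(1)] by simp
    qed
  qed
qed

text \<open>The arrow \<open>A\<close> is the coset of its source through \<open>g\<close>. Moving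
  \<open>g\<close> along the bisection carries a unit \<open>z\<close> near the source to the arrow
  of \<open>U\<close> with source \<open>z\<close>, which is then near \<open>A\<close>. Finite
  blocks and supports are both transported in this way.\<close>

lemma filterlim_src_section:
  assumes A: "A \<in> arrows H" and g: "g \<in> A" and U: "open_bisection G U" "g \<in> U"
  shows "filterlim (src_section G U) (near A) (near_units (gsrc H A))"
proof -
  let ?X = "gsrc H A"
  let ?w = "\<lambda>z. gmul G (gmul G (src_section G U (grng G z)) z) (rng_section G (gunits G) (gsrc G z))"
  note XA = cover_src_arrow[OF A] and ga = cover_elem_arrow[OF A g]
  have "filterlim ?w (near (translate G g ?X (gsrc G g))) (near ?X)"
  proof (rule filterlim_translate[OF _ _ _ _ U bisection_units src_in[OF ga]])
    show "?X \<subseteq> arrows G" using cover_elem_arrow[OF XA] by blast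
    show "?X \<noteq> {}" by (rule cover_nonempty[OF XA])
    show "grng G k = gsrc G g" if "k \<in> ?X" for k by (rule cover_src_elem(2)[OF A g that])
    show "gsrc G k = grng G (gsrc G g)" if "k \<in> ?X" for k
      using cover_src_elem(1)[OF A g that] rng_src[OF ga] by simp
  qed
  moreover have "translate G g ?X (gsrc G g) = (\<lambda>k. gmul G g k) ` ?X"
  proof (rule translate_unit_right[OF _ ga src_in[OF ga]])
    show "?X \<subseteq> arrows G" using cover_elem_arrow[OF XA] by blast
    show "gsrc G g = grng G k" if "k \<in> ?X" for k by (rule cover_src_elem(2)[OF A g that, symmetric])
    show "gsrc G k = gsrc G g" if "k \<in> ?X" for k by (rule cover_src_elem(1)[OF A g that])
  qed
  moreover have "\<dots> = A" by (rule cover_src_coset[OF A g, symmetric])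
  ultimately have "filterlim ?w (near A) (near ?X)" by simp
  then have *: "filterlim ?w (near A) (near_units ?X)"
    by (rule filterlim_mono[OF _ order_refl]) simp
  have "\<forall>\<^sub>F z in near_units ?X. ?w z = src_section G U z"
    using eventually_src_section[OF A g U]
  proof eventually_elim
    case (elim z)
    have "src_section G U z \<in> arrows G" using elim bisection_arrows U(1) by blast
    moreover have "rng_section G (gunits G) z = z"
      using rng_section[OF bisection_units, of z] elim by (simp add: rng_unit)
    moreover have "gmul G (src_section G U z) z = src_section G U z"
      using mul_src[of "src_section G U z"] elim calculation by simp
    ultimately show ?case using elim by (simp add: src_unit rng_unit)
  qed
  then show ?thesis using * by (rule filterlim_cong[OF refl refl, THEN iffD1])
qed

text \<open>A finite matrix of \<open>cover_map G f\<close> in the fibre over \<open>X\<close> is a limit of matrices of \<open>f\<close> in the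
  fibres over units \<open>z\<close> with \<open>{z} \<rightarrow> X\<close>: each \<open>A\<close> in the fibre over \<open>X\<close> is approximated by the
  singletons of the values of a local section of the source map.\<close>

lemma mat_bound_cover_map:
  assumes f: "f \<in> Cc G" and bd: "mat_bound G f C"
  shows "mat_bound H (cover_map G f) C"
  unfolding mat_bound_def
proof (intro ballI allI impI, elim conjE)
  fix X E and \<xi> :: "'g set \<Rightarrow> complex"
  assume X: "X \<in> gunits H" and fin: "finite E" and E: "E \<subseteq> fibre H X"
  note XA = cover_unit_arrow[OF X]
  obtain x where x: "x \<in> gunits G" "x \<in> X" "\<And>k. k \<in> X \<Longrightarrow> gsrc G k = x" "\<And>k. k \<in> X \<Longrightarrow> grng G k = x"
    using cover_unit_obtain[OF X] by metis
  have EA: "A \<in> arrows H" "gsrc H A = X" if "A \<in> E" for A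
    using that E by (auto simp: fibre_def)
  have "\<exists>g U. g \<in> A \<and> open_bisection G U \<and> g \<in> U" if A: "A \<in> E" for A
  proof -
    obtain g where g: "g \<in> A" using cover_nonempty[OF EA(1)[OF A]] by blast
    moreover obtain U where "open_bisection G U" "g \<in> U"
      using bisection_at[OF openin_topspace cover_elem_arrow[OF EA(1)[OF A] g]] by metis
    ultimately show ?thesis by blast
  qed
  then obtain g U where gU: "\<And>A. A \<in> E \<Longrightarrow> g A \<in> A" "\<And>A. A \<in> E \<Longrightarrow> open_bisection G (U A)"
    "\<And>A. A \<in> E \<Longrightarrow> g A \<in> U A" by metis
  have ga: "g A \<in> arrows G" "gsrc G (g A) = x" if "A \<in> E" for A
  proof -
    show "g A \<in> arrows G" using cover_elem_arrow[OF EA(1) gU(1)] that by blast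
    have "gsrc G x = gsrc G (g A)"
      using cover_src_elem(1)[OF EA(1)[OF that] gU(1)[OF that]] x(2) EA(2)[OF that] by simp
    then show "gsrc G (g A) = x" using x(1) by (simp add: src_unit)
  qed
  define \<gamma> where "\<gamma> A z = src_section G (U A) z" for A z
  define F where "F = inf (near X) (principal (gunits G))"
  have F: "F \<noteq> bot"
    using X by (simp add: F_def trivial_limit_def eventually_inf_principal cover_unit_iff frequently_def)
  have FX: "F \<le> near X" by (simp add: F_def)
  have Funit: "\<forall>\<^sub>F z in F. z \<in> gunits G"
    by (simp add: F_def eventually_inf_principal)
  have sect: "\<forall>\<^sub>F z in F. z \<in> gunits G \<and> \<gamma> A z \<in> U A \<and> gsrc G (\<gamma> A z) = z" if A: "A \<in> E" for A
    using eventually_src_section[OF EA(1)[OF A] gU[OF A]] EA(2)[OF A] by (simp add: F_def \<gamma>_def)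
  \<comment> \<open>The product \<open>A B\<^sup>-\<^sup>1\<close> is the translate of
    \<open>X\<close> by \<open>g A\<close> and the inverse of \<open>g B\<close>; at a unit
    \<open>z\<close> the moving translate is the corresponding entry in the fibre over
    \<open>z\<close>.\<close>
  have lim: "((\<lambda>z. f (gmul G (\<gamma> A z) (ginv G (\<gamma> B z)))) \<longlongrightarrow> cover_map G f (gmul H A (ginv H B))) F"
    if A: "A \<in> E" and B: "B \<in> E" for A B
  proof -
    let ?w = "\<lambda>z. gmul G (gmul G (src_section G (U A) (grng G z)) z)
        (rng_section G (ginv G ` U B) (gsrc G z))"
    have AB: "gsrc H A = gsrc H B" using EA A B by simp
    have "filterlim ?w (near (translate G (g A) X (ginv G (g B)))) (near X)"
    proof (rule filterlim_translate[OF _ _ _ _ gU(2,3)[OF A] bisection_inv[OF gU(2)[OF B]]])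
      show "X \<subseteq> arrows G" using cover_elem_arrow[OF XA] by blast
      show "X \<noteq> {}" by (rule cover_nonempty[OF XA])
      show "grng G k = gsrc G (g A)" if "k \<in> X" for k using x(4)[OF that] ga(2)[OF A] by simp
      show "gsrc G k = grng G (ginv G (g B))" if "k \<in> X" for k
        using x(3)[OF that] ga[OF B] by (simp add: rng_inv)
      show "ginv G (g B) \<in> ginv G ` U B" using gU(3)[OF B] by simp
    qed
    moreover have "translate G (g A) X (ginv G (g B)) = gmul H A (ginv H B)"
      using cover_mul_inv_translate[OF EA(1)[OF A] EA(1)[OF B] AB gU(1)[OF A] gU(1)[OF B]] EA(2)[OF A] by simp
    ultimately have "filterlim ?w (near (gmul H A (ginv H B))) (near X)" by simp
    then have "((\<lambda>z. f (?w z)) \<longlongrightarrow> cover_map G f (gmul H A (ginv H B))) (near X)"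
      by (rule filterlim_compose[OF tendsto_cover_map[OF f cover_mul_inv_arrow[OF EA(1)[OF A] EA(1)[OF B] AB]]])
    then have *: "((\<lambda>z. f (?w z)) \<longlongrightarrow> cover_map G f (gmul H A (ginv H B))) F"
      using FX by (rule tendsto_mono[rotated])
    have "\<forall>\<^sub>F z in F. f (?w z) = f (gmul G (\<gamma> A z) (ginv G (\<gamma> B z)))"
      using sect[OF A] sect[OF B]
    proof eventually_elim
      case (elim z)
      have "\<gamma> A z \<in> arrows G" "\<gamma> B z \<in> arrows G"
        using elim bisection_arrows gU(2) A B by blast+
      moreover have "rng_section G (ginv G ` U B) z = ginv G (\<gamma> B z)"
        using rng_section[OF bisection_inv[OF gU(2)[OF B]], of "ginv G (\<gamma> B z)"] elim calculation
        by (simp add: rng_inv)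
      moreover have "gmul G (\<gamma> A z) z = \<gamma> A z"
        using mul_src[of "\<gamma> A z"] elim calculation by simp
      ultimately show ?case using elim by (simp add: src_unit rng_unit \<gamma>_def)
    qed
    then show ?thesis using * by (rule tendsto_cong[THEN iffD1])
  qed
  have lim1: "filterlim (\<gamma> A) (near A) F" if A: "A \<in> E" for A
    using filterlim_src_section[OF EA(1)[OF A] gU[OF A]] EA(2)[OF A] by (simp add: F_def \<gamma>_def[abs_def])
  \<comment> \<open>Distinct indices must have distinct approximants, otherwise the approximating
    matrix would not be a block of the convolution matrix. A compact neighbourhood of
    \<open>g A\<close> outside the closed set \<open>B\<close> contains the first section eventually
    and is avoided by the second.\<close>
  have dist: "\<forall>\<^sub>F z in F. \<gamma> A z \<noteq> \<gamma> B z" if A: "A \<in> E" and B: "B \<in> E" and ne: "A \<noteq> B" for A B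
  proof -
    have "g A \<notin> B"
      using cover_eq_of_common[OF EA(1)[OF A] EA(1)[OF B] _ gU(1)[OF A]] ne EA(2) A B by auto
    moreover have "openin (gtop G) (arrows G - B)"
      using cover_closed[OF EA(1)[OF B]] by (simp add: closedin_def)
    ultimately obtain V K where VK: "openin (gtop G) V" "compactin (gtop G) K" "g A \<in> V" "V \<subseteq> K"
      "K \<subseteq> arrows G - B"
      using compact_neighbourhood[of "arrows G - B" "g A"] ga(1)[OF A] by blast
    have "\<forall>\<^sub>F z in near A. z \<in> V" "\<forall>\<^sub>F z in near B. z \<notin> K"
      using VK gU(1)[OF A] by (auto intro!: eventually_fell_filter_open eventually_fell_filter_compact)
    then have "\<forall>\<^sub>F z in F. \<gamma> A z \<in> V" "\<forall>\<^sub>F z in F. \<gamma> B z \<notin> K"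
      using lim1[OF A] lim1[OF B] by (auto simp: filterlim_iff)
    then show ?thesis by eventually_elim (use VK(4) in auto)
  qed
  have "\<forall>\<^sub>F z in F. \<forall>A\<in>E. \<forall>B\<in>E. A \<noteq> B \<longrightarrow> \<gamma> A z \<noteq> \<gamma> B z"
    using fin dist by (intro eventually_ball_finite ballI) (auto simp: eventually_mono)
  moreover have "\<forall>\<^sub>F z in F. \<forall>A\<in>E. z \<in> gunits G \<and> \<gamma> A z \<in> U A \<and> gsrc G (\<gamma> A z) = z"
    using fin sect by (intro eventually_ball_finite) auto
  ultimately have "\<forall>\<^sub>F z in F.
      L2_set (\<lambda>A. cmod (\<Sum>B\<in>E. f (gmul G (\<gamma> A z) (ginv G (\<gamma> B z))) * \<xi> B)) E \<le> C * L2_set (\<lambda>A. cmod (\<xi> A)) E"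
    using Funit
  proof eventually_elim
    case (elim z)
    let ?c = "\<lambda>A. \<gamma> A z"
    have inj: "inj_on ?c E" using elim by (auto simp: inj_on_def)
    have "?c ` E \<subseteq> fibre G z"
      using elim bisection_arrows gU(2) by (fastforce simp: fibre_def)
    \<comment> \<open>The vector is transported to the approximating arrows along the injection, so
      that the hypothesis on blocks of \<open>f\<close> applies in the fibre over
      \<open>z\<close>.\<close>
    then have "L2_set (\<lambda>a. cmod (\<Sum>b\<in>?c ` E. f (gmul G a (ginv G b)) * \<xi> (inv_into E ?c b))) (?c ` E)
        \<le> C * L2_set (\<lambda>b. cmod (\<xi> (inv_into E ?c b))) (?c ` E)"
      using bd elim fin unfolding mat_bound_def by (simp add: finite_imageI)
    moreover have "inv_into E ?c (\<gamma> A z) = A" if "A \<in> E" for A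
      using inv_into_f_f[OF inj that] .
    ultimately show ?case
      using inj by (simp add: L2_set_def sum.reindex o_def cong: sum.cong)
  qed
  moreover have "((\<lambda>z. L2_set (\<lambda>A. cmod (\<Sum>B\<in>E. f (gmul G (\<gamma> A z) (ginv G (\<gamma> B z))) * \<xi> B)) E) \<longlongrightarrow>
      L2_set (\<lambda>A. cmod (\<Sum>B\<in>E. cover_map G f (gmul H A (ginv H B)) * \<xi> B)) E) F"
    unfolding L2_set_def by (intro tendsto_intros lim)
  ultimately show "L2_set (\<lambda>A. cmod (\<Sum>B\<in>E. cover_map G f (gmul H A (ginv H B)) * \<xi> B)) E
      \<le> C * L2_set (\<lambda>A. cmod (\<xi> A)) E"
    using F tendsto_upperbound by blast
qed

lemma conv_bounded_cover_map:
  assumes f: "f \<in> Cc G"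
  shows "conv_bounded H (cover_map G f)"
  using conv_bounded_Cc[OF f] mat_bound_cover_map[OF f] row_finite_cover_map[OF f]
  unfolding conv_bounded_def by blast

end

section \<open>Completeness\<close>

lemma Cstar_red_linear:
  assumes "T \<in> Cstar_red G" "x \<in> gunits G"
  shows "linear_on_ell2 G x (T x)"
  using assms by (auto simp: Cstar_red_def intro!: bounded_operators_linear)

lemma family_norm_tendsto_0_iff:
  assumes T: "T \<in> Cstar_red G" and f: "\<And>n. conv_bounded G (f n)"
  shows "(\<lambda>n. family_norm G (T - reg_family G (f n))) \<longlonglongrightarrow> 0 \<longleftrightarrow>
    (\<forall>e>0. \<forall>\<^sub>F n in sequentially. op_dist_le G T (reg_family G (f n)) e)"
  unfolding ennreal_tendsto_0_iff
  using family_norm_diff_le_iff[of G T, OF Cstar_red_linear[OF T] reg_family_linear[OF f]] by simp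

lemma Cstar_red_sequence:
  assumes T: "T \<in> Cstar_red G"
  obtains f where "\<And>n. f n \<in> Cc G" "(\<lambda>n. family_norm G (T - reg_family G (f n))) \<longlonglongrightarrow> 0"
proof -
  have "\<exists>f\<in>Cc G. family_norm G (T - reg_family G f) < ennreal (1 / real (Suc n))" for n
    using T by (simp add: Cstar_red_def)
  then obtain f where f: "\<And>n. f n \<in> Cc G"
    "\<And>n. family_norm G (T - reg_family G (f n)) < ennreal (1 / real (Suc n))" by metis
  have "(\<lambda>n. family_norm G (T - reg_family G (f n))) \<longlonglongrightarrow> 0"
    unfolding ennreal_tendsto_0_iff
  proof (intro allI impI)
    fix e :: real assume "e > 0"
    then have "\<forall>\<^sub>F n in sequentially. 1 / real (Suc n) < e"
      using order_tendstoD(2)[OF LIMSEQ_inverse_real_of_nat] by (simp add: inverse_eq_divide)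
    then show "\<forall>\<^sub>F n in sequentially. family_norm G (T - reg_family G (f n)) \<le> ennreal e"
    proof eventually_elim
      case (elim n)
      then show ?case using f(2)[of n] ennreal_leI[of "1 / real (Suc n)" e] by simp
    qed
  qed
  then show ?thesis using that f(1) by blast
qed

lemma convolution_zero_right: "convolution G f (\<lambda>_. 0) g = 0"
  by (simp add: convolution_def infsum_0)

text \<open>The limit operator is built coordinate by coordinate; finite sums then carry the Cauchy
  bounds to the limit in norm. This supplies the image of an element of the completion under the map
  to the cover.\<close>

lemma Cstar_red_complete:
  fixes F :: "nat \<Rightarrow> 'g \<Rightarrow> complex"
  assumes Cc: "\<And>n. F n \<in> Cc G" and cb: "\<And>n. conv_bounded G (F n)"
    and Cauchy: "\<And>e. e > 0 \<Longrightarrow> \<exists>N. \<forall>m\<ge>N. \<forall>n\<ge>N. mat_bound G (\<lambda>g. F m g - F n g) e"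
  obtains S where "S \<in> Cstar_red G"
    "\<And>e. e > 0 \<Longrightarrow> \<forall>\<^sub>F n in sequentially. op_dist_le G S (reg_family G (F n)) e"
proof -
  \<comment> \<open>The convolution operator does not mention the fibre, so a single pointwise limit
    serves all units; it is restricted to the fibres at the end.\<close>
  define L where "L \<xi> h = lim (\<lambda>n. convolution G (F n) \<xi> h)" for \<xi> h
  have diff: "(\<lambda>h. convolution G (F m) \<xi> h - convolution G (F n) \<xi> h) \<in> ell2 G x"
    "ell2_norm G x (\<lambda>h. convolution G (F m) \<xi> h - convolution G (F n) \<xi> h) \<le> e * ell2_norm G x \<xi>"
    if "x \<in> gunits G" "\<xi> \<in> ell2 G x" "mat_bound G (\<lambda>g. F m g - F n g) e" "e > 0" for x \<xi> m n e
  proof -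
    have "(\<lambda>h. convolution G (F m) \<xi> h - convolution G (F n) \<xi> h) = convolution G (\<lambda>g. F m g - F n g) \<xi>"
      using convolution_diff_left[OF cb cb] by auto
    moreover have "row_finite G (\<lambda>g. F m g - F n g)"
      using conv_bounded_diff[OF cb cb] by (simp add: conv_bounded_def)
    ultimately show "(\<lambda>h. convolution G (F m) \<xi> h - convolution G (F n) \<xi> h) \<in> ell2 G x"
      "ell2_norm G x (\<lambda>h. convolution G (F m) \<xi> h - convolution G (F n) \<xi> h) \<le> e * ell2_norm G x \<xi>"
      using mat_bound_convolution[of G "\<lambda>g. F m g - F n g" e x \<xi>] that by auto
  qed
  have lim: "(\<lambda>n. convolution G (F n) \<xi> h) \<longlonglongrightarrow> L \<xi> h" if x: "x \<in> gunits G" "\<xi> \<in> ell2 G x" for x \<xi> h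
  proof (cases "h \<in> fibre G x")
    case True
    have "Cauchy (\<lambda>n. convolution G (F n) \<xi> h)"
    proof (rule CauchyI)
      fix e :: real assume e: "e > 0"
      \<comment> \<open>The summand 1 avoids a division by zero and makes
        \<open>d * ell2_norm G x \<xi>\<close> strictly smaller than \<open>e\<close>.\<close>
      define d where "d = e / (ell2_norm G x \<xi> + 1)"
      have d: "d > 0" using e ell2_norm_nonneg[of G x \<xi>] by (simp add: d_def add_nonneg_pos)
      have de: "d * ell2_norm G x \<xi> < e"
        using e ell2_norm_nonneg[of G x \<xi>] by (simp add: d_def field_simps add_nonneg_pos)
      obtain N where N: "\<forall>m\<ge>N. \<forall>n\<ge>N. mat_bound G (\<lambda>g. F m g - F n g) d" using Cauchy[OF d] by blast
      show "\<exists>N. \<forall>m\<ge>N. \<forall>n\<ge>N. cmod (convolution G (F m) \<xi> h - convolution G (F n) \<xi> h) < e"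
      proof (intro exI allI impI)
        fix m n assume "N \<le> m" "N \<le> n"
        then have mb: "mat_bound G (\<lambda>g. F m g - F n g) d" using N by blast
        show "cmod (convolution G (F m) \<xi> h - convolution G (F n) \<xi> h) < e"
          using cmod_le_ell2_norm[OF diff(1)[OF x mb d] True] diff(2)[OF x mb d] de by simp
      qed
    qed
    then show ?thesis
      unfolding L_def by (intro convergent_LIMSEQ_iff[THEN iffD1] Cauchy_convergent)
  next
    case False
    then show ?thesis
      using convolution_zero_off[OF x(2) False] by (simp add: L_def)
  qed
  have approx: "(\<lambda>h. L \<xi> h - convolution G (F n) \<xi> h) \<in> ell2 G x"
    "ell2_norm G x (\<lambda>h. L \<xi> h - convolution G (F n) \<xi> h) \<le> e * ell2_norm G x \<xi>"
    if x: "x \<in> gunits G" "\<xi> \<in> ell2 G x" and e: "e > 0"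
      and mb: "\<forall>\<^sub>F m in sequentially. mat_bound G (\<lambda>g. F m g - F n g) e" for x \<xi> n e
  proof -
    have off: "L \<xi> h - convolution G (F n) \<xi> h = 0" if "h \<notin> fibre G x" for h
      using convolution_zero_off[OF x(2) that] by (simp add: L_def)
    have bd: "L2_set (\<lambda>h. cmod (L \<xi> h - convolution G (F n) \<xi> h)) E \<le> e * ell2_norm G x \<xi>"
      if E: "finite E" "E \<subseteq> fibre G x" for E
    proof (rule tendsto_upperbound)
      show "(\<lambda>m. L2_set (\<lambda>h. cmod (convolution G (F m) \<xi> h - convolution G (F n) \<xi> h)) E) \<longlonglongrightarrow>
          L2_set (\<lambda>h. cmod (L \<xi> h - convolution G (F n) \<xi> h)) E"
        unfolding L2_set_def by (intro tendsto_intros lim[OF x])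
      show "\<forall>\<^sub>F m in sequentially. L2_set (\<lambda>h. cmod (convolution G (F m) \<xi> h - convolution G (F n) \<xi> h)) E
          \<le> e * ell2_norm G x \<xi>"
        using mb
      proof eventually_elim
        case (elim m)
        show ?case
          using L2_set_le_ell2_norm[OF diff(1)[OF x elim e] E] diff(2)[OF x elim e] by simp
      qed
    qed simp
    have nn: "0 \<le> e * ell2_norm G x \<xi>" using e by (simp add: ell2_norm_nonneg)
    show "(\<lambda>h. L \<xi> h - convolution G (F n) \<xi> h) \<in> ell2 G x"
      "ell2_norm G x (\<lambda>h. L \<xi> h - convolution G (F n) \<xi> h) \<le> e * ell2_norm G x \<xi>"
      using ell2_bounded[OF off nn bd] by auto
  qed
  \<comment> \<open>One approximant at distance at most 1 suffices for boundedness of the limit,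
    with the constant \<open>1 + C\<close>.\<close>
  obtain N where N: "\<forall>m\<ge>N. \<forall>n\<ge>N. mat_bound G (\<lambda>g. F m g - F n g) 1" using Cauchy[of 1] by auto
  then have evN: "\<forall>\<^sub>F m in sequentially. mat_bound G (\<lambda>g. F m g - F N g) 1"
    unfolding eventually_sequentially by blast
  obtain C where C: "0 \<le> C" "mat_bound G (F N) C" and rf: "row_finite G (F N)"
    using cb[of N] by (auto simp: conv_bounded_def)
  have L: "L \<xi> \<in> ell2 G x" "ell2_norm G x (L \<xi>) \<le> (1 + C) * ell2_norm G x \<xi>"
    if x: "x \<in> gunits G" "\<xi> \<in> ell2 G x" for x \<xi>
  proof -
    note a = approx[OF x zero_less_one evN] and b = mat_bound_convolution[OF rf C(2,1) x]
    show "L \<xi> \<in> ell2 G x" "ell2_norm G x (L \<xi>) \<le> (1 + C) * ell2_norm G x \<xi>"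
      using ell2_add[OF a(1) b(1)] a(2) b(2) by (simp_all add: algebra_simps)
  qed
  have lin: "linear_on_ell2 G x L" if x: "x \<in> gunits G" for x
    unfolding linear_on_ell2_def
  proof (intro conjI ballI allI ext)
    show "L \<in> ell2 G x \<rightarrow> ell2 G x" using L(1)[OF x] by blast
  next
    fix \<xi> \<eta> h assume \<xi>: "\<xi> \<in> ell2 G x" and \<eta>: "\<eta> \<in> ell2 G x"
    have "(\<lambda>n. convolution G (F n) (\<lambda>h. \<xi> h + \<eta> h) h) = (\<lambda>n. convolution G (F n) \<xi> h + convolution G (F n) \<eta> h)"
      using convolution_lincomb_right[of G _ 1] cb by (simp add: conv_bounded_def)
    then have "(\<lambda>n. convolution G (F n) (\<lambda>h. \<xi> h + \<eta> h) h) \<longlonglongrightarrow> L \<xi> h + L \<eta> h"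
      using tendsto_add[OF lim[OF x \<xi>] lim[OF x \<eta>]] by simp
    then show "L (\<lambda>h. \<xi> h + \<eta> h) h = L \<xi> h + L \<eta> h"
      using lim[OF x ell2_add(1)[OF \<xi> \<eta>]] LIMSEQ_unique by blast
  next
    fix c \<xi> h assume \<xi>: "\<xi> \<in> ell2 G x"
    have "(\<lambda>n. convolution G (F n) (\<lambda>h. c * \<xi> h) h) = (\<lambda>n. c * convolution G (F n) \<xi> h)"
      using convolution_lincomb_right[of G _ c \<xi> "\<lambda>_. 0"] cb by (simp add: conv_bounded_def convolution_zero_right)
    then have "(\<lambda>n. convolution G (F n) (\<lambda>h. c * \<xi> h) h) \<longlonglongrightarrow> c * L \<xi> h"
      using tendsto_mult_left[OF lim[OF x \<xi>]] by simp
    then show "L (\<lambda>h. c * \<xi> h) h = c * L \<xi> h"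
      using lim[OF x ell2_scale(1)[OF \<xi>]] LIMSEQ_unique by blast
  qed
  define S where "S = restrict (\<lambda>x. restrict L (ell2 G x)) (gunits G)"
  have SPi: "S \<in> (\<Pi>\<^sub>E x\<in>gunits G. bounded_operators G x)"
    using restrict_bounded_operators[OF lin L(2)] by (auto simp: S_def)
  have dist: "\<forall>\<^sub>F n in sequentially. op_dist_le G S (reg_family G (F n)) e" if e: "e > 0" for e
  proof -
    obtain M where M: "\<forall>m\<ge>M. \<forall>n\<ge>M. mat_bound G (\<lambda>g. F m g - F n g) e" using Cauchy[OF e] by blast
    have "op_dist_le G S (reg_family G (F n)) e" if "n \<ge> M" for n
    proof -
      have ev: "\<forall>\<^sub>F m in sequentially. mat_bound G (\<lambda>g. F m g - F n g) e"
        unfolding eventually_sequentially using M that by blast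
      show ?thesis
        unfolding op_dist_le_def using approx(2)[OF _ _ e ev] by (simp add: S_def reg_family_apply)
    qed
    then show ?thesis unfolding eventually_sequentially by blast
  qed
  have linS: "linear_on_ell2 G x (S x)" if "x \<in> gunits G" for x
    using that SPi by (auto intro!: bounded_operators_linear)
  have "\<exists>f\<in>Cc G. family_norm G (S - reg_family G f) < \<epsilon>" if \<epsilon>: "\<epsilon> > 0" for \<epsilon>
  proof -
    obtain e where e: "e > 0" "ennreal e < \<epsilon>" using ennreal_pos_real[OF \<epsilon>] .
    obtain n where "op_dist_le G S (reg_family G (F n)) e"
      using dist[OF e(1)] unfolding eventually_sequentially by blast
    then have "family_norm G (S - reg_family G (F n)) \<le> ennreal e"
      using family_norm_diff_le_iff[of G S, OF linS reg_family_linear[OF cb]] e(1) by simp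
    then show ?thesis using e(2) Cc[of n] by (intro bexI[of _ "F n"]) auto
  qed
  then have "S \<in> Cstar_red G" using SPi by (simp add: Cstar_red_def)
  then show ?thesis using that dist by blast
qed

lemma Cstar_red_eqI:
  assumes S: "S \<in> Cstar_red G" and T: "T \<in> Cstar_red G"
    and dist: "\<And>e. e > 0 \<Longrightarrow> op_dist_le G S T e"
  shows "S = T"
proof (rule PiE_ext)
  show "S \<in> (\<Pi>\<^sub>E x\<in>gunits G. bounded_operators G x)" "T \<in> (\<Pi>\<^sub>E x\<in>gunits G. bounded_operators G x)"
    using S T by (simp_all add: Cstar_red_def)
  fix x assume x: "x \<in> gunits G"
  show "S x = T x"
  proof (rule PiE_ext)
    show "S x \<in> ell2 G x \<rightarrow>\<^sub>E ell2 G x" "T x \<in> ell2 G x \<rightarrow>\<^sub>E ell2 G x"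
      using S T x by (auto simp: Cstar_red_def bounded_operators_def)
    fix \<xi> assume \<xi>: "\<xi> \<in> ell2 G x"
    note ell = linear_on_ell2_in[OF Cstar_red_linear[OF S x] \<xi>] linear_on_ell2_in[OF Cstar_red_linear[OF T x] \<xi>]
    have "ell2_norm G x (\<lambda>h. S x \<xi> h - T x \<xi> h) \<le> 0"
    proof (rule field_le_epsilon)
      fix e :: real assume e: "e > 0"
      define d where "d = e / (ell2_norm G x \<xi> + 1)"
      have d: "d > 0" using e ell2_norm_nonneg[of G x \<xi>] by (simp add: d_def add_nonneg_pos)
      have "d * ell2_norm G x \<xi> \<le> e"
        using e ell2_norm_nonneg[of G x \<xi>] by (simp add: d_def field_simps add_nonneg_pos)
      then show "ell2_norm G x (\<lambda>h. S x \<xi> h - T x \<xi> h) \<le> 0 + e"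
        using dist[OF d] x \<xi> unfolding op_dist_le_def by fastforce
    qed
    then have "cmod (S x \<xi> h - T x \<xi> h) \<le> 0" if "h \<in> fibre G x" for h
      using cmod_le_ell2_norm[OF ell2_diff(1)[OF ell] that] by linarith
    then show "S x \<xi> = T x \<xi>"
      using ell2_zero_off[OF ell(1)] ell2_zero_off[OF ell(2)] by (metis eq_iff_diff_eq_0 ext norm_le_zero_iff)
  qed
qed

section \<open>The extension of the map to the completions\<close>

context etale_groupoid
begin

text \<open>Justifies the definite description. An approximating sequence of \<open>T\<close> has a
  Cauchy image because \<open>cover_map\<close> preserves bounds on blocks; comparing two sequences
  through \<open>T\<close> shows that the limit does not depend on the choice. Since
  \<open>T\<close> has an approximating sequence, the limit is unique.\<close>

lemma Cstar_cover_map_spec: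
  assumes T: "T \<in> Cstar_red G"
  shows "Cstar_cover_map G T \<in> Cstar_red H"
    and "\<And>f. (\<And>n. f n \<in> Cc G) \<Longrightarrow> (\<lambda>n. family_norm G (T - reg_family G (f n))) \<longlonglongrightarrow> 0 \<Longrightarrow>
      (\<lambda>n. family_norm H (Cstar_cover_map G T - reg_family H (cover_map G (f n)))) \<longlonglongrightarrow> 0"
proof -
  define P where "P S \<longleftrightarrow> S \<in> Cstar_red H \<and>
        (\<forall>f :: nat \<Rightarrow> 'g \<Rightarrow> complex.
           (\<forall>n. f n \<in> Cc G) \<and> (\<lambda>n. family_norm G (T - reg_family G (f n))) \<longlonglongrightarrow> 0 \<longrightarrow>
           (\<lambda>n. family_norm H (S - reg_family H (cover_map G (f n)))) \<longlonglongrightarrow> 0)" for S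
  obtain f where f: "\<And>n. f n \<in> Cc G" and f0: "(\<lambda>n. family_norm G (T - reg_family G (f n))) \<longlonglongrightarrow> 0"
    using Cstar_red_sequence[OF T] by blast
  have close: "mat_bound H (\<lambda>A. cover_map G p A - cover_map G q A) e"
    if p: "p \<in> Cc G" and q: "q \<in> Cc G" and e: "e > 0" and
      d: "op_dist_le G T (reg_family G p) (e/2)" "op_dist_le G T (reg_family G q) (e/2)" for p q e
  proof -
    have "op_dist_le G (reg_family G p) (reg_family G q) (e/2 + e/2)"
      by (rule op_dist_le_trans[OF reg_family_linear Cstar_red_linear[OF T] reg_family_linear
            op_dist_le_sym[OF d(1)] d(2)]) (use conv_bounded_Cc p q in auto)
    then have "mat_bound G (\<lambda>g. p g - q g) e"
      using op_dist_le_reg_family_iff[OF conv_bounded_Cc[OF p] conv_bounded_Cc[OF q]] e by simp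
    then have "mat_bound H (cover_map G (\<lambda>g. p g - q g)) e"
      by (rule mat_bound_cover_map[OF Cc_diff[OF p q]])
    moreover have "cover_map G (\<lambda>g. p g - q g) = (\<lambda>A. cover_map G p A - cover_map G q A)"
      using cover_map_diff[OF p q] by blast
    ultimately show ?thesis by simp
  qed
  have distf: "\<forall>\<^sub>F n in sequentially. op_dist_le G T (reg_family G (f n)) e" if "e > 0" for e
    using f0 that family_norm_tendsto_0_iff[OF T conv_bounded_Cc[OF f]] by simp
  have "\<exists>N. \<forall>m\<ge>N. \<forall>n\<ge>N. mat_bound H (\<lambda>A. cover_map G (f m) A - cover_map G (f n) A) e" if e: "e > 0" for e
  proof -
    obtain N where "\<forall>n\<ge>N. op_dist_le G T (reg_family G (f n)) (e/2)"
      using distf[of "e/2"] e unfolding eventually_sequentially by auto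
    then show ?thesis using close[OF f f e] by blast
  qed
  then obtain S where S: "S \<in> Cstar_red H"
    "\<And>e. e > 0 \<Longrightarrow> \<forall>\<^sub>F n in sequentially. op_dist_le H S (reg_family H (cover_map G (f n))) e"
    using Cstar_red_complete[where F = "\<lambda>n. cover_map G (f n)" and G = H, OF cover_map_Cc[OF f]
        conv_bounded_cover_map[OF f]] by blast
  have "P S"
    unfolding P_def
  proof (intro conjI allI impI S(1), elim conjE)
    fix k assume k: "\<forall>n. k n \<in> Cc G" and k0: "(\<lambda>n. family_norm G (T - reg_family G (k n))) \<longlonglongrightarrow> 0"
    have kC: "k n \<in> Cc G" for n using k by blast
    have distk: "\<forall>\<^sub>F n in sequentially. op_dist_le G T (reg_family G (k n)) e" if "e > 0" for e
      using k0 that family_norm_tendsto_0_iff[OF T conv_bounded_Cc[OF kC]] by simp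
    show "(\<lambda>n. family_norm H (S - reg_family H (cover_map G (k n)))) \<longlonglongrightarrow> 0"
      unfolding family_norm_tendsto_0_iff[OF S(1) conv_bounded_cover_map[OF kC]]
    proof (intro allI impI)
      fix e :: real assume e: "e > 0"
      \<comment> \<open>One half of \<open>e\<close> is spent on the distance from \<open>S\<close>
        to the image of \<open>f n\<close>. The other half bounds the distance between the images of
        \<open>f n\<close> and \<open>k n\<close>, each of which is within \<open>e/4\<close> of
        \<open>T\<close> before transfer.\<close>
      have "e/2 > 0" "e/2/2 > 0" using e by auto
      from S(2)[OF this(1)] distf[OF this(2)] distk[OF this(2)]
      show "\<forall>\<^sub>F n in sequentially. op_dist_le H S (reg_family H (cover_map G (k n))) e"
      proof eventually_elim
        case (elim n)
        have "mat_bound H (\<lambda>A. cover_map G (f n) A - cover_map G (k n) A) (e/2)"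
          by (rule close[OF f kC _ elim(2,3)]) (use e in simp)
        then have fk: "op_dist_le H (reg_family H (cover_map G (f n))) (reg_family H (cover_map G (k n))) (e/2)"
          using op_dist_le_reg_family_iff[OF conv_bounded_cover_map[OF f] conv_bounded_cover_map[OF kC]] e by simp
        have "op_dist_le H S (reg_family H (cover_map G (k n))) (e/2 + e/2)"
          by (rule op_dist_le_trans[OF Cstar_red_linear[OF S(1)] reg_family_linear reg_family_linear elim(1) fk])
            (use conv_bounded_cover_map f kC in auto)
        then show ?case by simp
      qed
    qed
  qed
  moreover have "S' = S" if "P S'" for S'
  proof (rule Cstar_red_eqI)
    show S': "S' \<in> Cstar_red H" "S \<in> Cstar_red H" using that S(1) by (simp_all add: P_def)
    fix e :: real assume e: "e > 0"
    have "(\<lambda>n. family_norm H (S' - reg_family H (cover_map G (f n)))) \<longlonglongrightarrow> 0"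
      using that f f0 unfolding P_def by blast
    then have "\<forall>\<^sub>F n in sequentially. op_dist_le H S' (reg_family H (cover_map G (f n))) (e/2)"
      using family_norm_tendsto_0_iff[OF S'(1) conv_bounded_cover_map[OF f]] e by simp
    moreover have "\<forall>\<^sub>F n in sequentially. op_dist_le H S (reg_family H (cover_map G (f n))) (e/2)"
      using S(2)[of "e/2"] e by simp
    ultimately have "\<forall>\<^sub>F n in sequentially. op_dist_le H S' S (e/2 + e/2)"
    proof eventually_elim
      case (elim n)
      show ?case
        by (rule op_dist_le_trans[OF Cstar_red_linear[OF S'(1)] reg_family_linear Cstar_red_linear[OF S(1)]
              elim(1) op_dist_le_sym[OF elim(2)]]) (use conv_bounded_cover_map f in auto)
    qed
    then show "op_dist_le H S' S e" by simp
  qed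
  ultimately have "P (THE S. P S)"
    by (rule theI)
  then have "P (Cstar_cover_map G T)"
    unfolding Cstar_cover_map_def P_def .
  then show "Cstar_cover_map G T \<in> Cstar_red H"
    and "\<And>f. (\<And>n. f n \<in> Cc G) \<Longrightarrow> (\<lambda>n. family_norm G (T - reg_family G (f n))) \<longlonglongrightarrow> 0 \<Longrightarrow>
      (\<lambda>n. family_norm H (Cstar_cover_map G T - reg_family H (cover_map G (f n)))) \<longlonglongrightarrow> 0"
    unfolding P_def by blast+
qed

end

section \<open>Elements of the reduced C*-algebras as functions\<close>

lemma as_function_reg_family:
  assumes g: "g \<in> arrows G" and x: "gsrc G g \<in> fibre G (gsrc G g)" "gsrc G g \<in> gunits G"
    and eq: "gmul G g (ginv G (gsrc G g)) = g"
  shows "as_function G (reg_family G f) g = f g"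
proof -
  let ?x = "gsrc G g"
  have "convolution G f (delta ?x) g = (\<Sum>h\<in>{?x}. f (gmul G g (ginv G h)) * delta ?x h)"
    using g x(1) by (intro convolution_eq_sum) (auto simp: delta_def split: if_splits)
  then have "convolution G f (delta ?x) g = f g"
    by (simp add: eq delta_def)
  moreover have "g \<in> fibre G ?x" using g by (simp add: fibre_def)
  ultimately show ?thesis
    using delta_ell2(1)[OF x(1)] x(2) by (simp add: as_function_def ell2_inner_delta reg_family_apply)
qed

context etale_groupoid
begin

lemma as_function_approx:
  assumes T: "T \<in> Cstar_red G" and f: "f \<in> Cc G" and d: "op_dist_le G T (reg_family G f) e" "0 \<le> e"
    and g: "g \<in> arrows G"
  shows "cmod (as_function G T g - f g) \<le> e"
proof -
  have x: "gsrc G g \<in> fibre G (gsrc G g)" "gsrc G g \<in> gunits G"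
    using g by (simp_all add: fibre_def src_arrow src_src src_in)
  have "gmul G g (ginv G (gsrc G g)) = g"
    using g by (simp add: unit_inv src_in mul_src)
  then have "as_function G (reg_family G f) g = f g"
    by (rule as_function_reg_family[OF g x])
  then show ?thesis
    using as_function_diff_le[OF g x Cstar_red_linear[OF T x(2)] reg_family_linear[OF conv_bounded_Cc[OF f] x(2)] d]
    by simp
qed

lemma as_function_cover_approx:
  assumes S: "S \<in> Cstar_red H" and f: "f \<in> Cc G"
    and d: "op_dist_le H S (reg_family H (cover_map G f)) e" "0 \<le> e"
    and A: "A \<in> arrows H"
  shows "cmod (as_function H S A - cover_map G f A) \<le> e"
proof -
  have x: "gsrc H A \<in> fibre H (gsrc H A)" "gsrc H A \<in> gunits H"
    using A cover_src_in[OF A] by (simp_all add: fibre_def cover_src_arrow cover_src_unit)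
  have "as_function H (reg_family H (cover_map G f)) A = cover_map G f A"
    by (rule as_function_reg_family[OF A x cover_mul_inv_src[OF A]])
  then show ?thesis
    using as_function_diff_le[OF A x Cstar_red_linear[OF S x(2)]
        reg_family_linear[OF conv_bounded_cover_map[OF f] x(2)] d]
    by simp
qed

text \<open>Both functions are uniform limits, of \<open>f n\<close> and of
  \<open>cover_map G (f n)\<close>, and for these the convergence is
  \<open>tendsto_cover_map\<close>. The three errors of size \<open>e/3\<close> are two
  approximations and one limit.\<close>

lemma tendsto_as_function:
  assumes T: "T \<in> Cstar_red G" and Z: "Z \<in> arrows H"
  shows "(as_function G T \<longlongrightarrow> as_function H (Cstar_cover_map G T) Z) (near Z)"
proof (rule tendstoI)
  fix e :: real assume e: "e > 0"
  let ?S = "Cstar_cover_map G T"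
  note spec = Cstar_cover_map_spec[OF T]
  obtain f where f: "\<And>n. f n \<in> Cc G" and f0: "(\<lambda>n. family_norm G (T - reg_family G (f n))) \<longlonglongrightarrow> 0"
    using Cstar_red_sequence[OF T] by blast
  have "\<forall>\<^sub>F n in sequentially. op_dist_le G T (reg_family G (f n)) (e/3)"
    using f0 family_norm_tendsto_0_iff[OF T conv_bounded_Cc[OF f]] e by simp
  moreover have "\<forall>\<^sub>F n in sequentially. op_dist_le H ?S (reg_family H (cover_map G (f n))) (e/3)"
    using spec(2)[OF f f0] family_norm_tendsto_0_iff[OF spec(1) conv_bounded_cover_map[OF f]] e by simp
  ultimately have "\<forall>\<^sub>F n in sequentially. op_dist_le G T (reg_family G (f n)) (e/3) \<and>
      op_dist_le H ?S (reg_family H (cover_map G (f n))) (e/3)"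
    by (rule eventually_conj)
  then obtain n where n: "op_dist_le G T (reg_family G (f n)) (e/3)"
      "op_dist_le H ?S (reg_family H (cover_map G (f n))) (e/3)"
    unfolding eventually_sequentially by blast
  have S: "cmod (as_function H ?S Z - cover_map G (f n) Z) \<le> e/3"
    using as_function_cover_approx[OF spec(1) f n(2) _ Z] e by simp
  have "\<forall>\<^sub>F z in near Z. dist (f n z) (cover_map G (f n) Z) < e/3"
    by (rule tendstoD[OF tendsto_cover_map[OF f Z]]) (use e in simp)
  then show "\<forall>\<^sub>F z in near Z. dist (as_function G T z) (as_function H ?S Z) < e"
    using eventually_fell_filter_topspace[of "gtop G" Z]
  proof eventually_elim
    case (elim z)
    have "dist (as_function G T z) (f n z) \<le> e/3"
      using as_function_approx[OF T f n(1) _ elim(2)] e by (simp add: dist_norm)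
    moreover have "dist (cover_map G (f n) Z) (as_function H ?S Z) \<le> e/3"
      using S by (simp add: dist_norm norm_minus_commute)
    moreover have "dist (as_function G T z) (as_function H ?S Z)
        \<le> dist (as_function G T z) (f n z) + (dist (f n z) (cover_map G (f n) Z)
          + dist (cover_map G (f n) Z) (as_function H ?S Z))"
      by (intro order_trans[OF dist_triangle add_left_mono] dist_triangle)
    ultimately show ?case using elim(1) by linarith
  qed
qed

text \<open>What holds eventually near \<open>{g}\<close> holds at \<open>g\<close> itself, so the
  limit along this filter must be the value at \<open>g\<close>.\<close>

lemma as_function_singleton:
  assumes T: "T \<in> Cstar_red G" and g: "g \<in> arrows G"
  shows "as_function H (Cstar_cover_map G T) {g} = as_function G T g"
proof -
  have "dist (as_function G T g) (as_function H (Cstar_cover_map G T) {g}) < e" if "e > 0" for e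
    by (rule eventually_near_singleton[OF g tendstoD[OF tendsto_as_function[OF T singleton_cover_arrow[OF g]] that]])
  then show ?thesis
    by (metis dist_self less_irrefl zero_less_dist_iff)
qed

section \<open>Non-Hausdorff units\<close>

text \<open>Inseparable arrows have the same range and source because the units are Hausdorff. The
  product \<open>h\<close> of the inverse of \<open>g\<close> with \<open>k\<close> is then an
  isotropy arrow and not a unit. An arrow \<open>z\<close> close to both \<open>g\<close> and
  \<open>k\<close> yields the unit \<open>z\<^sup>-\<^sup>1 z\<close> close to \<open>h\<close>, so
  \<open>h\<close> is in the closure of the units.\<close>

lemma inseparable_imp_nonHausdorff_src:
  assumes a: "k \<in> arrows G" "g \<in> arrows G" and ne: "k \<noteq> g"
    and ins: "\<And>W V. openin (gtop G) W \<Longrightarrow> openin (gtop G) V \<Longrightarrow> k \<in> W \<Longrightarrow> g \<in> V \<Longrightarrow> W \<inter> V \<noteq> {}"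
  shows "gsrc G g \<in> nonHausdorff_units G"
proof -
  have r: "grng G k = grng G g"
  proof (rule ccontr)
    assume "grng G k \<noteq> grng G g"
    then obtain A B where AB: "openin (gtop G) A" "openin (gtop G) B" "grng G k \<in> A" "grng G g \<in> B" "A \<inter> B = {}"
      using units_separate[OF rng_in[OF a(1)] rng_in[OF a(2)]] by blast
    show False
      using ins[OF openin_rng_preimage[OF AB(1)] openin_rng_preimage[OF AB(2)]] a AB by auto
  qed
  have s: "gsrc G k = gsrc G g"
  proof (rule ccontr)
    assume "gsrc G k \<noteq> gsrc G g"
    then obtain A B where AB: "openin (gtop G) A" "openin (gtop G) B" "gsrc G k \<in> A" "gsrc G g \<in> B" "A \<inter> B = {}"
      using units_separate[OF src_in[OF a(1)] src_in[OF a(2)]] by blast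
    show False
      using ins[OF openin_src_preimage[OF AB(1)] openin_src_preimage[OF AB(2)]] a AB by auto
  qed
  define h where "h = gmul G (ginv G g) k"
  have h: "h \<in> arrows G" "gsrc G h = gsrc G g" "grng G h = gsrc G g"
    using a r s by (simp_all add: h_def mul_in src_mul rng_mul inv_in src_inv rng_inv)
  have gh: "gmul G g h = k"
    unfolding h_def by (rule mul_inv_cancel_left) (use a r in auto)
  have "h \<notin> gunits G"
  proof
    assume "h \<in> gunits G"
    then have "h = gsrc G g" using h by (simp add: src_unit)
    then show False using gh ne mul_src[OF a(2)] by simp
  qed
  moreover have "h \<in> gtop G closure_of gunits G"
    unfolding in_closure_of
  proof (intro conjI allI impI h(1))
    fix W assume W: "h \<in> W \<and> openin (gtop G) W"
    have comp: "gsrc G (ginv G g) = grng G k" using a r by (simp add: src_inv)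
    obtain A B where AB: "openin (gtop G) A" "openin (gtop G) B" "ginv G g \<in> A" "k \<in> B"
      "\<And>u v. u \<in> A \<Longrightarrow> v \<in> B \<Longrightarrow> gsrc G u = grng G v \<Longrightarrow> gmul G u v \<in> W"
      using mul_neighbourhood[OF inv_in[OF a(2)] a(1) comp, of W] W unfolding h_def by metis
    have "B \<inter> {z \<in> arrows G. ginv G z \<in> A} \<noteq> {}"
      using AB a by (intro ins openin_inv_preimage) auto
    then obtain z where z: "z \<in> B" "z \<in> arrows G" "ginv G z \<in> A" by blast
    have "gmul G (ginv G z) z \<in> W" by (rule AB(5)[OF z(3,1)]) (simp add: src_inv z)
    then show "\<exists>y. y \<in> gunits G \<and> y \<in> W"
      using z(2) by (intro exI[of _ "gsrc G z"]) (simp add: mul_inv_left src_in)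
  qed
  ultimately show ?thesis
    unfolding nonHausdorff_units_def using h(2) by (metis DiffI imageI)
qed

lemma inseparable_imp_nonHausdorff:
  assumes a: "k \<in> arrows G" "g \<in> arrows G" and ne: "k \<noteq> g"
    and ins: "\<And>W V. openin (gtop G) W \<Longrightarrow> openin (gtop G) V \<Longrightarrow> k \<in> W \<Longrightarrow> g \<in> V \<Longrightarrow> W \<inter> V \<noteq> {}"
  shows "gsrc G g \<in> nonHausdorff_units G" "grng G g \<in> nonHausdorff_units G"
proof -
  show "gsrc G g \<in> nonHausdorff_units G"
    by (rule inseparable_imp_nonHausdorff_src[OF a ne ins])
  have "gsrc G (ginv G g) \<in> nonHausdorff_units G"
  proof (rule inseparable_imp_nonHausdorff_src[OF inv_in[OF a(1)] inv_in[OF a(2)]])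
    show "ginv G k \<noteq> ginv G g" using a ne inv_inv by metis
    fix W V assume "openin (gtop G) W" "openin (gtop G) V" "ginv G k \<in> W" "ginv G g \<in> V"
    then have "{z \<in> arrows G. ginv G z \<in> W} \<inter> {z \<in> arrows G. ginv G z \<in> V} \<noteq> {}"
      using a by (intro ins openin_inv_preimage) auto
    then show "W \<inter> V \<noteq> {}" by blast
  qed
  then show "grng G g \<in> nonHausdorff_units G" using a by (simp add: src_inv)
qed

text \<open>The usual separation of a point from a compact set, which only uses that this one point
  can be separated from each point of \<open>K\<close>. If either end of \<open>g\<close> is outside
  \<open>D\<close>, no arrow is inseparable from \<open>g\<close>.\<close>

lemma compact_separate:
  assumes g: "g \<in> arrows G" and K: "compactin (gtop G) K" "g \<notin> K"
    and D: "\<not> (gsrc G g \<in> nonHausdorff_units G \<and> grng G g \<in> nonHausdorff_units G)"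
  obtains V where "openin (gtop G) V" "g \<in> V" "V \<inter> K = {}"
proof -
  have "\<exists>W V. openin (gtop G) W \<and> openin (gtop G) V \<and> k \<in> W \<and> g \<in> V \<and> W \<inter> V = {}" if k: "k \<in> K" for k
  proof (rule ccontr)
    assume *: "\<not> ?thesis"
    have "k \<in> arrows G" "k \<noteq> g" using k K compactin_subset_topspace by blast+
    then show False using inseparable_imp_nonHausdorff[of k g] g D * by blast
  qed
  then obtain W V where WV: "\<And>k. k \<in> K \<Longrightarrow> openin (gtop G) (W k)" "\<And>k. k \<in> K \<Longrightarrow> openin (gtop G) (V k)"
    "\<And>k. k \<in> K \<Longrightarrow> k \<in> W k" "\<And>k. k \<in> K \<Longrightarrow> g \<in> V k" "\<And>k. k \<in> K \<Longrightarrow> W k \<inter> V k = {}"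
    by metis
  have "\<exists>\<F>. finite \<F> \<and> \<F> \<subseteq> W ` K \<and> K \<subseteq> \<Union>\<F>"
    by (rule compactinD[OF K(1)]) (use WV in auto)
  then obtain \<F> where "finite \<F>" "\<F> \<subseteq> W ` K" "K \<subseteq> \<Union>\<F>" by blast
  moreover from calculation(1,2) obtain F where F: "F \<subseteq> K" "finite F" "\<F> = W ` F"
    using finite_subset_image by metis
  ultimately have cov: "K \<subseteq> (\<Union>k\<in>F. W k)" by simp
  define N where "N = \<Inter>(insert (arrows G) (V ` F))"
  have "openin (gtop G) N"
    unfolding N_def by (rule openin_Inter) (use F WV in auto)
  moreover have "g \<in> N" using g F WV by (auto simp: N_def)
  moreover have "N \<inter> K = {}"
  proof (rule equals0I)
    fix z assume "z \<in> N \<inter> K"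
    then obtain k where k: "k \<in> F" "z \<in> W k" "z \<in> N" using cov by blast
    then have "z \<in> V k" by (simp add: N_def)
    then show False using WV(5)[of k] k F by blast
  qed
  ultimately show ?thesis using that by blast
qed

text \<open>Continuity of \<open>g \<mapsto> {g}\<close> away from \<open>D\<close>: the compact set
  that a Fell neighbourhood excludes is already avoided by an ordinary neighbourhood of
  \<open>g\<close>.\<close>

lemma eventually_near_singleton_nhd:
  assumes g: "g \<in> arrows G" and D: "\<not> (gsrc G g \<in> nonHausdorff_units G \<and> grng G g \<in> nonHausdorff_units G)"
    and P: "eventually P (near {g})"
  obtains V where "openin (gtop G) V" "g \<in> V" "\<And>z. z \<in> V \<Longrightarrow> P z"
proof -
  obtain \<U> K where UK': "finite \<U>" "\<forall>U\<in>\<U>. openin (gtop G) U \<and> {g} \<inter> U \<noteq> {}"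
    "compactin (gtop G) K" "{g} \<inter> K = {}" "\<forall>z\<in>arrows G. (\<forall>U\<in>\<U>. z \<in> U) \<and> z \<notin> K \<longrightarrow> P z"
    using P unfolding eventually_fell_filter by metis
  then have UK: "finite \<U>" "\<And>U. U \<in> \<U> \<Longrightarrow> openin (gtop G) U" "\<And>U. U \<in> \<U> \<Longrightarrow> g \<in> U"
    "compactin (gtop G) K" "g \<notin> K" "\<And>z. z \<in> arrows G \<Longrightarrow> (\<forall>U\<in>\<U>. z \<in> U) \<Longrightarrow> z \<notin> K \<Longrightarrow> P z"
    by auto
  obtain V where V: "openin (gtop G) V" "g \<in> V" "V \<inter> K = {}"
    using compact_separate[OF g UK(4,5) D] .
  define N where "N = \<Inter>(insert V \<U>)"
  have "openin (gtop G) N"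
    unfolding N_def by (rule openin_Inter) (use UK V in auto)
  moreover have "g \<in> N" using UK V by (auto simp: N_def)
  moreover have "P z" if z: "z \<in> N" for z
  proof (rule UK(6))
    show "z \<in> arrows G" using z openin_subset[OF V(1)] by (auto simp: N_def)
    show "\<forall>U\<in>\<U>. z \<in> U" using z by (simp add: N_def)
    show "z \<notin> K" using z V(3) by (auto simp: N_def)
  qed
  ultimately show ?thesis using that by blast
qed

text \<open>If one end of \<open>g\<close> were outside \<open>D\<close>, nonvanishing at
  \<open>g\<close> would spread to a neighbourhood, whose source is open. Although the ideal is
  defined by sources only, the range is constrained as well, and this gives the range half on the
  cover.\<close>

lemma singular_ideal_supp:
  assumes T: "T \<in> singular_ideal G" and g: "g \<in> arrows G" "as_function G T g \<noteq> 0"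
  shows "gsrc G g \<in> nonHausdorff_units G \<and> grng G g \<in> nonHausdorff_units G"
proof (rule ccontr)
  assume D: "\<not> ?thesis"
  have TC: "T \<in> Cstar_red G" using T by (simp add: singular_ideal_def)
  have "\<forall>\<^sub>F z in near {g}. as_function G T z \<noteq> 0"
    using tendsto_imp_eventually_ne[OF tendsto_as_function[OF TC singleton_cover_arrow[OF g(1)]], of 0]
      as_function_singleton[OF TC g(1)] g(2) by simp
  then obtain V where V: "openin (gtop G) V" "g \<in> V" "\<And>z. z \<in> V \<Longrightarrow> as_function G T z \<noteq> 0"
    using eventually_near_singleton_nhd[OF g(1) D] by blast
  have "V \<subseteq> open_supp G T"
    using V openin_subset[OF V(1)] by (auto simp: open_supp_def)
  then have "gsrc G ` V \<subseteq> gsrc G ` open_supp G T" by blast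
  moreover have "openin (unit_top G) (gsrc G ` V)"
    using openin_src_image[OF V(1)] openin_subset[OF V(1)] by (auto simp: openin_unit_top_iff src_in)
  ultimately have "gsrc G g \<in> unit_top G interior_of (gsrc G ` open_supp G T)"
    using V(2) unfolding interior_of_def by blast
  then show False using T by (simp add: singular_ideal_def)
qed

text \<open>Any second element of \<open>B\<close> would be a non-unit in the closure of the units,
  and its source would put the base point into \<open>D\<close>.\<close>

lemma cover_unit_singleton:
  assumes B: "B \<in> gunits H" and D: "cover_proj G B \<notin> nonHausdorff_units G"
  shows "B = {cover_proj G B}" "cover_proj G B \<in> gunits G"
proof -
  note BA = cover_unit_arrow[OF B]
  obtain y where y: "y \<in> gunits G" "y \<in> B" "\<And>k. k \<in> B \<Longrightarrow> gsrc G k = y"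
    using cover_unit_obtain[OF B] by metis
  have py: "cover_proj G B = y" using cover_proj_eq[OF B y(2)] y(3)[OF y(2)] by simp
  have "k = y" if k: "k \<in> B" for k
  proof (rule ccontr)
    assume ne: "k \<noteq> y"
    have "k \<notin> gunits G" using ne y(3)[OF k] src_unit by auto
    moreover have "k \<in> gtop G closure_of gunits G"
      unfolding in_closure_of
    proof (intro conjI allI impI)
      show "k \<in> arrows G" by (rule cover_elem_arrow[OF BA k])
      fix W assume W: "k \<in> W \<and> openin (gtop G) W"
      then have "\<forall>\<^sub>F z in near B. z \<in> W"
        using k by (intro eventually_fell_filter_open) auto
      moreover have "\<exists>\<^sub>F z in near B. z \<in> gunits G" using B by (simp add: cover_unit_iff)
      ultimately show "\<exists>y. y \<in> gunits G \<and> y \<in> W"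
        using frequently_ex[OF frequently_eventually_conj] by blast
    qed
    ultimately have "y \<in> nonHausdorff_units G"
      unfolding nonHausdorff_units_def using y(3)[OF k] by (metis DiffI imageI)
    then show False using D py by simp
  qed
  then show "B = {cover_proj G B}" using y(2) py by blast
  show "cover_proj G B \<in> gunits G" using y(1) py by simp
qed

text \<open>If all unit singletons near \<open>X\<close> lay over \<open>D\<close>, the Fell
  conditions that express this would define an open set \<open>N\<close> of units of the cover. An
  element of \<open>N\<close> over a point outside \<open>D\<close> is itself a singleton and
  satisfies the same conditions, a contradiction; so \<open>N\<close> would put \<open>X\<close>
  into the singular part.\<close>

lemma not_singular_imp_frequently:
  assumes X: "X \<in> gunits H" and nX: "X \<notin> cover_units_sing G"
  shows "\<exists>\<^sub>F z in near_units X. z \<notin> nonHausdorff_units G"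
  unfolding frequently_def
proof
  assume "\<forall>\<^sub>F z in near_units X. \<not> z \<notin> nonHausdorff_units G"
  then have "\<forall>\<^sub>F z in near X. z \<in> gunits G \<longrightarrow> z \<in> nonHausdorff_units G"
    by (simp add: eventually_inf_principal)
  then obtain \<U> K where UK: "finite \<U>" "\<And>U. U \<in> \<U> \<Longrightarrow> openin (gtop G) U" "\<And>U. U \<in> \<U> \<Longrightarrow> X \<inter> U \<noteq> {}"
    "compactin (gtop G) K" "X \<inter> K = {}"
    "\<And>z. z \<in> arrows G \<Longrightarrow> (\<forall>U\<in>\<U>. z \<in> U) \<Longrightarrow> z \<notin> K \<Longrightarrow> z \<in> gunits G \<Longrightarrow> z \<in> nonHausdorff_units G"
    unfolding eventually_fell_filter by metis
  define N where "N = gunits H \<inter> \<Inter>(insert {A \<in> arrows H. A \<inter> K = {}} ((\<lambda>U. {A \<in> arrows H. A \<inter> U \<noteq> {}}) ` \<U>))"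
  have "openin (unit_top H) N"
    unfolding N_def
  proof (intro openin_subtopology_Int2 openin_Inter)
    fix W assume "W \<in> insert {A \<in> arrows H. A \<inter> K = {}} ((\<lambda>U. {A \<in> arrows H. A \<inter> U \<noteq> {}}) ` \<U>)"
    then show "openin (gtop H) W"
      using openin_cover_misses[OF UK(4)] openin_cover_meets[OF UK(2)] by auto
  qed (use UK in auto)
  moreover have "X \<in> N" using X cover_unit_arrow[OF X] UK by (auto simp: N_def)
  moreover have "cover_proj G B \<in> nonHausdorff_units G" if B: "B \<in> N" for B
  proof (rule ccontr)
    assume D: "cover_proj G B \<notin> nonHausdorff_units G"
    have BX: "B \<in> gunits H" using B by (simp add: N_def)
    obtain y where y: "y \<in> gunits G" "B = {y}" "y = cover_proj G B"
      using cover_unit_singleton[OF BX D] by blast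
    have "y \<in> nonHausdorff_units G"
    proof (rule UK(6))
      show "y \<in> arrows G" "y \<in> gunits G" using y(1) unit_arrow by auto
      have "{y} \<inter> K = {}" using B unfolding N_def y(2) by simp
      then show "y \<notin> K" by blast
      show "\<forall>U\<in>\<U>. y \<in> U"
      proof
        fix U assume "U \<in> \<U>"
        then have "{y} \<inter> U \<noteq> {}" using B unfolding N_def y(2) by simp
        then show "y \<in> U" by blast
      qed
    qed
    then show False using D y(3) by simp
  qed
  ultimately have "X \<in> cover_units_sing G"
    unfolding cover_units_sing_def interior_of_def by (auto simp: N_def)
  then show False using nX by simp
qed

text \<open>The section through \<open>A\<close> sends units close to the source to arrows
  satisfying \<open>P\<close>, whose sources are those units. Hence all of them lie in
  \<open>D\<close>. The predicate is abstract so that composition with inversion yields the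
  statement on ranges.\<close>

lemma src_cover_units_sing:
  assumes A: "A \<in> arrows H"
    and D: "\<And>g. g \<in> arrows G \<Longrightarrow> P g \<Longrightarrow> gsrc G g \<in> nonHausdorff_units G"
    and P: "eventually P (near A)"
  shows "gsrc H A \<in> cover_units_sing G"
proof (rule ccontr)
  assume "gsrc H A \<notin> cover_units_sing G"
  then have fr: "\<exists>\<^sub>F z in near_units (gsrc H A). z \<notin> nonHausdorff_units G"
    by (rule not_singular_imp_frequently[OF cover_src_in[OF A]])
  obtain g where g: "g \<in> A" using cover_nonempty[OF A] by blast
  obtain U where U: "open_bisection G U" "g \<in> U"
    using bisection_at[OF openin_topspace cover_elem_arrow[OF A g]] by metis
  have "\<forall>\<^sub>F z in near_units (gsrc H A). P (src_section G U z)"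
    using filterlim_src_section[OF A g U] P by (auto simp: filterlim_iff)
  then have "\<forall>\<^sub>F z in near_units (gsrc H A). z \<in> nonHausdorff_units G"
    using eventually_src_section[OF A g U]
  proof eventually_elim
    case (elim z)
    then show ?case
      using D[OF bisection_arrows[OF U(1)], of "src_section G U z"] by simp
  qed
  then show False using fr by (simp add: frequently_def)
qed

lemma singular_ideal_cover:
  assumes T: "T \<in> singular_ideal G"
  shows "Cstar_cover_map G T \<in> cover_singular_ideal G"
proof -
  have TC: "T \<in> Cstar_red G" using T by (simp add: singular_ideal_def)
  have "gsrc H A \<in> cover_units_sing G \<and> grng H A \<in> cover_units_sing G"
    if A: "A \<in> arrows H" and nz: "as_function H (Cstar_cover_map G T) A \<noteq> 0" for A
  proof
    have ne: "\<forall>\<^sub>F z in near A. as_function G T z \<noteq> 0"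
      using tendsto_imp_eventually_ne[OF tendsto_as_function[OF TC A] nz] .
    show "gsrc H A \<in> cover_units_sing G"
      by (rule src_cover_units_sing[OF A _ ne]) (use singular_ideal_supp[OF T] in simp)
    \<comment> \<open>The range of \<open>A\<close> is the source of its inverse. Nonvanishing of
      \<open>T\<close> near \<open>A\<close> becomes nonvanishing at inverse arrows near the inverse
      of \<open>A\<close>.\<close>
    have sub: "A \<subseteq> arrows G" using cover_elem_arrow[OF A] by blast
    have "ginv G ` A \<subseteq> arrows G" using cover_elem_arrow[OF cover_inv_arrow[OF A]] by blast
    from filterlim_near_inv[OF this] have "filterlim (ginv G) (near A) (near (ginv G ` A))"
      unfolding inv_inv_image[OF sub] .
    then have ev: "\<forall>\<^sub>F z in near (ginv G ` A). as_function G T (ginv G z) \<noteq> 0"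
      using ne by (auto simp: filterlim_iff)
    have "gsrc G g \<in> nonHausdorff_units G"
      if "g \<in> arrows G" "as_function G T (ginv G g) \<noteq> 0" for g
      using singular_ideal_supp[OF T inv_in[OF that(1)] that(2)] that(1) by (simp add: rng_inv)
    then have "gsrc H (ginv G ` A) \<in> cover_units_sing G"
      by (rule src_cover_units_sing[OF cover_inv_arrow[OF A] _ ev])
    then show "grng H A \<in> cover_units_sing G" by (simp add: cover_src_inv[OF A])
  qed
  then show ?thesis
    using Cstar_cover_map_spec(1)[OF TC] by (auto simp: cover_singular_ideal_def open_supp_def cover_sing_def)
qed

text \<open>In a bisection the non-units of the closure form a relatively closed set, and the source
  map is an open injection. If the closure of their source had interior, they would contain an open
  set of arrows; but they are limits of units, so this open set would contain a unit.\<close>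

lemma nonHausdorff_units_bisection_nowhere_dense:
  assumes U: "open_bisection G U"
  shows "unit_top G interior_of (unit_top G closure_of
    (gsrc G ` ((gtop G closure_of gunits G - gunits G) \<inter> U))) = {}"
proof (rule ccontr)
  define F where "F = gtop G closure_of gunits G - gunits G"
  define N where "N = gsrc G ` (F \<inter> U)"
  note Uo = bisection_openin[OF U]
  assume "unit_top G interior_of (unit_top G closure_of
    (gsrc G ` ((gtop G closure_of gunits G - gunits G) \<inter> U))) \<noteq> {}"
  then obtain W p where W: "openin (unit_top G) W" "p \<in> W" "W \<subseteq> unit_top G closure_of N"
    unfolding interior_of_def N_def F_def by blast
  then have "p \<in> unit_top G closure_of N" by blast
  then obtain q where q: "q \<in> N" "q \<in> W"
    using W(1,2) unfolding in_closure_of by blast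
  \<comment> \<open>Leaving \<open>F\<close> means leaving the closure of the units or being a unit,
    and both conditions are open.\<close>
  have openUF: "openin (gtop G) (U - F)"
  proof -
    have "U - F = U \<inter> ((arrows G - gtop G closure_of gunits G) \<union> gunits G)"
      using openin_subset[OF Uo] by (auto simp: F_def)
    then show ?thesis
      using Uo openin_units by (simp add: openin_Int openin_Un openin_diff)
  qed
  have W': "openin (gtop G) (W \<inter> gsrc G ` U)"
    using W(1) openin_src_image[OF Uo] by (simp add: openin_unit_top_iff openin_Int)
  \<comment> \<open>Within the source of \<open>U\<close>, a point outside \<open>N\<close> is the
    source of an arrow of \<open>U - F\<close>. The sources of these arrows form an open set that is
    disjoint from \<open>N\<close> by injectivity, against the density of \<open>N\<close> in
    \<open>W\<close>.\<close>
  have sub: "W \<inter> gsrc G ` U \<subseteq> N"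
  proof
    fix y assume y: "y \<in> W \<inter> gsrc G ` U"
    show "y \<in> N"
    proof (rule ccontr)
      assume yN: "y \<notin> N"
      define Q where "Q = gsrc G ` (U - F) \<inter> W"
      have yQ: "y \<in> Q" using y yN by (auto simp: N_def Q_def)
      have Q: "openin (unit_top G) Q"
        using W(1) openin_src_image[OF openUF] by (auto simp: openin_unit_top_iff Q_def)
      have "y \<in> unit_top G closure_of N" using y W(3) by blast
      then have "\<forall>T. y \<in> T \<and> openin (unit_top G) T \<longrightarrow> (\<exists>w. w \<in> N \<and> w \<in> T)"
        by (simp add: in_closure_of)
      then obtain w where "w \<in> N" "w \<in> Q" using yQ Q by blast
      then obtain a b where "a \<in> F \<inter> U" "b \<in> U - F" "gsrc G a = gsrc G b"
        by (auto simp: N_def Q_def)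
      then show False using bisection_src_inj[OF U] by blast
    qed
  qed
  define V where "V = U \<inter> {g \<in> arrows G. gsrc G g \<in> W \<inter> gsrc G ` U}"
  have Vo: "openin (gtop G) V"
    unfolding V_def using Uo openin_src_preimage[OF W'] by blast
  have VF: "V \<subseteq> F"
  proof
    fix v assume v: "v \<in> V"
    then obtain a where "a \<in> F \<inter> U" "gsrc G v = gsrc G a" using sub by (auto simp: V_def N_def)
    then show "v \<in> F" using bisection_src_inj[OF U, of v a] v by (auto simp: V_def)
  qed
  obtain a where a: "a \<in> F \<inter> U" "q = gsrc G a" using q(1) by (auto simp: N_def)
  then have "a \<in> V" using q(2) bisection_arrows[OF U] by (auto simp: V_def)
  moreover have "a \<in> gtop G closure_of gunits G" using a by (simp add: F_def)
  ultimately obtain y where "y \<in> gunits G" "y \<in> V" using Vo unfolding in_closure_of by blast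
  then show False using VF by (auto simp: F_def)
qed

text \<open>Baire's theorem for the locally compact Hausdorff unit space. The countable cover by
  bisections cuts the closure of the units minus the units into countably many pieces with nowhere
  dense sources.\<close>

lemma nonHausdorff_units_meagre:
  assumes cov: "countable \<U>" "\<And>U. U \<in> \<U> \<Longrightarrow> open_bisection G U" "\<Union>\<U> = arrows G"
  shows "unit_top G interior_of nonHausdorff_units G = {}"
proof -
  define F where "F = gtop G closure_of gunits G - gunits G"
  define \<G> where "\<G> = (\<lambda>U. unit_top G closure_of (gsrc G ` (F \<inter> U))) ` \<U>"
  have "unit_top G interior_of \<Union>\<G> = {}"
  proof (rule Baire_category_alt)
    show "completely_metrizable_space (unit_top G) \<or> locally_compact_space (unit_top G) \<and> regular_space (unit_top G)"
      using locally_compact_units Hausdorff_units locally_compact_Hausdorff_imp_regular_space by blast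
    show "countable \<G>" using cov(1) by (simp add: \<G>_def)
    show "closedin (unit_top G) T \<and> unit_top G interior_of T = {}" if "T \<in> \<G>" for T
      using that nonHausdorff_units_bisection_nowhere_dense[OF cov(2)] by (auto simp: \<G>_def F_def)
  qed
  moreover have "nonHausdorff_units G \<subseteq> \<Union>\<G>"
  proof
    fix x assume "x \<in> nonHausdorff_units G"
    then obtain h where h: "h \<in> F" "x = gsrc G h" by (auto simp: nonHausdorff_units_def F_def)
    have ha: "h \<in> arrows G" using h(1) closure_of_subset_topspace[of "gtop G"] by (auto simp: F_def)
    then obtain U where U: "U \<in> \<U>" "h \<in> U" using cov(3) by blast
    have "gsrc G ` (F \<inter> U) \<subseteq> unit_top G closure_of (gsrc G ` (F \<inter> U))"
      using bisection_arrows[OF cov(2)[OF U(1)]] by (intro closure_of_subset) (auto simp: src_in src_arrow)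
    then show "x \<in> \<Union>\<G>" using h U by (auto simp: \<G>_def)
  qed
  ultimately show ?thesis
    using interior_of_mono by blast
qed

text \<open>Evaluation at singletons loses nothing of \<open>T\<close>: an arrow \<open>g\<close> of
  its support gives the arrow \<open>{g}\<close> of the support on the cover. The source of
  \<open>{g}\<close> is a singleton in the singular part, and the interior of the preimage of
  \<open>D\<close> lies in that preimage.\<close>

lemma cover_singular_ideal_imp_singular:
  assumes cov: "countable \<U>" "\<And>U. U \<in> \<U> \<Longrightarrow> open_bisection G U" "\<Union>\<U> = arrows G"
    and T: "T \<in> Cstar_red G" and S: "Cstar_cover_map G T \<in> cover_singular_ideal G"
  shows "T \<in> singular_ideal G"
proof -
  have "gsrc G ` open_supp G T \<subseteq> nonHausdorff_units G"
  proof
    fix x assume "x \<in> gsrc G ` open_supp G T"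
    then obtain g where g: "g \<in> arrows G" "as_function G T g \<noteq> 0" "x = gsrc G g"
      by (auto simp: open_supp_def)
    have "{g} \<in> open_supp H (Cstar_cover_map G T)"
      using as_function_singleton[OF T g(1)] g(2) singleton_cover_arrow[OF g(1)] by (simp add: open_supp_def)
    then have "gsrc H {g} \<in> cover_units_sing G"
      using S by (auto simp: cover_singular_ideal_def cover_sing_def)
    then have "{x} \<in> cover_units_sing G"
      using cover_src_singleton[OF g(1)] g(3) by simp
    then have "cover_proj G {x} \<in> nonHausdorff_units G"
      using interior_of_subset unfolding cover_units_sing_def by fastforce
    moreover have "cover_proj G {x} = x"
      using cover_proj_eq[OF singleton_cover_unit, of x x] g by (simp add: src_in src_src)
    ultimately show "x \<in> nonHausdorff_units G" by simp
  qed
  then have "unit_top G interior_of (gsrc G ` open_supp G T) = {}"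
    using interior_of_mono nonHausdorff_units_meagre[OF cov] by blast
  then show ?thesis using T by (simp add: singular_ideal_def)
qed

end

theorem proposition4p15:
  fixes G :: "'g groupoid_data"
  assumes "etale_groupoid G"
    and "\<not> Hausdorff_space (gtop G)"
    and "\<exists>\<U>. countable \<U> \<and> (\<forall>U\<in>\<U>. open_bisection G U) \<and> \<Union>\<U> = arrows G"
  shows "Cstar_cover_map G ` singular_ideal G =
         Cstar_cover_map G ` Cstar_red G \<inter> cover_singular_ideal G"
proof -
  interpret etale_groupoid G by (rule assms(1))
  obtain \<U> where cov: "countable \<U>" "\<And>U. U \<in> \<U> \<Longrightarrow> open_bisection G U" "\<Union>\<U> = arrows G"
    using assms(3) by metis
  \<comment> \<open>An element of the intersection is the image of some \<open>T\<close>, and this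
    same \<open>T\<close> lies in the singular ideal.\<close>
  show ?thesis
    using singular_ideal_cover cover_singular_ideal_imp_singular[OF cov]
    by (auto simp: singular_ideal_def)
qed

end
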